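(* Let $G$ be a primitive-divergent graph with at least five edges, and let $e_1,\dots,e_5$ be five distinct edges of $G$. Then for every prime power $q$, $$c_2(G)_q\equiv -[{}^5\Psi_G(e_1,\dots,e_5)]_q \mod q .$$
   Context: Graphs are finite, possibly with multiple edges and self-loops. $N_G$ is the number of edges and $h_G$ the number of loops (first Betti number) of $G$. A subgraph is a subset of edges. A connected graph $G$ is primitive-divergent if $N_G=2h_G$ and $N_\gamma>2h_\gamma$ for all non-empty strict subgraphs $\gamma\subsetneq G$. The graph polynomial is $\Psi_G=\sum_T\prod_{e\notin T}\alpha_e$, summed over spanning trees $T$ of $G$. Dodgson polynomials: orient the edges of $G$ and let $\mathcal{E}_G$ be the edge-by-vertex incidence matrix ($(\mathcal{E}_G)_{e,v}=1$ if $e$ begins at $v$ and does not end there, $-1$ if $e$ ends at $v$ and does not begin there, $0$ otherwise). Let $A$ be the diagonal matrix with entries $\alpha_e$, and let $M_G$ be obtained from $\begin{pmatrix} A & \mathcal{E}_G\\ -\mathcal{E}_G^T & 0\end{pmatrix}$ by deleting the row and column indexed by one chosen vertex (all choices are fixed once and for all for $G$). For sets of edges $I,J,K$ with $|I|=|J|$, $\Psi^{I,J}_{G,K}$ is the determinant of the matrix obtained from $M_G$ by removing the rows indexed by $I$ and the columns indexed by $J$, and setting $\alpha_e=0$ for $e\in K$ ($K$ omitted if empty). The five-invariant of distinct edges $i,j,k,l,m$ is, up to sign, $${}^5\Psi_G(i,j,k,l,m)=\pm\det\begin{pmatrix}\Psi^{ij,kl}_{G,m}&\Psi^{ik,jl}_{G,m}\\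 \Psi^{ijm,klm}_G&\Psi^{ikm,jlm}_G\end{pmatrix};$$ up to sign it does not depend on the order of the five edges. For polynomials $P_1,\dots,P_\ell$ with integer coefficients, $[P_1,\dots,P_\ell]_q$ is the number of common zeros over the field $\mathbb{F}_q$ in affine space with coordinates the remaining variables (dimension $N_G-5$ for ${}^5\Psi_G$, $N_G$ for $\Psi_G$). The invariant $c_2(G)_q\in\mathbb{Z}/q\mathbb{Z}$ is defined by $[\Psi_G]_q\equiv c_2(G)_q\,q^2\mod q^3$. *)

theory Defs
  imports
    "HOL-Library.Poly_Mapping"
    "HOL-Library.FuncSet"
    "HOL-Library.Cardinality"
    "HOL-Number_Theory.Cong"
    "Graph_Theory.Digraph_Component"
    "Jordan_Normal_Form.Determinant"
    "Jordan_Normal_Form.DL_Submatrix"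
begin

section \<open>Integer polynomials in edge variables and point counts\<close>

text \<open>The ring of polynomials over the integers with one variable for each element of \<open>'e\<close>:
  finitely supported maps from exponent vectors to coefficients.\<close>

type_synonym 'e ipoly = "('e \<Rightarrow>\<^sub>0 nat) \<Rightarrow>\<^sub>0 int"

definition var :: "'e \<Rightarrow> 'e ipoly" where
  "var e = Poly_Mapping.single (Poly_Mapping.single e 1) 1"

definition eval_ipoly :: "('e \<Rightarrow> 'k::comm_ring_1) \<Rightarrow> 'e ipoly \<Rightarrow> 'k" where
  "eval_ipoly a P =
     (\<Sum>m\<in>Poly_Mapping.keys P. of_int (Poly_Mapping.lookup P m) *
        (\<Prod>e\<in>Poly_Mapping.keys m. a e ^ Poly_Mapping.lookup m e))"

text \<open>The number of zeros of \<open>P\<close> over the finite field \<open>'k\<close> in the affine space with coordinates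
  indexed by \<open>X\<close>. Meant for \<open>P\<close> all of whose variables lie in \<open>X\<close>; outside of \<open>X\<close> points take an
  irrelevant dummy value. Finite fields are types here, so a statement for all
  \<open>'k :: {finite, field}\<close> is a statement for all prime powers \<open>q = CARD('k)\<close>.\<close>

definition point_count :: "'k::{finite,field} itself \<Rightarrow> 'e set \<Rightarrow> 'e ipoly \<Rightarrow> nat" where
  "point_count _ X P = card {a :: 'e \<Rightarrow> 'k. a \<in> X \<rightarrow>\<^sub>E UNIV \<and> eval_ipoly a P = 0}"


section \<open>Graphs\<close>

text \<open>An undirected multigraph, possibly with self-loops, together with an orientation of its
  edges is a \<^typ>\<open>('v, 'e) pre_digraph\<close> satisfying \<^locale>\<open>fin_digraph\<close>. All notions in this
  section ignore the orientation. A set \<open>\<gamma>\<close> of edges is identified with the subgraph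
  \<open>G\<lparr>arcs := \<gamma>\<rparr>\<close> on all vertices; isolated vertices do not affect the Betti number.\<close>

definition components :: "('v, 'e) pre_digraph \<Rightarrow> 'v set set" where
  "components G = pre_digraph.sccs_verts (with_proj (mk_symmetric G))"

text \<open>The first Betti number, through the Euler characteristic.\<close>

definition loop_number :: "('v, 'e) pre_digraph \<Rightarrow> int" where
  "loop_number G = int (card (arcs G)) - int (card (verts G)) + int (card (components G))"

definition primitive_divergent :: "('v, 'e) pre_digraph \<Rightarrow> bool" where
  "primitive_divergent G \<longleftrightarrow>
     Digraph_Component.connected G \<and>
     int (card (arcs G)) = 2 * loop_number G \<and>
     (\<forall>\<gamma>. \<gamma> \<noteq> {} \<and> \<gamma> \<subset> arcs G \<longrightarrow> int (card \<gamma>) > 2 * loop_number (G\<lparr>arcs := \<gamma>\<rparr>))"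

text \<open>Cycles of the underlying undirected multigraph: \<open>es ! i\<close> joins \<open>vs ! i\<close> to the cyclically next
  vertex. Length one is a self-loop, length two a pair of parallel edges. The library's
  \<^const>\<open>forest\<close> and \<^const>\<open>Digraph_Component.spanning_tree\<close> only exclude directed cycles and
  are therefore not usable here.\<close>

definition undirected_cycle :: "('v, 'e) pre_digraph \<Rightarrow> 'v list \<Rightarrow> 'e list \<Rightarrow> bool" where
  "undirected_cycle G vs es \<longleftrightarrow>
     es \<noteq> [] \<and> length vs = length es \<and> distinct vs \<and> distinct es \<and> set es \<subseteq> arcs G \<and>
     (\<forall>i < length es.
        {tail G (es ! i), head G (es ! i)} = {vs ! i, vs ! (Suc i mod length es)})"

definition undirected_spanning_tree :: "('v, 'e) pre_digraph \<Rightarrow> 'e set \<Rightarrow> bool" where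
  "undirected_spanning_tree G T \<longleftrightarrow>
     T \<subseteq> arcs G \<and> Digraph_Component.connected (G\<lparr>arcs := T\<rparr>) \<and>
     \<not> (\<exists>vs es. undirected_cycle (G\<lparr>arcs := T\<rparr>) vs es)"

definition graph_polynomial :: "('v, 'e) pre_digraph \<Rightarrow> 'e ipoly" where
  "graph_polynomial G =
     (\<Sum>T | undirected_spanning_tree G T. \<Prod>e\<in>arcs G - T. var e)"

text \<open>The class in \<open>\<int>/q\<int>\<close> is represented by its representative in \<open>{0..<q}\<close>, where
  \<open>q = CARD('k)\<close>; there is at most one such representative.\<close>

definition c2_invariant :: "'k::{finite,field} itself \<Rightarrow> ('v, 'e) pre_digraph \<Rightarrow> int" where
  "c2_invariant k G =
     (THE c. c \<in> {0..<int CARD('k)} \<and>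
        [int (point_count k (arcs G) (graph_polynomial G)) = c * int CARD('k) ^ 2]
          (mod (int CARD('k) ^ 3)))"


section \<open>Dodgson polynomials and the five-invariant\<close>

text \<open>Throughout, \<open>es\<close> enumerates the edges and \<open>vs\<close> enumerates all vertices but the deleted one.\<close>

definition incidence_mat ::
    "('v, 'e) pre_digraph \<Rightarrow> 'e list \<Rightarrow> 'v list \<Rightarrow> 'e ipoly mat" where
  "incidence_mat G es vs = mat (length es) (length vs) (\<lambda>(r, c).
     if tail G (es ! r) = vs ! c \<and> head G (es ! r) \<noteq> vs ! c then 1
     else if head G (es ! r) = vs ! c \<and> tail G (es ! r) \<noteq> vs ! c then - 1
     else 0)"

text \<open>The matrix \<open>M\<^sub>G\<close> with the variables of the edges in \<open>K\<close> set to zero.\<close>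

definition graph_mat ::
    "('v, 'e) pre_digraph \<Rightarrow> 'e list \<Rightarrow> 'v list \<Rightarrow> 'e set \<Rightarrow> 'e ipoly mat" where
  "graph_mat G es vs K = four_block_mat
     (mat_diag (length es) (\<lambda>r. if es ! r \<in> K then 0 else var (es ! r)))
     (incidence_mat G es vs)
     (- transpose_mat (incidence_mat G es vs))
     (0\<^sub>m (length vs) (length vs))"

definition edge_positions :: "'e list \<Rightarrow> 'e set \<Rightarrow> nat set" where
  "edge_positions es I = {r. r < length es \<and> es ! r \<in> I}"

definition dodgson ::
    "('v, 'e) pre_digraph \<Rightarrow> 'e list \<Rightarrow> 'v list \<Rightarrow> 'e set \<Rightarrow> 'e set \<Rightarrow> 'e set \<Rightarrow> 'e ipoly" where
  "dodgson G es vs I J K =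
     det (submatrix (graph_mat G es vs K) (- edge_positions es I) (- edge_positions es J))"

definition five_invariant ::
    "('v, 'e) pre_digraph \<Rightarrow> 'e list \<Rightarrow> 'v list \<Rightarrow> 'e \<Rightarrow> 'e \<Rightarrow> 'e \<Rightarrow> 'e \<Rightarrow> 'e \<Rightarrow> 'e ipoly" where
  "five_invariant G es vs i j k l m = det (mat_of_rows_list 2
     [[dodgson G es vs {i,j} {k,l} {m},     dodgson G es vs {i,k} {j,l} {m}],
      [dodgson G es vs {i,j,m} {k,l,m} {},  dodgson G es vs {i,k,m} {j,l,m} {}]])"

end

theory Submission
  imports Defs "HOL-Library.Function_Algebras" "HOL-Library.Product_Plus"
begin

text \<open>Let \<open>q\<close> be the number of elements of the field, let \<open>n\<close> be one less than the number of vertices and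
\<open>N\<close> the number of edges. Connectedness and the number of loops give \<open>N = 2 * n\<close>. Write \<open>[f]\<close> for the
number of zeros of \<open>f\<close>.

By the matrix-tree theorem the graph polynomial is the determinant of \<open>M\<^sub>G\<close>, so a point \<open>\<alpha>\<close> is a zero
iff \<open>M\<^sub>G\<close> has a kernel vector \<open>(y, z) \<noteq> 0\<close> there: \<open>y\<close> is a cycle (\<open>E\<^sup>T y = 0\<close>), \<open>z\<close> is a potential on
the vertices, and \<open>\<alpha>\<^sub>r y\<^sub>r + (E z)\<^sub>r = 0\<close> for every edge \<open>r\<close>. For a fixed cycle \<open>y\<close> these equations are
linear in the unknowns \<open>z\<close> and \<open>\<alpha>\<close> together, so the number of solutions is a power of \<open>q\<close> whose exponent is
at least the number of unknowns minus the number of equations. Summed over \<open>y\<close> this shows that the total number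
of kernel vectors, over all \<open>\<alpha>\<close>, is divisible by a power of \<open>q\<close>. As a kernel of dimension \<open>c\<close> has
\<open>q\<^sup>c\<close> elements, which is \<open>1\<close> or \<open>0\<close> modulo \<open>q\<close> according to whether it is trivial, the number of zeros of a
minor, or of common zeros of two minors, is divisible by \<open>q\<close> whenever there are enough variables
(\<open>dvd_card_singular\<close>, \<open>dvd_card_singular_pair\<close>). This elementary argument takes the place of the theorem of
Ax and Katz. Counting pairs of kernel vectors in the same way gives divisibility by \<open>q\<^sup>3\<close> for the graph
polynomial of a graph with fewer than \<open>2 * n\<close> edges (\<open>cube_dvd_num_singular\<close>).

With this at hand the edge variables are eliminated one at a time. The polynomials that occur are affine in the variable to be eliminated, and
\<open>[\<alpha> A + B] = q\<^sup>k - [A] + q [A, B]\<close> for \<open>k\<close> remaining variables, and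
\<open>[\<alpha> A + B, \<alpha> C + D] = q [A, B, C, D] + [A D - B C] - [A, C]\<close>.
The resultant \<open>A D - B C\<close> of two Dodgson polynomials is governed by the Pluecker relation between determinants
that differ in two rows (\<open>rdet_pluecker\<close>), and most of the other terms are killed by the divisibility results.
In the usual notation, the edges 1 and 2 lead from \<open>[\<Psi>]\<close> to \<open>q [\<Psi>\<^bsup>1,2\<^esup>]\<close> modulo \<open>q\<^sup>3\<close>
(\<open>num_singular_double_elimination\<close>), the edges 3 and 4 lead to \<open>- q\<^sup>2 [\<Psi>\<^bsup>13,24\<^esup>, \<Psi>\<^bsup>14,23\<^esup>]\<close>
(\<open>num_singular_eq_pair_count\<close>), and the resultant of the last two polynomials in the fifth variable is the
five-invariant (\<open>num_singular_eq_five_invariant_count\<close>). Thus \<open>[\<Psi>]\<close> is congruent to \<open>- q\<^sup>2\<close> times the number of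
zeros of the five-invariant modulo \<open>q\<^sup>3\<close>.\<close>

section \<open>Homogeneous linear systems over a finite field\<close>

text \<open>A nonzero linear functional on a finite vector space \<open>S\<close> splits it into \<open>q\<close> translates of its kernel.
The scalar multiplication is a parameter because the spaces used below are products of function spaces.\<close>

lemma card_hyperplane:
  fixes S :: "'v::ab_group_add set" and sc :: "'k::{finite,field} \<Rightarrow> 'v \<Rightarrow> 'v" and f :: "'v \<Rightarrow> 'k"
  assumes closed: "\<And>u v. u \<in> S \<Longrightarrow> v \<in> S \<Longrightarrow> u + v \<in> S" "\<And>u v. u \<in> S \<Longrightarrow> v \<in> S \<Longrightarrow> u - v \<in> S"
      "\<And>c u. u \<in> S \<Longrightarrow> sc c u \<in> S"
    and add: "\<And>u v. f (u + v) = f u + f v" and scale: "\<And>c u. f (sc c u) = c * f u"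
    and u: "u \<in> S" "f u \<noteq> 0"
  shows "card {v \<in> S. f v = 0} * CARD('k) = card S"
proof -
  define u1 where "u1 = sc (inverse (f u)) u"
  have u1: "u1 \<in> S" "f u1 = 1" using u closed scale unfolding u1_def by auto
  have diff: "f (v - w) = f v - f w" for v w
    using add[of "v - w" w] by (simp add: algebra_simps)
  let ?U = "{v \<in> S. f v = 0}"
  have "bij_betw (\<lambda>(w, t). w + sc t u1) (?U \<times> UNIV) S"
  proof (rule bij_betw_byWitness[where f' = "\<lambda>w. (w - sc (f w) u1, f w)"])
    show "\<forall>a\<in>?U \<times> UNIV. (\<lambda>w. (w - sc (f w) u1, f w)) ((\<lambda>(w, t). w + sc t u1) a) = a"
      using add scale u1 by auto
    show "(\<lambda>(w, t). w + sc t u1) ` (?U \<times> UNIV) \<subseteq> S"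
      using closed u1 by auto
    show "(\<lambda>w. (w - sc (f w) u1, f w)) ` S \<subseteq> ?U \<times> UNIV"
      using closed diff scale u1 by auto
  qed (use scale u1 in simp)
  from bij_betw_same_card[OF this] show ?thesis by (simp add: card_cartesian_product)
qed

text \<open>Every equation either holds throughout or lowers the dimension by one.\<close>

lemma card_solutions_ge:
  fixes S :: "'v::ab_group_add set" and sc :: "'k::{finite,field} \<Rightarrow> 'v \<Rightarrow> 'v" and f :: "'j \<Rightarrow> 'v \<Rightarrow> 'k"
  assumes "finite J" and card: "card S = CARD('k) ^ d"
    and closed: "\<And>u v. u \<in> S \<Longrightarrow> v \<in> S \<Longrightarrow> u + v \<in> S" "\<And>u v. u \<in> S \<Longrightarrow> v \<in> S \<Longrightarrow> u - v \<in> S"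
      "\<And>c u. u \<in> S \<Longrightarrow> sc c u \<in> S"
    and add: "\<And>j u v. j \<in> J \<Longrightarrow> f j (u + v) = f j u + f j v"
    and scale: "\<And>j c u. j \<in> J \<Longrightarrow> f j (sc c u) = c * f j u"
  shows "\<exists>d'. card {u \<in> S. \<forall>j\<in>J. f j u = 0} = CARD('k) ^ d' \<and> d \<le> d' + card J"
  using \<open>finite J\<close> add scale
proof (induction J rule: finite_induct)
  case empty
  then show ?case using card by auto
next
  case (insert j J)
  define T where "T = {u \<in> S. \<forall>j\<in>J. f j u = 0}"
  from insert obtain d' where d': "card T = CARD('k) ^ d'" "d \<le> d' + card J"
    unfolding T_def by auto
  have T: "{u \<in> S. \<forall>i\<in>insert j J. f i u = 0} = {u \<in> T. f j u = 0}" by (auto simp: T_def)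
  have diff: "f i (u - v) = f i u - f i v" if "i \<in> insert j J" for i u v
    using insert.prems(1)[OF that, of "u - v" v] by (simp add: algebra_simps)
  show ?case
  proof (cases "\<forall>u\<in>T. f j u = 0")
    case True
    then have "{u \<in> T. f j u = 0} = T" by auto
    then show ?thesis unfolding T using d' insert.hyps by (auto intro!: exI[of _ d'])
  next
    case False
    then obtain u where u: "u \<in> T" "f j u \<noteq> 0" by auto
    have c: "card {u \<in> T. f j u = 0} * CARD('k) = CARD('k) ^ d'"
      unfolding d'(1)[symmetric]
      by (rule card_hyperplane[where sc = sc and S = T and f = "f j" and u = u])
        (use u closed insert.prems diff in \<open>auto simp: T_def\<close>)
    have "d' \<noteq> 0"
    proof
      assume "d' = 0"
      then have "CARD('k) = 1" using c by simp
      moreover have "card {0::'k, 1} \<le> CARD('k)" by (rule card_mono) auto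
      ultimately show False by simp
    qed
    then obtain d'' where "d' = Suc d''" by (cases d') auto
    with c have "card {u \<in> T. f j u = 0} = CARD('k) ^ d''" by simp
    then show ?thesis unfolding T using d' insert.hyps \<open>d' = Suc d''\<close> by (intro exI[of _ d'']) auto
  qed
qed

text \<open>Vectors indexed by a set \<open>X\<close> of edges or vertices are functions that vanish outside \<open>X\<close>, rather than
extensional functions, so that they are closed under pointwise addition.\<close>

definition supp :: "nat set \<Rightarrow> (nat \<Rightarrow> 'k::zero) set" where
  "supp X = {f. \<forall>i. i \<notin> X \<longrightarrow> f i = 0}"

definition smul :: "'k::times \<Rightarrow> (nat \<Rightarrow> 'k) \<Rightarrow> nat \<Rightarrow> 'k" where
  "smul c f = (\<lambda>i. c * f i)"

lemma smul_apply [simp]: "smul c f i = c * f i"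
  by (simp add: smul_def)

lemma supp_closed:
  fixes u v :: "nat \<Rightarrow> 'k::field"
  shows "u \<in> supp X \<Longrightarrow> v \<in> supp X \<Longrightarrow> u + v \<in> supp X" "u \<in> supp X \<Longrightarrow> v \<in> supp X \<Longrightarrow> u - v \<in> supp X"
    "u \<in> supp X \<Longrightarrow> smul c u \<in> supp X" "0 \<in> supp X"
  by (auto simp: supp_def)

lemma supp_insert_bij:
  assumes "x \<notin> X"
  shows "bij_betw (\<lambda>(f, t). f(x := t)) (supp X \<times> UNIV) (supp (insert x X) :: (nat \<Rightarrow> 'k::zero) set)"
  by (rule bij_betw_byWitness[where f' = "\<lambda>f. (f(x := 0), f x)"])
    (use assms in \<open>auto simp: supp_def fun_eq_iff\<close>)

lemma finite_supp [simp]: "finite X \<Longrightarrow> finite (supp X :: (nat \<Rightarrow> 'k::{finite,zero}) set)"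
proof (induction X rule: finite_induct)
  case empty
  have "(supp {} :: (nat \<Rightarrow> 'k) set) = {\<lambda>_. 0}" by (auto simp: supp_def)
  then show ?case by simp
next
  case (insert x X)
  then have "finite ((supp X :: (nat \<Rightarrow> 'k) set) \<times> (UNIV :: 'k set))" by simp
  then show ?case using bij_betw_finite[OF supp_insert_bij[OF insert.hyps(2)]] by blast
qed

lemma card_supp: "finite X \<Longrightarrow> card (supp X :: (nat \<Rightarrow> 'k::{finite,zero}) set) = CARD('k) ^ card X"
proof (induction X rule: finite_induct)
  case empty
  have "(supp {} :: (nat \<Rightarrow> 'k) set) = {\<lambda>_. 0}" by (auto simp: supp_def)
  then show ?case by simp
next
  case (insert x X)
  then show ?case using bij_betw_same_card[OF supp_insert_bij[of x X, where 'k = 'k], symmetric]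
    by (simp add: card_cartesian_product)
qed

lemma sum_supp_insert:
  assumes "x \<notin> X" "finite X"
  shows "(\<Sum>f\<in>supp (insert x X). g f) = (\<Sum>f\<in>supp X. \<Sum>t\<in>UNIV. g (f(x := t :: 'k::{finite,zero})))"
  using sum.reindex_bij_betw[OF supp_insert_bij[OF assms(1)], of g]
  by (simp add: sum.cartesian_product split_beta)

lemma card_eq_sum_of_bool: "finite A \<Longrightarrow> card {x \<in> A. P x} = (\<Sum>x\<in>A. of_bool (P x))"
  by (simp add: Int_def)

lemma card_pairs_eq_sum:
  assumes "finite A" "finite B"
  shows "card {(x, y). x \<in> A \<and> y \<in> B \<and> R x y} = (\<Sum>x\<in>A. \<Sum>y\<in>B. of_bool (R x y))"
proof -
  have "{(x, y). x \<in> A \<and> y \<in> B \<and> R x y} = {p \<in> A \<times> B. case p of (x, y) \<Rightarrow> R x y}" by auto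
  then show ?thesis
    using assms by (simp only: card_eq_sum_of_bool finite_cartesian_product sum.cartesian_product)
      (simp add: split_beta)
qed

section \<open>Kernel vectors and powers of q\<close>

text \<open>In this locale \<open>E\<close> is an arbitrary \<open>N\<close> by \<open>n\<close> matrix. Rows correspond to edges, columns to the vertices
other than the deleted one.\<close>

locale incidence =
  fixes E :: "nat \<Rightarrow> nat \<Rightarrow> 'k::{finite,field}" and N n :: nat and q :: int
  assumes q_def: "q = int CARD('k)"
begin

text \<open>The coboundary of the potential \<open>z\<close>, at the edge \<open>r\<close>.\<close>

definition cobd :: "nat \<Rightarrow> (nat \<Rightarrow> 'k) \<Rightarrow> 'k" where
  "cobd r z = (\<Sum>j<n. E r j * z j)"

text \<open>The vectors of the cycle space that vanish on \<open>P\<close>.\<close>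

definition cycles :: "nat set \<Rightarrow> (nat \<Rightarrow> 'k) set" where
  "cycles P = {y \<in> supp ({..<N} - P). \<forall>i<n. (\<Sum>r<N. E r i * y r) = 0}"

definition solves :: "nat set \<Rightarrow> nat set \<Rightarrow> (nat \<Rightarrow> 'k) \<Rightarrow> (nat \<Rightarrow> 'k) \<Rightarrow> (nat \<Rightarrow> 'k) \<Rightarrow> bool" where
  "solves X Q a y z \<longleftrightarrow> (\<forall>r\<in>X. a r * y r + cobd r z = 0) \<and> (\<forall>r\<in>Q. cobd r z = 0)"

text \<open>The kernel of a matrix obtained from \<open>M\<^sub>G\<close>: the columns in \<open>P\<close> are deleted, the edges in \<open>X\<close> have their
variable on the diagonal, the edges in \<open>Q\<close> have a zero there, and the rows of all other edges are deleted.\<close>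

definition Ker :: "nat set \<Rightarrow> nat set \<Rightarrow> nat set \<Rightarrow> (nat \<Rightarrow> 'k) \<Rightarrow> ((nat \<Rightarrow> 'k) \<times> (nat \<Rightarrow> 'k)) set" where
  "Ker X P Q a = {(y, z). y \<in> cycles P \<and> z \<in> supp {..<n} \<and> solves X Q a y z}"

lemma cobd_lin [simp]: "cobd r (u + v) = cobd r u + cobd r v" "cobd r (smul c u) = c * cobd r u" "cobd r 0 = 0"
   "cobd r (u - v) = cobd r u - cobd r v"
  by (simp_all add: cobd_def algebra_simps sum.distrib sum_distrib_left sum_subtractf)

lemma finite_cycles [simp]: "finite (cycles P)"
  by (simp add: cycles_def)

lemma cycles_closed:
  "u \<in> cycles P \<Longrightarrow> v \<in> cycles P \<Longrightarrow> u + v \<in> cycles P"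
  "u \<in> cycles P \<Longrightarrow> v \<in> cycles P \<Longrightarrow> u - v \<in> cycles P"
  "u \<in> cycles P \<Longrightarrow> smul c u \<in> cycles P" "0 \<in> cycles P"
  by (simp_all add: cycles_def supp_closed algebra_simps sum.distrib sum_subtractf)
    (simp add: mult.left_commute[of _ c] sum_distrib_left[symmetric])

lemma solves_closed:
  "solves X Q a y z \<Longrightarrow> solves X Q a y' z' \<Longrightarrow> solves X Q a (y + y') (z + z')"
  "solves X Q a y z \<Longrightarrow> solves X Q a y' z' \<Longrightarrow> solves X Q a (y - y') (z - z')"
  "solves X Q a y z \<Longrightarrow> solves X Q a (smul c y) (smul c z)" "solves X Q a 0 0"
proof -
  assume 1: "solves X Q a y z"
  show "solves X Q a (smul c y) (smul c z)"
    using 1 by (simp add: solves_def mult.left_commute[of _ c] distrib_left[symmetric])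
  assume 2: "solves X Q a y' z'"
  have e: "a r * (y + y') r + cobd r (z + z') = (a r * y r + cobd r z) + (a r * y' r + cobd r z')"
    "a r * (y - y') r + cobd r (z - z') = (a r * y r + cobd r z) - (a r * y' r + cobd r z')" for r
    by (simp_all add: algebra_simps)
  show "solves X Q a (y + y') (z + z')" "solves X Q a (y - y') (z - z')"
    using 1 2 unfolding solves_def e by simp_all
qed (simp add: solves_def)

lemma Ker_subspace:
  "u \<in> Ker X P Q a \<Longrightarrow> v \<in> Ker X P Q a \<Longrightarrow> u + v \<in> Ker X P Q a"
  "u \<in> Ker X P Q a \<Longrightarrow> v \<in> Ker X P Q a \<Longrightarrow> u - v \<in> Ker X P Q a"
  "u \<in> Ker X P Q a \<Longrightarrow> map_prod (smul c) (smul c) u \<in> Ker X P Q a"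
  "0 \<in> Ker X P Q a"
  by (auto simp: Ker_def cycles_closed solves_closed supp_closed zero_prod_def)

lemma finite_Ker [simp]: "finite (Ker X P Q a)"
  by (rule finite_subset[of _ "cycles P \<times> supp {..<n}"]) (auto simp: Ker_def)

lemma zero_in_Ker: "(0, 0) \<in> Ker X P Q a"
  using Ker_subspace(4) by (simp add: zero_prod_def)

lemma card_Ker_ge:
  assumes "finite X" "finite Q"
  shows "\<exists>d. card (Ker X P Q a) = CARD('k) ^ d \<and> card ({..<N} - P) \<le> d + card X + card Q"
proof -
  let ?J = "{..<n} <+> (X <+> Q)"
  let ?f = "\<lambda>j (y, z). case j of Inl i \<Rightarrow> \<Sum>r<N. E r i * y r | Inr (Inl r) \<Rightarrow> a r * y r + cobd r z
       | Inr (Inr r) \<Rightarrow> cobd r z"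
  let ?S = "supp ({..<N} - P) \<times> supp {..<n} :: ((nat \<Rightarrow> 'k) \<times> (nat \<Rightarrow> 'k)) set"
  have "\<exists>d'. card {u \<in> ?S. \<forall>j\<in>?J. ?f j u = 0} = CARD('k) ^ d' \<and>
      card ({..<N} - P) + n \<le> d' + card ?J"
    apply (rule card_solutions_ge[where sc = "\<lambda>c. map_prod (smul c) (smul c)"])
    using assms
    by (auto simp: card_cartesian_product card_supp power_add supp_closed algebra_simps sum.distrib
        sum_distrib_left split: sum.splits)
  moreover have "u \<in> ?S \<and> (\<forall>j\<in>?J. ?f j u = 0) \<longleftrightarrow> u \<in> Ker X P Q a" for u
  proof -
    obtain y z where u: "u = (y, z)" by (cases u)
    have "(\<forall>j\<in>?J. ?f j u = 0) \<longleftrightarrow> (\<forall>i\<in>{..<n}. ?f (Inl i) u = 0) \<and>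
        (\<forall>r\<in>X. ?f (Inr (Inl r)) u = 0) \<and> (\<forall>r\<in>Q. ?f (Inr (Inr r)) u = 0)"
      unfolding Plus_def ball_Un by blast
    then show ?thesis by (auto simp: u Ker_def cycles_def solves_def)
  qed
  then have "{u \<in> ?S. \<forall>j\<in>?J. ?f j u = 0} = Ker X P Q a" by blast
  ultimately show ?thesis using assms by (force simp: card_Plus)
qed

lemma card_Ker_pow:
  assumes "finite X" "finite Q"
  shows "\<exists>d. card (Ker X P Q a) = CARD('k) ^ d"
  using card_Ker_ge[OF assms] by blast

end

text \<open>A factor that is \<open>1\<close> modulo \<open>q\<close> is coprime to \<open>q\<close>.\<close>

lemma dvd_cancel_unit_mod:
  fixes q :: int
  assumes "q ^ m dvd (1 + q * t) * F"
  shows "q ^ m dvd F"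
proof -
  have "coprime q (1 + q * t)"
    by (rule coprimeI) (metis dvd_add_left_iff dvd_mult2)
  then show ?thesis using assms by (simp add: coprime_dvd_mult_right_iff)
qed

context incidence
begin

lemma int_card_supp: "finite X \<Longrightarrow> int (card (supp X :: (nat \<Rightarrow> 'k) set)) = q ^ card X"
  by (simp add: card_supp q_def)

definition singular :: "nat set \<Rightarrow> nat set \<Rightarrow> nat set \<Rightarrow> (nat \<Rightarrow> 'k) \<Rightarrow> bool" where
  "singular X P Q a \<longleftrightarrow> Ker X P Q a \<noteq> {(0, 0)}"

lemma card_Ker_sum:
  "card (Ker X P Q a) = (\<Sum>y\<in>cycles P. \<Sum>z\<in>supp {..<n}. of_bool (solves X Q a y z))"
  unfolding Ker_def by (rule card_pairs_eq_sum) auto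

abbreviation sols where
  "sols X Q y \<equiv> {(z, a). z \<in> supp {..<n} \<and> a \<in> supp X \<and> solves X Q a y z}"

abbreviation joint_sols where
  "joint_sols X Q y X' Q' y' \<equiv> {(z, z', a). z \<in> supp {..<n} \<and> z' \<in> supp {..<n} \<and> a \<in> supp X \<and>
     solves X Q a y z \<and> solves X' Q' a y' z'}"

text \<open>For a fixed cycle \<open>y\<close> the potential and the edge variables are the unknowns of a homogeneous linear
system; each edge of \<open>X\<close> contributes one unknown and one equation.\<close>

lemma card_sol1:
  assumes "finite X" "finite Q"
  shows "\<exists>d. card (sols X Q y) = CARD('k) ^ d \<and> n \<le> d + card Q"
proof -
  let ?J = "X <+> Q"
  let ?f = "\<lambda>j (z, a). case j of Inl r \<Rightarrow> a r * y r + cobd r z | Inr r \<Rightarrow> cobd r z"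
  let ?S = "supp {..<n} \<times> supp X :: ((nat \<Rightarrow> 'k) \<times> (nat \<Rightarrow> 'k)) set"
  have "\<exists>d'. card {u \<in> ?S. \<forall>j\<in>?J. ?f j u = 0} = CARD('k) ^ d' \<and> n + card X \<le> d' + card ?J"
    apply (rule card_solutions_ge[where sc = "\<lambda>c. map_prod (smul c) (smul c)"])
    using assms
    by (auto simp: card_cartesian_product card_supp power_add supp_closed algebra_simps split: sum.splits)
  moreover have "u \<in> ?S \<and> (\<forall>j\<in>?J. ?f j u = 0) \<longleftrightarrow> u \<in> sols X Q y" for u
  proof -
    obtain z a where u: "u = (z, a)" by (cases u)
    have "(\<forall>j\<in>?J. ?f j u = 0) \<longleftrightarrow> (\<forall>r\<in>X. ?f (Inl r) u = 0) \<and> (\<forall>r\<in>Q. ?f (Inr r) u = 0)"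
      unfolding Plus_def ball_Un by blast
    then show ?thesis by (auto simp: u solves_def)
  qed
  then have "{u \<in> ?S. \<forall>j\<in>?J. ?f j u = 0} = sols X Q y" by blast
  ultimately show ?thesis using assms by (force simp: card_Plus)
qed

lemma card_sol2:
  assumes "finite X" "finite Q" "finite X'" "finite Q'"
  shows "\<exists>d. card (joint_sols X Q y X' Q' y')
     = CARD('k) ^ d \<and> 2 * n \<le> d + card Q + card X' + card Q'"
proof -
  let ?J = "(X <+> Q) <+> (X' <+> Q')"
  let ?f = "\<lambda>j (z, z', a). case j of Inl (Inl r) \<Rightarrow> a r * y r + cobd r z | Inl (Inr r) \<Rightarrow> cobd r z
     | Inr (Inl r) \<Rightarrow> a r * y' r + cobd r z' | Inr (Inr r) \<Rightarrow> cobd r z'"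
  let ?S = "supp {..<n} \<times> supp {..<n} \<times> supp X :: ((nat \<Rightarrow> 'k) \<times> (nat \<Rightarrow> 'k) \<times> (nat \<Rightarrow> 'k)) set"
  let ?T = "joint_sols X Q y X' Q' y'"
  have "\<exists>d'. card {u \<in> ?S. \<forall>j\<in>?J. ?f j u = 0} = CARD('k) ^ d' \<and> 2 * n + card X \<le> d' + card ?J"
    apply (rule card_solutions_ge[where sc = "\<lambda>c. map_prod (smul c) (map_prod (smul c) (smul c))"])
    using assms
    by (auto simp: card_cartesian_product card_supp power_add supp_closed algebra_simps mult_2_right split: sum.splits)
  moreover have "u \<in> ?S \<and> (\<forall>j\<in>?J. ?f j u = 0) \<longleftrightarrow> u \<in> ?T" for u
  proof -
    obtain z z' a where u: "u = (z, z', a)" by (cases u)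
    have "(\<forall>j\<in>?J. ?f j u = 0) \<longleftrightarrow> (\<forall>r\<in>X. ?f (Inl (Inl r)) u = 0) \<and> (\<forall>r\<in>Q. ?f (Inl (Inr r)) u = 0)
      \<and> (\<forall>r\<in>X'. ?f (Inr (Inl r)) u = 0) \<and> (\<forall>r\<in>Q'. ?f (Inr (Inr r)) u = 0)"
      unfolding Plus_def ball_Un by blast
    then show ?thesis by (auto simp: u solves_def)
  qed
  then have "{u \<in> ?S. \<forall>j\<in>?J. ?f j u = 0} = ?T" by blast
  ultimately show ?thesis using assms by (force simp: card_Plus)
qed

text \<open>The sum counts triples \<open>(y, z, \<alpha>)\<close>. Summing over \<open>y\<close> last makes every inner count the size of a linear
solution space.\<close>

lemma dvd_sum_card_Ker:
  assumes "finite X" "finite Q"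
  shows "q ^ (n - card Q) dvd (\<Sum>a\<in>supp X. int (card (Ker X P Q a)))"
proof -
  have "(\<Sum>a\<in>supp X. int (card (Ker X P Q a)))
      = (\<Sum>y\<in>cycles P. \<Sum>z\<in>supp {..<n}. \<Sum>a\<in>supp X. of_bool (solves X Q a y z))"
    by (simp only: card_Ker_sum of_nat_sum of_nat_of_bool)
      (subst sum.swap, rule sum.cong[OF refl], rule sum.swap)
  also have "\<dots> = (\<Sum>y\<in>cycles P. int (card (sols X Q y)))"
    using assms by (subst card_pairs_eq_sum) simp_all
  also have "q ^ (n - card Q) dvd \<dots>"
  proof (rule dvd_sum)
    fix y
    from card_sol1[OF assms, of y] obtain d where d: "n \<le> d + card Q"
      "card (sols X Q y) = CARD('k) ^ d" by blast
    then show "q ^ (n - card Q) dvd int (card (sols X Q y))"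
      by (simp add: q_def le_imp_power_dvd)
  qed
  finally show ?thesis .
qed

lemma card_sol2_sum:
  assumes "finite X"
  shows "card (joint_sols X Q y X' Q' y')
    = (\<Sum>a\<in>supp X. \<Sum>z\<in>supp {..<n}. \<Sum>z'\<in>supp {..<n}. of_bool (solves X Q a y z) * of_bool (solves X' Q' a y' z'))"
proof -
  let ?T = "joint_sols X Q y X' Q' y'"
  have T: "?T = {(z, w). z \<in> supp {..<n} \<and> w \<in> supp {..<n} \<times> supp X \<and> (solves X Q (snd w) y z \<and> solves X' Q' (snd w) y' (fst w))}"
    by auto
  have "card ?T = (\<Sum>z\<in>supp {..<n}. \<Sum>w\<in>supp {..<n} \<times> supp X. of_bool (solves X Q (snd w) y z \<and> solves X' Q' (snd w) y' (fst w)))"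
    unfolding T by (rule card_pairs_eq_sum) (simp_all add: assms)
  also have "\<dots> = (\<Sum>z\<in>supp {..<n}. \<Sum>z'\<in>supp {..<n}. \<Sum>a\<in>supp X. of_bool (solves X Q a y z) * of_bool (solves X' Q' a y' z'))"
    unfolding of_bool_conj by (rule sum.cong[OF refl], subst sum.cartesian_product') simp
  also have "\<dots> = (\<Sum>z\<in>supp {..<n}. \<Sum>a\<in>supp X. \<Sum>z'\<in>supp {..<n}. of_bool (solves X Q a y z) * of_bool (solves X' Q' a y' z'))"
    by (rule sum.cong[OF refl], rule sum.swap)
  also have "\<dots> = (\<Sum>a\<in>supp X. \<Sum>z\<in>supp {..<n}. \<Sum>z'\<in>supp {..<n}. of_bool (solves X Q a y z) * of_bool (solves X' Q' a y' z'))"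
    by (rule sum.swap)
  finally show ?thesis .
qed

text \<open>Two kernel vectors at the same point share the edge variables, so each edge of \<open>X\<close> now costs one
equation more than it brings unknowns.\<close>

lemma dvd_sum_card_Ker2:
  assumes "finite X" "finite Q" "finite Q'"
  shows "q ^ (2 * n - card X - card Q - card Q') dvd
    (\<Sum>a\<in>supp X. int (card (Ker X P Q a)) * int (card (Ker X P' Q' a)))"
proof -
  have "(\<Sum>a\<in>supp X. int (card (Ker X P Q a)) * int (card (Ker X P' Q' a)))
      = (\<Sum>a\<in>supp X. \<Sum>y\<in>cycles P. \<Sum>y'\<in>cycles P'. \<Sum>z\<in>supp {..<n}. \<Sum>z'\<in>supp {..<n}.
           of_bool (solves X Q a y z) * of_bool (solves X Q' a y' z'))"
    by (simp only: card_Ker_sum of_nat_sum of_nat_of_bool sum_product)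
  also have "\<dots> = (\<Sum>y\<in>cycles P. \<Sum>y'\<in>cycles P'. \<Sum>a\<in>supp X. \<Sum>z\<in>supp {..<n}. \<Sum>z'\<in>supp {..<n}.
           of_bool (solves X Q a y z) * of_bool (solves X Q' a y' z'))"
    by (subst sum.swap, rule sum.cong[OF refl], rule sum.swap)
  also have "\<dots> = (\<Sum>y\<in>cycles P. \<Sum>y'\<in>cycles P'. int (card (joint_sols X Q y X Q' y')))"
    using assms by (subst card_sol2_sum) (simp_all only: of_nat_sum of_nat_of_bool of_nat_mult)
  also have "q ^ (2 * n - card X - card Q - card Q') dvd \<dots>"
  proof (intro dvd_sum)
    fix y y'
    from card_sol2[OF assms(1,2,1,3), of y y'] obtain d where d: "2 * n \<le> d + card Q + card X + card Q'"
      "card (joint_sols X Q y X Q' y') = CARD('k) ^ d"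
      by blast
    show "q ^ (2 * n - card X - card Q - card Q') dvd int (card (joint_sols X Q y X Q' y'))"
      unfolding d(2) using d(1) by (simp add: q_def le_imp_power_dvd)
  qed
  finally show ?thesis .
qed

lemma card_Ker_eq_power:
  assumes "finite X" "finite Q"
  obtains d where "int (card (Ker X P Q a)) = q ^ d" "singular X P Q a \<longleftrightarrow> d > 0"
proof -
  from card_Ker_pow[OF assms] obtain d where d: "card (Ker X P Q a) = CARD('k) ^ d" by blast
  have "card {0::'k, 1} \<le> CARD('k)" by (rule card_mono) auto
  then have 2: "CARD('k) \<ge> 2" by simp
  have "singular X P Q a \<longleftrightarrow> card (Ker X P Q a) \<noteq> 1"
    unfolding singular_def card_1_singleton_iff using zero_in_Ker by (metis One_nat_def card_1_singleton_iff singletonD)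
  also have "\<dots> \<longleftrightarrow> d > 0" unfolding d using 2 by auto
  finally show ?thesis using d that[of d] by (simp add: q_def)
qed

text \<open>The indicator of a nontrivial kernel is congruent to one minus the size of the kernel.\<close>

lemma dvd_card_singular:
  assumes "finite X" "finite Q" "card Q < n" "X \<noteq> {}"
  shows "q dvd int (card {a \<in> supp X. singular X P Q a})"
proof -
  have "[int (card {a \<in> supp X. singular X P Q a}) = (\<Sum>a\<in>supp X. 1 - int (card (Ker X P Q a)))] (mod q)"
  proof -
    have "[(of_bool (singular X P Q a) :: int) = 1 - int (card (Ker X P Q a))] (mod q)" for a
    proof -
      obtain d where d: "int (card (Ker X P Q a)) = q ^ d" "singular X P Q a \<longleftrightarrow> d > 0"
        using card_Ker_eq_power[OF assms(1,2)] by blast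
      show ?thesis unfolding d by (cases d) (auto simp: cong_iff_dvd_diff)
    qed
    then show ?thesis
      using assms(1) by (simp only: card_eq_sum_of_bool finite_supp of_nat_sum of_nat_of_bool) (rule cong_sum)
  qed
  also have "(\<Sum>a\<in>supp X. 1 - int (card (Ker X P Q a))) = q ^ card X - (\<Sum>a\<in>supp X. int (card (Ker X P Q a)))"
    using assms(1) by (simp add: sum_subtractf card_supp q_def)
  also have "[\<dots> = 0] (mod q)"
  proof -
    have 1: "q dvd q ^ m" if "m > 0" for m using that by simp
    have "q dvd q ^ card X" using assms by (intro 1) (simp add: card_gt_0_iff)
    moreover have "q dvd (\<Sum>a\<in>supp X. int (card (Ker X P Q a)))"
      by (rule dvd_trans[OF 1 dvd_sum_card_Ker[OF assms(1,2), of P]]) (use assms in simp)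
    ultimately show ?thesis unfolding cong_0_iff by (rule dvd_diff)
  qed
  finally show ?thesis unfolding cong_0_iff .
qed

text \<open>The indicators of both kernels are replaced by one minus their sizes. For minors this says that the
number of common zeros is divisible by \<open>q\<close> as soon as the sum of the degrees is less than the number of
variables.\<close>

lemma dvd_card_singular_pair:
  assumes "finite X" "finite Q" "finite Q'" "card Q < n" "card Q' < n" "X \<noteq> {}"
    and "card X + card Q + card Q' < 2 * n"
  shows "q dvd int (card {a \<in> supp X. singular X P Q a \<and> singular X P' Q' a})"
proof -
  let ?k = "\<lambda>a. int (card (Ker X P Q a))" and ?l = "\<lambda>a. int (card (Ker X P' Q' a))"
  have "[int (card {a \<in> supp X. singular X P Q a \<and> singular X P' Q' a}) = (\<Sum>a\<in>supp X. (1 - ?k a) * (1 - ?l a))] (mod q)"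
  proof -
    have "[(of_bool (singular X P Q a \<and> singular X P' Q' a) :: int) = (1 - ?k a) * (1 - ?l a)] (mod q)" for a
    proof -
      obtain d where d: "?k a = q ^ d" "singular X P Q a \<longleftrightarrow> d > 0"
        using card_Ker_eq_power[OF assms(1,2)] by blast
      obtain e where e: "?l a = q ^ e" "singular X P' Q' a \<longleftrightarrow> e > 0"
        using card_Ker_eq_power[OF assms(1,3)] by blast
      have "[(1 - q ^ d) * (1 - q ^ e) = of_bool (d > 0) * of_bool (e > 0)] (mod q)"
        by (intro cong_mult; cases d; cases e) (auto simp: cong_iff_dvd_diff)
      then show ?thesis unfolding d e by (simp add: of_bool_conj cong_sym)
    qed
    then show ?thesis
      using assms(1) by (simp only: card_eq_sum_of_bool finite_supp of_nat_sum of_nat_of_bool) (rule cong_sum)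
  qed
  also have "(\<Sum>a\<in>supp X. (1 - ?k a) * (1 - ?l a))
      = q ^ card X - (\<Sum>a\<in>supp X. ?k a) - (\<Sum>a\<in>supp X. ?l a) + (\<Sum>a\<in>supp X. ?k a * ?l a)"
  proof -
    have "(1 - ?k a) * (1 - ?l a) = 1 - ?k a - ?l a + ?k a * ?l a" for a by (simp add: algebra_simps)
    then show ?thesis
      using assms(1) by (simp only: sum_subtractf sum.distrib sum_constant int_card_supp mult_1_right)
  qed
  also have "[\<dots> = 0] (mod q)"
  proof -
    have 1: "q dvd q ^ m" if "m > 0" for m using that by simp
    have "q dvd q ^ card X" using assms by (intro 1) (simp add: card_gt_0_iff)
    moreover have "q dvd (\<Sum>a\<in>supp X. ?k a)"
      by (rule dvd_trans[OF 1 dvd_sum_card_Ker[OF assms(1,2), of P]]) (use assms in simp)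
    moreover have "q dvd (\<Sum>a\<in>supp X. ?l a)"
      by (rule dvd_trans[OF 1 dvd_sum_card_Ker[OF assms(1,3), of P']]) (use assms in simp)
    moreover have "q dvd (\<Sum>a\<in>supp X. ?k a * ?l a)"
      by (rule dvd_trans[OF 1 dvd_sum_card_Ker2[OF assms(1,2,3), of P P']]) (use assms in simp)
    ultimately show ?thesis unfolding cong_0_iff by (intro dvd_add[OF dvd_diff[OF dvd_diff]])
  qed
  finally show ?thesis unfolding cong_0_iff .
qed

lemma cycle_cut_orthogonal:
  assumes "y \<in> cycles P"
  shows "(\<Sum>r<N. y r * cobd r z) = 0"
proof -
  have "(\<Sum>r<N. y r * cobd r z) = (\<Sum>j<n. \<Sum>r<N. y r * (E r j * z j))"
    unfolding cobd_def sum_distrib_left by (rule sum.swap)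
  also have "\<dots> = (\<Sum>j<n. z j * (\<Sum>r<N. E r j * y r))"
    unfolding sum_distrib_left by (intro sum.cong refl) (simp add: ac_simps)
  finally show ?thesis using assms by (simp add: cycles_def)
qed

text \<open>Cycles and coboundaries are orthogonal, and the edges of \<open>X\<close> contribute nothing because there the
coboundary is a common multiple of the cycle. This is the symmetry of \<open>M\<^sub>G\<close> in terms of kernel vectors:
the values of kernel vectors at the edges outside \<open>X\<close> form an isotropic set for a symplectic form.\<close>

lemma isotropy:
  assumes y: "y \<in> cycles P" "y' \<in> cycles P'" and R: "solves X Q a y z" "solves X Q' a y' z'"
    and X: "X \<subseteq> {..<N}"
  shows "(\<Sum>r\<in>{..<N} - X. y r * cobd r z' - y' r * cobd r z) = 0"
proof -
  have "y r * cobd r z' - y' r * cobd r z = 0" if "r \<in> X" for r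
  proof -
    have "cobd r z = - (a r * y r)" "cobd r z' = - (a r * y' r)"
      using R that by (auto simp: solves_def eq_neg_iff_add_eq_0 add.commute)
    then show ?thesis by simp
  qed
  then have "(\<Sum>r\<in>{..<N} - X. y r * cobd r z' - y' r * cobd r z) = (\<Sum>r<N. y r * cobd r z' - y' r * cobd r z)"
    by (intro sum.mono_neutral_left) auto
  also have "\<dots> = 0"
    using cycle_cut_orthogonal[OF y(1)] cycle_cut_orthogonal[OF y(2)] by (simp add: sum_subtractf)
  finally show ?thesis .
qed

text \<open>By isotropy the equations for two kernel vectors at the same point are dependent, which
gains one factor \<open>q\<close>. The redundant equation is the second one at an edge \<open>p\<close> with \<open>y p \<noteq> 0\<close> and
\<open>y' p = 0\<close>.\<close>

lemma dvd_card_sol2_isotropic: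
  assumes X: "X \<subseteq> {..<N}" and y: "y \<in> cycles ({..<N} - X)" "y' \<in> cycles ({..<N} - X)"
    and p: "p \<in> X" "y p \<noteq> 0" "y' p = 0"
  shows "q ^ (2 * n + 1 - card X) dvd int (card (joint_sols X {} y X {} y'))"
proof -
  have fin: "finite X" using X by (rule finite_subset) simp
  have "solves X {} a y' z'" if R: "solves X {} a y z" "solves (X - {p}) {} a y' z'" for z z' a
  proof -
    have R': "solves (X - {p}) {} a y z" using R(1) by (simp add: solves_def)
    have out: "y r = 0" "y' r = 0" if "r \<in> {..<N} - X" for r
      using that y by (auto simp: cycles_def supp_def)
    have "0 = (\<Sum>r\<in>{..<N} - (X - {p}). y r * cobd r z' - y' r * cobd r z)"
      using isotropy[OF y R' R(2)] X by auto
    also have "{..<N} - (X - {p}) = insert p ({..<N} - X)" using p X by auto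
    also have "(\<Sum>r\<in>insert p ({..<N} - X). y r * cobd r z' - y' r * cobd r z) = y p * cobd p z'"
      using p out by simp
    finally have "cobd p z' = 0" using p by simp
    then show ?thesis using R(2) p by (auto simp: solves_def)
  qed
  moreover have "solves (X - {p}) {} a y' z'" if "solves X {} a y' z'" for z' a
    using that by (auto simp: solves_def)
  ultimately have eq: "joint_sols X {} y X {} y' = joint_sols X {} y (X - {p}) {} y'" by blast
  from card_sol2[OF fin, of "{}" "X - {p}" "{}" y y'] fin obtain d where
    d: "card (joint_sols X {} y (X - {p}) {} y') = CARD('k) ^ d" "2 * n \<le> d + card (X - {p})"
    by auto
  have "card X > 0" using fin p(1) by (auto simp: card_gt_0_iff)
  then have "2 * n + 1 - card X \<le> d" using d(2) p(1) fin by simp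
  then show ?thesis unfolding eq d(1) by (simp add: q_def le_imp_power_dvd)
qed

text \<open>The second vector of a pair is normalised by subtracting a multiple of the first one, so that it
vanishes at an edge \<open>p\<close> where the first cycle does not. Each normalised pair stands for \<open>q\<close> pairs; this factor and the
redundant equation raise the exponent by two compared with \<open>dvd_sum_card_Ker2\<close>.\<close>

lemma dvd_sum_Ker_square:
  assumes X: "X \<subseteq> {..<N}" and c: "card X \<le> 2 * n + 1" and inj: "\<And>z. z \<in> supp {..<n} \<Longrightarrow> (\<forall>r\<in>X. cobd r z = 0) \<Longrightarrow> z = 0"
  defines "k \<equiv> \<lambda>a. int (card (Ker X ({..<N} - X) {} a))"
  shows "q ^ (2 * n + 2 - card X) dvd (\<Sum>a\<in>supp X. k a * (k a - 1))"
proof -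
  have fin: "finite X" using X by (rule finite_subset) simp
  let ?P = "{..<N} - X"
  \<comment> \<open>the edge at which the second vector is normalised\<close>
  define p where "p = (\<lambda>y :: nat \<Rightarrow> 'k. SOME r. r \<in> X \<and> y r \<noteq> 0)"
  have p: "p y \<in> X \<and> y (p y) \<noteq> 0" if "y \<in> cycles ?P - {0}" for y
  proof -
    have "\<exists>r. r \<in> X \<and> y r \<noteq> 0"
    proof (rule ccontr)
      assume "\<not> ?thesis"
      then have "y = 0" using that X by (auto simp: cycles_def supp_def fun_eq_iff)
      then show False using that by simp
    qed
    then show ?thesis unfolding p_def by (rule someI_ex)
  qed
  define H where "H = (\<lambda>y. {y' \<in> cycles ?P. y' (p y) = 0})"
  define A where "A = (\<Sum>y\<in>cycles ?P - {0}. \<Sum>y'\<in>H y. int (card (joint_sols X {} y X {} y')))"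
  have dvd: "q ^ (2 * n + 1 - card X) dvd A"
    unfolding A_def by (intro dvd_sum dvd_card_sol2_isotropic[OF X]) (use p in \<open>auto simp: H_def\<close>)
  have "A = (\<Sum>y\<in>cycles ?P - {0}. \<Sum>y'\<in>H y. \<Sum>a\<in>supp X. \<Sum>z\<in>supp {..<n}. \<Sum>z'\<in>supp {..<n}.
      of_bool (solves X {} a y z) * of_bool (solves X {} a y' z'))"
    unfolding A_def card_sol2_sum[OF fin] by simp
  also have "\<dots> = (\<Sum>a\<in>supp X. \<Sum>y\<in>cycles ?P - {0}. \<Sum>y'\<in>H y. \<Sum>z\<in>supp {..<n}. \<Sum>z'\<in>supp {..<n}.
      of_bool (solves X {} a y z) * of_bool (solves X {} a y' z'))"
    by (subst sum.swap, rule sum.cong[OF refl], rule sum.swap)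
  finally have "q * A = (\<Sum>a\<in>supp X. \<Sum>y\<in>cycles ?P - {0}. q * (\<Sum>y'\<in>H y. \<Sum>z\<in>supp {..<n}. \<Sum>z'\<in>supp {..<n}.
      of_bool (solves X {} a y z) * of_bool (solves X {} a y' z')))"
    by (simp add: sum_distrib_left)
  also have "\<dots> = (\<Sum>a\<in>supp X. \<Sum>y\<in>cycles ?P - {0}. \<Sum>z\<in>supp {..<n}. of_bool (solves X {} a y z) * k a)"
  proof (intro sum.cong refl)
    fix a y assume y: "y \<in> cycles ?P - {0}"
    have "(\<Sum>y'\<in>H y. \<Sum>z\<in>supp {..<n}. \<Sum>z'\<in>supp {..<n}. of_bool (solves X {} a y z) * of_bool (solves X {} a y' z'))
      = (\<Sum>z\<in>supp {..<n}. of_bool (solves X {} a y z) * (\<Sum>y'\<in>H y. \<Sum>z'\<in>supp {..<n}. of_bool (solves X {} a y' z') :: int))"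
      by (subst sum.swap) (simp only: sum_distrib_left)
    also have "(\<Sum>y'\<in>H y. \<Sum>z'\<in>supp {..<n}. of_bool (solves X {} a y' z') :: int) =
        int (card {(y', z'). y' \<in> H y \<and> z' \<in> supp {..<n} \<and> solves X {} a y' z'})"
      by (subst card_pairs_eq_sum) (simp_all add: H_def)
    also have "{(y', z'). y' \<in> H y \<and> z' \<in> supp {..<n} \<and> solves X {} a y' z'} = {v \<in> Ker X ?P {} a. fst v (p y) = 0}"
      by (auto simp: H_def Ker_def)
    finally have e: "(\<Sum>y'\<in>H y. \<Sum>z\<in>supp {..<n}. \<Sum>z'\<in>supp {..<n}. of_bool (solves X {} a y z) * of_bool (solves X {} a y' z'))
        = (\<Sum>z\<in>supp {..<n}. of_bool (solves X {} a y z) * int (card {v \<in> Ker X ?P {} a. fst v (p y) = 0}))" .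
    have "q * (\<Sum>y'\<in>H y. \<Sum>z\<in>supp {..<n}. \<Sum>z'\<in>supp {..<n}. of_bool (solves X {} a y z) * of_bool (solves X {} a y' z'))
        = (\<Sum>z\<in>supp {..<n}. of_bool (solves X {} a y z) * (q * int (card {v \<in> Ker X ?P {} a. fst v (p y) = 0})))"
      unfolding e by (simp only: sum_distrib_left mult.left_commute[of q])
    also have "\<dots> = (\<Sum>z\<in>supp {..<n}. of_bool (solves X {} a y z) * k a)"
    proof (intro sum.cong refl)
      fix z :: "nat \<Rightarrow> 'k" assume z: "z \<in> supp {..<n}"
      show "of_bool (solves X {} a y z) * (q * int (card {v \<in> Ker X ?P {} a. fst v (p y) = 0})) = of_bool (solves X {} a y z) * k a"
      proof (cases "solves X {} a y z")
        case True
        then have "(y, z) \<in> Ker X ?P {} a" using y z by (auto simp: Ker_def)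
        then have "card {v \<in> Ker X ?P {} a. fst v (p y) = 0} * CARD('k) = card (Ker X ?P {} a)"
          using p[OF y] by (intro card_hyperplane[where u = "(y, z)" and sc = "\<lambda>c. map_prod (smul c) (smul c)"])
            (auto intro: Ker_subspace)
        then have "q * int (card {v \<in> Ker X ?P {} a. fst v (p y) = 0}) = k a"
          unfolding k_def q_def by (simp flip: of_nat_mult add: mult.commute)
        then show ?thesis by simp
      qed simp
    qed
    finally show "q * (\<Sum>y'\<in>H y. \<Sum>z\<in>supp {..<n}. \<Sum>z'\<in>supp {..<n}. of_bool (solves X {} a y z) * of_bool (solves X {} a y' z'))
        = (\<Sum>z\<in>supp {..<n}. of_bool (solves X {} a y z) * k a)" .
  qed
  also have "\<dots> = (\<Sum>a\<in>supp X. k a * (k a - 1))"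
  proof (intro sum.cong refl)
    fix a
    have "(\<Sum>y\<in>cycles ?P - {0}. \<Sum>z\<in>supp {..<n}. of_bool (solves X {} a y z) * k a)
       = k a * int (card {(y, z). y \<in> cycles ?P - {0} \<and> z \<in> supp {..<n} \<and> solves X {} a y z})"
      by (subst card_pairs_eq_sum) (simp_all add: sum_distrib_left mult.commute)
    also have "{(y, z). y \<in> cycles ?P - {0} \<and> z \<in> supp {..<n} \<and> solves X {} a y z} = Ker X ?P {} a - {(0, 0)}"
      using inj by (auto simp: Ker_def solves_def)
    also have "int (card (Ker X ?P {} a - {(0, 0)})) = k a - 1"
      using zero_in_Ker[of X ?P "{}" a] card_gt_0_iff[of "Ker X ?P {} a"]
      by (auto simp: k_def of_nat_diff)
    finally show "(\<Sum>y\<in>cycles ?P - {0}. \<Sum>z\<in>supp {..<n}. of_bool (solves X {} a y z) * k a) = k a * (k a - 1)" .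
  qed
  finally have qA: "q * A = (\<Sum>a\<in>supp X. k a * (k a - 1))" .
  have "2 * n + 2 - card X = Suc (2 * n + 1 - card X)" using c by simp
  then show ?thesis using dvd unfolding qA[symmetric] by (simp add: mult_dvd_mono)
qed

text \<open>The indicator of \<open>d > 0\<close>, times a number coprime to \<open>q\<close>, is a quadratic polynomial in \<open>\<kappa> = q\<^sup>d\<close>
modulo \<open>q\<^sup>3\<close>: the polynomial is the combination of the numbers of lines and planes in a space of dimension \<open>d\<close>
that agrees with the indicator for \<open>d \<le> 2\<close>, and its error for larger \<open>d\<close> is divisible by \<open>q\<^sup>3\<close>.\<close>

lemma corank_indicator_cong:
  assumes "\<kappa> = q ^ d"
  shows "[(1 + q * (q * q - q - 1)) * of_bool (d > 0) = (q * q - 1) * (\<kappa> - 1) - (\<kappa> * (\<kappa> - 1) - q * (\<kappa> - 1))] (mod q ^ 3)"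
proof -
  consider "d = 0" | "d = 1" | "d = 2" | e where "d = e + 3"
    by (metis One_nat_def Suc_1 add.commute add_2_eq_Suc' less_2_cases_iff not_less ordered_cancel_comm_monoid_diff_class.le_imp_diff_is_add le_add_diff_inverse2 numeral_3_eq_3 not_less_eq_eq Suc_leI le_neq_implies_less)
  then show ?thesis
  proof cases
    case 4
    have "(1 + q * (q * q - q - 1)) * of_bool (d > 0) - ((q * q - 1) * (\<kappa> - 1) - (\<kappa> * (\<kappa> - 1) - q * (\<kappa> - 1)))
        = q ^ 3 * (1 - q ^ e * (q * q - 1) + q ^ e * (\<kappa> - 1) - q ^ e * q)"
      unfolding assms 4 by (simp add: algebra_simps power_add power3_eq_cube)
    then show ?thesis unfolding cong_iff_dvd_diff by simp
  qed (simp_all add: assms cong_iff_dvd_diff algebra_simps power2_eq_square)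
qed

text \<open>If \<open>E\<close> has dependent columns, every point is singular. Otherwise the potential of a kernel vector is
determined by the cycle and \<open>dvd_sum_Ker_square\<close> applies. The count in question is that of the graph polynomial of
the subgraph \<open>X\<close>.\<close>

lemma cube_dvd_num_singular:
  assumes X: "X \<subseteq> {..<N}" and c: "3 \<le> card X" "card X < 2 * n" and n: "3 \<le> n"
  shows "q ^ 3 dvd int (card {a \<in> supp X. singular X ({..<N} - X) {} a})"
proof -
  have fin: "finite X" using X by (rule finite_subset) simp
  let ?P = "{..<N} - X"
  define k where "k = (\<lambda>a. int (card (Ker X ?P {} a)))"
  have cX: "q ^ 3 dvd q ^ card X" using c(1) by (rule le_imp_power_dvd)
  show ?thesis
  proof (cases "\<exists>z\<in>supp {..<n}. z \<noteq> 0 \<and> (\<forall>r\<in>X. cobd r z = 0)")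
    case True
    then obtain z where z: "z \<in> supp {..<n}" "z \<noteq> 0" "\<forall>r\<in>X. cobd r z = 0" by blast
    have "(0, z) \<in> Ker X ?P {} a" for a
      using z by (auto simp: Ker_def solves_def cycles_closed)
    then have "singular X ?P {} a" for a using z(2) unfolding singular_def by blast
    then show ?thesis using cX fin by (simp add: int_card_supp)
  next
    case False
    have "q ^ (2 * n + 2 - card X) dvd (\<Sum>a\<in>supp X. k a * (k a - 1))"
      using dvd_sum_Ker_square[OF X] False c unfolding k_def by auto
    moreover have "q ^ 3 dvd q ^ (2 * n + 2 - card X)" using c by (intro le_imp_power_dvd) simp
    ultimately have 2: "q ^ 3 dvd (\<Sum>a\<in>supp X. k a * (k a - 1))" by (rule dvd_trans[rotated])
    have "q ^ 3 dvd q ^ n" using n by (rule le_imp_power_dvd)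
    then have "q ^ 3 dvd (\<Sum>a\<in>supp X. k a)"
      using dvd_sum_card_Ker[OF fin, of "{}" ?P] unfolding k_def by (auto intro: dvd_trans)
    then have 1: "q ^ 3 dvd (\<Sum>a\<in>supp X. k a - 1)"
      using cX fin by (simp add: sum_subtractf int_card_supp dvd_diff)
    \<comment> \<open>equal to \<open>(q - 1)\<^sup>2 (q + 1)\<close>\<close>
    let ?u = "1 + q * (q * q - q - 1)"
    have "[(of_bool (singular X ?P {} a) :: int) * ?u = (q * q - 1) * (k a - 1) - (k a * (k a - 1) - q * (k a - 1))] (mod q ^ 3)" for a
    proof -
      obtain d where d: "k a = q ^ d" "singular X ?P {} a \<longleftrightarrow> d > 0"
        unfolding k_def using card_Ker_eq_power[OF fin, of "{}"] by blast
      show ?thesis using corank_indicator_cong[OF d(1)] d(2) by (simp add: mult.commute)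
    qed
    then have "[(\<Sum>a\<in>supp X. (of_bool (singular X ?P {} a) :: int) * ?u) =
        (\<Sum>a\<in>supp X. (q * q - 1) * (k a - 1) - (k a * (k a - 1) - q * (k a - 1)))] (mod q ^ 3)"
      by (rule cong_sum)
    also have "(\<Sum>a\<in>supp X. (q * q - 1) * (k a - 1) - (k a * (k a - 1) - q * (k a - 1)))
      = (q * q - 1) * (\<Sum>a\<in>supp X. k a - 1) - ((\<Sum>a\<in>supp X. k a * (k a - 1)) - q * (\<Sum>a\<in>supp X. k a - 1))"
      by (subst sum_subtractf, subst sum_subtractf) (simp only: sum_distrib_left)
    also have "[\<dots> = 0] (mod q ^ 3)"
      unfolding cong_0_iff using 1 2 by (intro dvd_diff dvd_mult) auto
    also have "(\<Sum>a\<in>supp X. (of_bool (singular X ?P {} a) :: int) * ?u) = ?u * int (card {a \<in> supp X. singular X ?P {} a})"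
      using fin by (simp only: card_eq_sum_of_bool finite_supp of_nat_sum of_nat_of_bool sum_distrib_left mult.commute)
    finally show ?thesis unfolding cong_0_iff by (rule dvd_cancel_unit_mod)
  qed
qed

end

section \<open>Determinants with prescribed rows\<close>

text \<open>A determinant as a function of its rows, where a row is a function on the natural numbers. In this form
single rows can be replaced by function update.\<close>

definition rdet :: "nat \<Rightarrow> (nat \<Rightarrow> nat \<Rightarrow> 'a::comm_ring_1) \<Rightarrow> 'a" where
  "rdet s \<rho> = det (mat s s (\<lambda>(i, j). \<rho> i j))"

lemma rdet_cong: "(\<And>i j. i < s \<Longrightarrow> j < s \<Longrightarrow> \<rho> i j = \<sigma> i j) \<Longrightarrow> rdet s \<rho> = rdet s \<sigma>"
  unfolding rdet_def by (rule arg_cong[of _ _ det]) (rule eq_matI, auto)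

text \<open>The cofactors of a row do not depend on that row; this yields linearity in each row.\<close>

lemma rdet_row_expand:
  assumes "i < s"
  shows "rdet s (\<rho>(i := u)) = (\<Sum>j<s. u j * cofactor (mat s s (\<lambda>(i, j). \<rho> i j)) i j)"
proof -
  have "rdet s (\<rho>(i := u)) = (\<Sum>j<s. mat s s (\<lambda>(k, j). (\<rho>(i := u)) k j) $$ (i, j) *
      cofactor (mat s s (\<lambda>(k, j). (\<rho>(i := u)) k j)) i j)"
    unfolding rdet_def by (rule laplace_expansion_row) (use assms in auto)
  also have "\<dots> = (\<Sum>j<s. u j * cofactor (mat s s (\<lambda>(i, j). \<rho> i j)) i j)"
  proof (rule sum.cong[OF refl])
    fix j assume "j \<in> {..<s}"
    have "mat_delete (mat s s (\<lambda>(k, j). (\<rho>(i := u)) k j)) i j = mat_delete (mat s s (\<lambda>(i, j). \<rho> i j)) i j"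
      using assms \<open>j \<in> {..<s}\<close> by (intro eq_matI) (auto simp: mat_delete_def)
    then show "mat s s (\<lambda>(k, j). (\<rho>(i := u)) k j) $$ (i, j) * cofactor (mat s s (\<lambda>(k, j). (\<rho>(i := u)) k j)) i j
      = u j * cofactor (mat s s (\<lambda>(i, j). \<rho> i j)) i j"
      using assms \<open>j \<in> {..<s}\<close> by (simp add: cofactor_def)
  qed
  finally show ?thesis .
qed

lemma rdet_row_affine:
  "i < s \<Longrightarrow> rdet s (\<rho>(i := \<lambda>j. t * u j + w j)) = t * rdet s (\<rho>(i := u)) + rdet s (\<rho>(i := w))"
  by (simp add: rdet_row_expand sum_distrib_left distrib_right sum.distrib ac_simps)

lemma rdet_row_sum:
  "i < s \<Longrightarrow> rdet s (\<rho>(i := \<lambda>j. \<Sum>k\<in>A. t k * u k j)) = (\<Sum>k\<in>A. t k * rdet s (\<rho>(i := u k)))"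
  by (simp add: rdet_row_expand sum_distrib_left sum_distrib_right ac_simps) (rule sum.swap)

lemma rdet_row_scale:
  "i < s \<Longrightarrow> rdet s (\<rho>(i := \<lambda>j. t * u j)) = t * rdet s (\<rho>(i := u))"
  by (simp add: rdet_row_expand sum_distrib_left ac_simps)

lemma rdet_equal_rows:
  "i < s \<Longrightarrow> k < s \<Longrightarrow> i \<noteq> k \<Longrightarrow> \<rho> i = \<rho> k \<Longrightarrow> rdet s \<rho> = 0"
  unfolding rdet_def by (rule det_identical_rows[of _ s i k]) (auto intro!: eq_vecI)

text \<open>Cramer's rule: a vector is expressed through the rows of a matrix.\<close>

lemma rdet_cramer:
  assumes "m < s"
  shows "rdet s \<rho> * u m = (\<Sum>k<s. rdet s (\<rho>(k := u)) * \<rho> k m)"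
proof -
  let ?A = "mat s s (\<lambda>(i, j). \<rho> i j)"
  have "(\<Sum>k<s. rdet s (\<rho>(k := u)) * \<rho> k m) = (\<Sum>k<s. \<Sum>j<s. u j * cofactor ?A k j * \<rho> k m)"
    by (intro sum.cong refl) (simp add: rdet_row_expand sum_distrib_right)
  also have "\<dots> = (\<Sum>j<s. \<Sum>k<s. u j * cofactor ?A k j * \<rho> k m)" by (rule sum.swap)
  also have "\<dots> = (\<Sum>j<s. u j * (adj_mat ?A * ?A) $$ (j, m))"
    using assms by (intro sum.cong refl)
      (auto simp: adj_mat_def scalar_prod_def sum_distrib_left ac_simps atLeast0LessThan intro!: sum.cong)
  also have "\<dots> = (\<Sum>j<s. if j = m then u j * det ?A else 0)"
    using assms adj_mat(3)[of ?A s] by (intro sum.cong refl) auto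
  also have "\<dots> = rdet s \<rho> * u m" using assms by (simp add: rdet_def)
  finally show ?thesis by simp
qed

text \<open>Expressing the row \<open>d\<close> through the rows of the matrix with \<open>a\<close> and \<open>b\<close> by Cramer's rule, only
the multiples of \<open>a\<close> and \<open>b\<close> survive in the second factor, since every other term has a repeated row.\<close>

lemma rdet_pluecker:
  assumes ij: "i < s" "j < s" "i \<noteq> j"
  shows "rdet s (\<rho>(i := a, j := b)) * rdet s (\<rho>(i := c, j := d)) =
     rdet s (\<rho>(i := d, j := b)) * rdet s (\<rho>(i := c, j := a)) + rdet s (\<rho>(i := a, j := d)) * rdet s (\<rho>(i := c, j := b))"
proof -
  let ?r = "\<rho>(i := a, j := b)"
  have "rdet s ?r * rdet s (\<rho>(i := c, j := d)) = rdet s ((\<rho>(i := c))(j := \<lambda>m. rdet s ?r * d m))"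
    using ij by (simp only: rdet_row_scale)
  also have "\<dots> = rdet s ((\<rho>(i := c))(j := \<lambda>m. \<Sum>k<s. rdet s (?r(k := d)) * ?r k m))"
    by (rule rdet_cong) (auto simp: rdet_cramer[of _ s ?r])
  also have "\<dots> = (\<Sum>k<s. rdet s (?r(k := d)) * rdet s ((\<rho>(i := c))(j := ?r k)))"
    using ij by (simp only: rdet_row_sum)
  also have "\<dots> = (\<Sum>k\<in>{i, j}. rdet s (?r(k := d)) * rdet s ((\<rho>(i := c))(j := ?r k)))"
  proof (intro sum.mono_neutral_right ballI)
    fix k assume k: "k \<in> {..<s} - {i, j}"
    have "rdet s ((\<rho>(i := c))(j := ?r k)) = 0"
      by (rule rdet_equal_rows[of k _ j]) (use k ij in auto)
    then show "rdet s (?r(k := d)) * rdet s ((\<rho>(i := c))(j := ?r k)) = 0" by simp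
  qed (use ij in auto)
  also have "\<dots> = rdet s (\<rho>(i := d, j := b)) * rdet s (\<rho>(i := c, j := a)) + rdet s (\<rho>(i := a, j := d)) * rdet s (\<rho>(i := c, j := b))"
    using ij by (simp add: fun_upd_twist)
  finally show ?thesis .
qed

lemma rdet_eq_0_iff:
  fixes \<rho> :: "nat \<Rightarrow> nat \<Rightarrow> 'a::field"
  shows "rdet s \<rho> = 0 \<longleftrightarrow> (\<exists>v. (\<exists>j<s. v j \<noteq> 0) \<and> (\<forall>i<s. (\<Sum>j<s. \<rho> i j * v j) = 0))"
proof -
  let ?A = "mat s s (\<lambda>(i, j). \<rho> i j)"
  have "rdet s \<rho> = 0 \<longleftrightarrow> (\<exists>v. v \<in> carrier_vec s \<and> v \<noteq> 0\<^sub>v s \<and> ?A *\<^sub>v v = 0\<^sub>v s)"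
    unfolding rdet_def by (rule det_0_iff_vec_prod_zero_field) simp
  also have "\<dots> \<longleftrightarrow> (\<exists>v. (\<exists>j<s. v j \<noteq> 0) \<and> (\<forall>i<s. (\<Sum>j<s. \<rho> i j * v j) = 0))"
  proof
    assume "\<exists>v. v \<in> carrier_vec s \<and> v \<noteq> 0\<^sub>v s \<and> ?A *\<^sub>v v = 0\<^sub>v s"
    then obtain v where v: "v \<in> carrier_vec s" "v \<noteq> 0\<^sub>v s" "?A *\<^sub>v v = 0\<^sub>v s" by blast
    have "(\<Sum>j<s. \<rho> i j * v $ j) = 0" if "i < s" for i
    proof -
      have "(?A *\<^sub>v v) $ i = (\<Sum>j<s. \<rho> i j * v $ j)"
        using that v(1) by (auto simp: scalar_prod_def atLeast0LessThan intro!: sum.cong)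
      then show ?thesis using v(3) that by simp
    qed
    moreover have "\<exists>j<s. v $ j \<noteq> 0" using v(1,2) by (metis carrier_vecD eq_vecI index_zero_vec)
    ultimately show "\<exists>v. (\<exists>j<s. v j \<noteq> 0) \<and> (\<forall>i<s. (\<Sum>j<s. \<rho> i j * v j) = 0)" by blast
  next
    assume "\<exists>v. (\<exists>j<s. v j \<noteq> 0) \<and> (\<forall>i<s. (\<Sum>j<s. \<rho> i j * v j) = 0)"
    then obtain v where v: "\<exists>j<s. v j \<noteq> 0" "\<forall>i<s. (\<Sum>j<s. \<rho> i j * v j) = 0" by blast
    have "?A *\<^sub>v vec s v = 0\<^sub>v s"
      using v(2) by (intro eq_vecI) (auto simp: scalar_prod_def atLeast0LessThan)
    moreover have "vec s v \<noteq> 0\<^sub>v s" using v(1) by (metis index_vec index_zero_vec(1))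
    ultimately show "\<exists>v. v \<in> carrier_vec s \<and> v \<noteq> 0\<^sub>v s \<and> ?A *\<^sub>v v = 0\<^sub>v s"
      by (intro exI[of _ "vec s v"]) simp
  qed
  finally show ?thesis .
qed

lemma sum_lessThan_add:
  fixes f :: "nat \<Rightarrow> 'a::comm_monoid_add"
  shows "(\<Sum>j<N + n. f j) = (\<Sum>j<N. f j) + (\<Sum>j<n. f (N + j))"
  by (induction n) (simp_all add: add.assoc)

text \<open>The row of an edge can be replaced by a unit row, which deletes the row together with one column up to
sign, or by its row without diagonal entry, which sets the variable of the edge to zero.\<close>

datatype row = Unit nat | Inc nat

context incidence
begin

fun row_of :: "row \<Rightarrow> nat \<Rightarrow> 'k" where
  "row_of (Unit k) = (\<lambda>j. if j = k then 1 else 0)"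
| "row_of (Inc r) = (\<lambda>j. if j < N then 0 else E r (j - N))"

text \<open>The matrix \<open>M\<^sub>G\<close> for the edges in \<open>X\<close>, with the rows of the other edges prescribed by \<open>c\<close>. With suitable \<open>c\<close>
its determinant is any Dodgson polynomial up to sign, and the size of the matrix never changes.\<close>

definition Rows :: "nat set \<Rightarrow> (nat \<Rightarrow> row) \<Rightarrow> (nat \<Rightarrow> 'k) \<Rightarrow> nat \<Rightarrow> nat \<Rightarrow> 'k" where
  "Rows X c a = (\<lambda>r. if r < N then (if r \<in> X then (\<lambda>j. a r * row_of (Unit r) j + row_of (Inc r) j) else row_of (c r))
     else (\<lambda>j. if j < N then - E j (r - N) else 0))"

definition Det :: "nat set \<Rightarrow> (nat \<Rightarrow> row) \<Rightarrow> (nat \<Rightarrow> 'k) \<Rightarrow> 'k" where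
  "Det X c a = rdet (N + n) (Rows X c a)"

text \<open>The coefficient of \<open>a x\<close> deletes the edge \<open>x\<close>; the constant term sets its variable to zero.\<close>

lemma Det_affine:
  assumes "x \<notin> X" "x < N"
  shows "Det (insert x X) c a = a x * Det X (c(x := Unit x)) a + Det X (c(x := Inc x)) a"
proof -
  have "Rows (insert x X) c a = (Rows X c a)(x := \<lambda>j. a x * row_of (Unit x) j + row_of (Inc x) j)"
    "Rows X (c(x := Unit x)) a = (Rows X c a)(x := row_of (Unit x))"
    "Rows X (c(x := Inc x)) a = (Rows X c a)(x := row_of (Inc x))"
    using assms by (auto simp: Rows_def fun_eq_iff)
  then show ?thesis unfolding Det_def using assms by (simp only: rdet_row_affine trans_less_add1)
qed

lemma Det_cong:
  assumes "\<And>r. r \<in> {..<N} - X \<Longrightarrow> c r = c' r" "\<And>r. r \<in> X \<Longrightarrow> a r = a' r"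
  shows "Det X c a = Det X c' a'"
  unfolding Det_def by (rule rdet_cong) (use assms in \<open>auto simp: Rows_def\<close>)

lemma Det_upd [simp]: "x \<notin> X \<Longrightarrow> Det X c (a(x := t)) = Det X c a"
  by (rule Det_cong) auto

lemma Det_pluecker:
  assumes "x \<notin> X" "x < N" "y \<notin> X" "y < N" "x \<noteq> y"
  shows "Det X (c(x := r1, y := r2)) a * Det X (c(x := r3, y := r4)) a =
     Det X (c(x := r4, y := r2)) a * Det X (c(x := r3, y := r1)) a + Det X (c(x := r1, y := r4)) a * Det X (c(x := r3, y := r2)) a"
proof -
  have M: "Rows X (c(x := u, y := v)) a = (Rows X c a)(x := row_of u, y := row_of v)" for u v
    using assms by (auto simp: Rows_def fun_eq_iff)
  show ?thesis unfolding Det_def M by (rule rdet_pluecker) (use assms in auto)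
qed

definition units :: "row set \<Rightarrow> nat set" where "units R = {k. Unit k \<in> R}"
definition incs :: "row set \<Rightarrow> nat set" where "incs R = {k. Inc k \<in> R}"

lemma units_incs [simp]:
  "units {} = {}" "incs {} = {}" "units (insert (Unit k) R) = insert k (units R)" "units (insert (Inc k) R) = units R"
  "incs (insert (Unit k) R) = incs R" "incs (insert (Inc k) R) = insert k (incs R)"
  "units (Unit ` A) = A" "incs (Unit ` A) = {}" "units (A' \<union> B) = units A' \<union> units B" "incs (A' \<union> B) = incs A' \<union> incs B"
  by (auto simp: units_def incs_def)

text \<open>A vector of length \<open>N + n\<close> is read as a pair of a vector on the edges and a potential. A unit row
forces an entry of the former to vanish.\<close>

lemma Det_eq_0_iff:
  assumes X: "X \<subseteq> {..<N}" and c: "units (c ` ({..<N} - X)) \<subseteq> {..<N}"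
  shows "Det X c a = 0 \<longleftrightarrow> singular X (units (c ` ({..<N} - X))) (incs (c ` ({..<N} - X))) a"
proof -
  let ?P = "units (c ` ({..<N} - X))" and ?Q = "incs (c ` ({..<N} - X))"
  have dotU: "(\<Sum>j<N + n. row_of (Unit k) j * v j) = v k" if "k < N" for v k
    using that by (simp add: if_distrib if_distribR cong: if_cong)
  have dotI: "(\<Sum>j<N + n. row_of (Inc r) j * v j) = (\<Sum>j<n. E r j * v (N + j))" for v r
    by (simp add: sum_lessThan_add)
  have rows: "(\<forall>i<N + n. (\<Sum>j<N + n. Rows X c a i j * v j) = 0) \<longleftrightarrow>
      (\<forall>k\<in>?P. v k = 0) \<and> (\<forall>r\<in>?Q. (\<Sum>j<n. E r j * v (N + j)) = 0) \<and>
      (\<forall>r\<in>X. a r * v r + (\<Sum>j<n. E r j * v (N + j)) = 0) \<and> (\<forall>i<n. (\<Sum>r<N. E r i * v r) = 0)" for v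
  proof -
    have b: "(\<Sum>j<N + n. Rows X c a (N + i) j * v j) = - (\<Sum>r<N. E r i * v r)" for i
      by (simp add: Rows_def sum_lessThan_add sum_negf)
    have x: "(\<Sum>j<N + n. Rows X c a r j * v j) = a r * v r + (\<Sum>j<n. E r j * v (N + j))" if "r \<in> X" for r
    proof -
      have "r < N" using that X by auto
      then have "(\<Sum>j<N + n. Rows X c a r j * v j) = (\<Sum>j<N + n. a r * (row_of (Unit r) j * v j) + row_of (Inc r) j * v j)"
        using that by (intro sum.cong refl) (simp add: Rows_def distrib_right)
      also have "\<dots> = a r * v r + (\<Sum>j<n. E r j * v (N + j))"
        using \<open>r < N\<close> by (simp only: sum.distrib dotU dotI sum_distrib_left[symmetric])
      finally show ?thesis .
    qed
    have f: "(\<Sum>j<N + n. Rows X c a r j * v j) = (case c r of Unit k \<Rightarrow> v k | Inc r \<Rightarrow> \<Sum>j<n. E r j * v (N + j))"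
      if r: "r \<in> {..<N} - X" for r
    proof (cases "c r")
      case (Unit k)
      then have "k < N" using c r by (force simp: units_def image_iff)
      then show ?thesis using Unit r dotU[of k v] by (simp add: Rows_def)
    next
      case (Inc k)
      then show ?thesis using r dotI[of k v] by (simp add: Rows_def)
    qed
    have "(\<forall>i<N + n. (\<Sum>j<N + n. Rows X c a i j * v j) = 0) \<longleftrightarrow>
      (\<forall>i<n. (\<Sum>j<N + n. Rows X c a (N + i) j * v j) = 0) \<and> (\<forall>i\<in>X. (\<Sum>j<N + n. Rows X c a i j * v j) = 0)
      \<and> (\<forall>i\<in>{..<N} - X. (\<Sum>j<N + n. Rows X c a i j * v j) = 0)"
    proof -
      have "i \<in> X \<or> i \<in> {..<N} - X \<or> (\<exists>k<n. i = N + k)" if "i < N + n" for i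
        using that by (cases "i < N") (auto intro: exI[of _ "i - N"])
      moreover have "i < N + n" if "i \<in> X" for i using that X by auto
      ultimately have "(\<forall>i<N + n. G i) \<longleftrightarrow> (\<forall>i<n. G (N + i)) \<and> (\<forall>i\<in>X. G i) \<and> (\<forall>i\<in>{..<N} - X. G i)"
        for G :: "nat \<Rightarrow> bool"
        by (metis DiffD1 lessThan_iff nat_add_left_cancel_less trans_less_add1)
      then show ?thesis .
    qed
    also have "\<dots> \<longleftrightarrow> (\<forall>k\<in>?P. v k = 0) \<and> (\<forall>r\<in>?Q. (\<Sum>j<n. E r j * v (N + j)) = 0) \<and>
      (\<forall>r\<in>X. a r * v r + (\<Sum>j<n. E r j * v (N + j)) = 0) \<and> (\<forall>i<n. (\<Sum>r<N. E r i * v r) = 0)"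
    proof -
      have "(\<forall>i\<in>{..<N} - X. (\<Sum>j<N + n. Rows X c a i j * v j) = 0) \<longleftrightarrow>
         (\<forall>\<xi>\<in>c ` ({..<N} - X). (case \<xi> of Unit k \<Rightarrow> v k | Inc r \<Rightarrow> \<Sum>j<n. E r j * v (N + j)) = 0)"
        using f by auto
      also have "\<dots> \<longleftrightarrow> (\<forall>k\<in>?P. v k = 0) \<and> (\<forall>r\<in>?Q. (\<Sum>j<n. E r j * v (N + j)) = 0)"
      proof -
        have "(\<forall>\<xi>\<in>R. (case \<xi> of Unit k \<Rightarrow> f k | Inc r \<Rightarrow> g r) = 0) \<longleftrightarrow>
            (\<forall>k\<in>units R. f k = 0) \<and> (\<forall>r\<in>incs R. g r = 0)" for R and f g :: "nat \<Rightarrow> 'k"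
          unfolding units_def incs_def by (auto split: row.splits)
        then show ?thesis .
      qed
      finally show ?thesis using b x by auto
    qed
    finally show ?thesis .
  qed
  show ?thesis
  proof
    assume "Det X c a = 0"
    then obtain v where v: "\<exists>j<N + n. v j \<noteq> 0" "\<forall>i<N + n. (\<Sum>j<N + n. Rows X c a i j * v j) = 0"
      unfolding Det_def rdet_eq_0_iff by blast
    define y where "y = (\<lambda>j. if j < N then v j else 0)"
    define z where "z = (\<lambda>j. if j < n then v (N + j) else 0)"
    have y: "y r = v r" if "r < N" for r using that by (simp add: y_def)
    have z: "cobd r z = (\<Sum>j<n. E r j * v (N + j))" for r by (simp add: cobd_def z_def)
    have "(\<Sum>r<N. E r i * y r) = (\<Sum>r<N. E r i * v r)" for i by (simp add: y_def)
    moreover have "y \<in> supp ({..<N} - ?P)" using v(2) unfolding rows by (auto simp: supp_def y_def)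
    moreover have "z \<in> supp {..<n}" by (auto simp: supp_def z_def)
    ultimately have "(y, z) \<in> Ker X ?P ?Q a"
      using v(2) X y unfolding rows by (auto simp: Ker_def cycles_def solves_def z subset_iff)
    moreover have "(y, z) \<noteq> (0, 0)"
    proof
      assume "(y, z) = (0, 0)"
      then have "y = 0" "z = 0" by auto
      obtain j where j: "j < N + n" "v j \<noteq> 0" using v(1) by blast
      show False
      proof (cases "j < N")
        case True
        then show False using j fun_cong[OF \<open>y = 0\<close>, of j] by (simp add: y_def)
      next
        case False
        then have "j - N < n" "N + (j - N) = j" using j by auto
        then show False using j fun_cong[OF \<open>z = 0\<close>, of "j - N"] by (simp add: z_def)
      qed
    qed
    ultimately show "singular X ?P ?Q a" unfolding singular_def by blast
  next
    assume "singular X ?P ?Q a"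
    then obtain y z where yz: "(y, z) \<in> Ker X ?P ?Q a" "(y, z) \<noteq> (0, 0)"
      unfolding singular_def using zero_in_Ker[of X ?P ?Q a] by auto
    define v where "v = (\<lambda>j. if j < N then y j else z (j - N))"
    have y: "y \<in> supp ({..<N} - ?P)" and z: "z \<in> supp {..<n}" using yz(1) by (auto simp: Ker_def cycles_def)
    have v: "v r = y r" if "r < N" for r using that by (simp add: v_def)
    have 1: "(\<Sum>j<n. E r j * v (N + j)) = cobd r z" for r by (simp add: cobd_def v_def)
    have "\<forall>i<N + n. (\<Sum>j<N + n. Rows X c a i j * v j) = 0"
      unfolding rows 1 using yz(1) c X v by (auto simp: Ker_def cycles_def solves_def supp_def subset_iff)
    moreover have "\<exists>j<N + n. v j \<noteq> 0"
    proof (rule ccontr)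
      assume "\<not> ?thesis"
      then have *: "v j = 0" if "j < N + n" for j using that by blast
      have "y j = 0" for j using *[of j] y by (cases "j < N") (auto simp: v_def supp_def)
      moreover have "z j = 0" for j using *[of "N + j"] z by (cases "j < n") (auto simp: v_def supp_def)
      ultimately show False using yz(2) by (auto simp: fun_eq_iff)
    qed
    ultimately show "Det X c a = 0" unfolding Det_def rdet_eq_0_iff by blast
  qed
qed

end

section \<open>Elimination of edge variables\<close>

text \<open>A polynomial \<open>t u + v\<close> of degree at most one in \<open>t\<close> has one zero if \<open>u \<noteq> 0\<close>, and otherwise none or \<open>q\<close>.\<close>

lemma sum_affine_zero:
  fixes u v :: "'k::{finite,field}"
  shows "(\<Sum>t\<in>UNIV. of_bool (t * u + v = 0) :: int) + of_bool (u = 0) = 1 + int CARD('k) * of_bool (u = 0 \<and> v = 0)"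
proof (cases "u = 0")
  case False
  then have "{t. t * u + v = 0} = {- v / u}" by (auto simp: field_simps eq_neg_iff_add_eq_0)
  then show ?thesis using False by simp
qed auto

text \<open>If \<open>u\<close> or \<open>w\<close> is nonzero there is at most one common zero, and it exists iff the resultant vanishes.\<close>

lemma sum_affine_zero2:
  fixes u v w x :: "'k::{finite,field}"
  shows "(\<Sum>t\<in>UNIV. of_bool (t * u + v = 0 \<and> t * w + x = 0) :: int) + of_bool (u = 0 \<and> w = 0)
    = int CARD('k) * of_bool (u = 0 \<and> v = 0 \<and> w = 0 \<and> x = 0) + of_bool (u * x = v * w)"
proof -
  have 1: "(\<Sum>t\<in>UNIV. of_bool (t * u + v = 0 \<and> t * w + x = 0) :: int) = of_bool (u * x = v * w)"
    if u: "u \<noteq> 0" for u v w x :: 'k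
  proof -
    have "t * u + v = 0 \<longleftrightarrow> t = - v / u" for t
      using u by (auto simp: field_simps eq_neg_iff_add_eq_0)
    moreover have "- v / u * w + x = 0 \<longleftrightarrow> u * x = v * w"
      using u by (auto simp: field_simps)
    ultimately have "{t. t * u + v = 0 \<and> t * w + x = 0} = (if u * x = v * w then {- v / u} else {})"
      by auto
    then show ?thesis by simp
  qed
  consider "u = 0" "w = 0" | "u \<noteq> 0" | "w \<noteq> 0" by blast
  then show ?thesis
  proof cases
    case 1
    then show ?thesis by auto
  next
    case 2
    then show ?thesis using 1[of u v w x] by simp
  next
    case 3
    have e: "(\<lambda>t. of_bool (t * u + v = 0 \<and> t * w + x = 0) :: int) = (\<lambda>t. of_bool (t * w + x = 0 \<and> t * u + v = 0))"
      by (simp only: conj_commute)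
    have f: "u * x = v * w \<longleftrightarrow> w * v = x * u" by (auto simp: mult.commute)
    show ?thesis using 1[OF 3, of x u v] 3 unfolding e f by simp
  qed
qed

text \<open>This is \<open>[\<alpha> A + B] = q\<^sup>k - [A] + q [A, B]\<close>, without subtraction.\<close>

lemma card_affine_zeros:
  fixes A B :: "(nat \<Rightarrow> 'k::{finite,field}) \<Rightarrow> 'k"
  assumes "finite X" "x \<notin> X" and indep: "\<And>a t. A (a(x := t)) = A a" "\<And>a t. B (a(x := t)) = B a"
  shows "int (card {a \<in> supp (insert x X). a x * A a + B a = 0}) + int (card {a \<in> supp X. A a = 0})
     = int CARD('k) ^ card X + int CARD('k) * int (card {a \<in> supp X. A a = 0 \<and> B a = 0})"
proof -
  have "int (card {a \<in> supp (insert x X). a x * A a + B a = 0}) + int (card {a \<in> supp X. A a = 0})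
    = (\<Sum>a\<in>supp X. (\<Sum>t\<in>UNIV. of_bool (t * A a + B a = 0)) + of_bool (A a = 0))"
    using assms(1) unfolding sum.distrib
    by (simp only: card_eq_sum_of_bool finite_supp finite_insert of_nat_sum of_nat_of_bool)
      (subst sum_supp_insert[OF assms(2,1)], simp only: indep fun_upd_same)
  also have "\<dots> = (\<Sum>a\<in>supp X. 1 + int CARD('k) * of_bool (A a = 0 \<and> B a = 0))"
    by (intro sum.cong refl sum_affine_zero)
  also have "\<dots> = int CARD('k) ^ card X + int CARD('k) * int (card {a \<in> supp X. A a = 0 \<and> B a = 0})"
    using assms(1) by (simp only: card_eq_sum_of_bool finite_supp sum.distrib sum_distrib_left[symmetric] of_nat_sum of_nat_of_bool)
      (simp add: card_supp)
  finally show ?thesis .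
qed

text \<open>This is \<open>[\<alpha> A + B, \<alpha> C + H] = q [A, B, C, H] + [A H - B C] - [A, C]\<close>, without subtraction.\<close>

lemma card_affine_zeros2:
  fixes A B C H :: "(nat \<Rightarrow> 'k::{finite,field}) \<Rightarrow> 'k"
  assumes "finite X" "x \<notin> X" and indep: "\<And>a t. A (a(x := t)) = A a" "\<And>a t. B (a(x := t)) = B a"
    "\<And>a t. C (a(x := t)) = C a" "\<And>a t. H (a(x := t)) = H a"
  shows "int (card {a \<in> supp (insert x X). a x * A a + B a = 0 \<and> a x * C a + H a = 0}) + int (card {a \<in> supp X. A a = 0 \<and> C a = 0})
     = int CARD('k) * int (card {a \<in> supp X. A a = 0 \<and> B a = 0 \<and> C a = 0 \<and> H a = 0}) + int (card {a \<in> supp X. A a * H a = B a * C a})"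
proof -
  have "int (card {a \<in> supp (insert x X). a x * A a + B a = 0 \<and> a x * C a + H a = 0}) + int (card {a \<in> supp X. A a = 0 \<and> C a = 0})
    = (\<Sum>a\<in>supp X. (\<Sum>t\<in>UNIV. of_bool (t * A a + B a = 0 \<and> t * C a + H a = 0)) + of_bool (A a = 0 \<and> C a = 0))"
    using assms(1) unfolding sum.distrib
    by (simp only: card_eq_sum_of_bool finite_supp finite_insert of_nat_sum of_nat_of_bool)
      (subst sum_supp_insert[OF assms(2,1)], simp only: indep fun_upd_same)
  also have "\<dots> = (\<Sum>a\<in>supp X. int CARD('k) * of_bool (A a = 0 \<and> B a = 0 \<and> C a = 0 \<and> H a = 0) + of_bool (A a * H a = B a * C a))"
    by (intro sum.cong refl sum_affine_zero2)
  also have "\<dots> = int CARD('k) * int (card {a \<in> supp X. A a = 0 \<and> B a = 0 \<and> C a = 0 \<and> H a = 0}) + int (card {a \<in> supp X. A a * H a = B a * C a})"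
    using assms(1) by (simp only: card_eq_sum_of_bool finite_supp sum.distrib sum_distrib_left[symmetric] of_nat_sum of_nat_of_bool)
  finally show ?thesis .
qed

lemma elim_inner_count:
  fixes q :: int
  assumes "x + y = p + q * e" "e + t = q * f + r"
  shows "x - q * r = p - y + q * (q * f) - q * t"
proof -
  have "x = p + q * e - y" "e = q * f + r - t" using assms by simp_all
  then show ?thesis by (simp add: algebra_simps)
qed

context incidence
begin

lemma singularE:
  assumes "singular X P Q a"
  obtains y z where "(y, z) \<in> Ker X P Q a" "(y, z) \<noteq> (0, 0)"
  using assms zero_in_Ker[of X P Q a] unfolding singular_def by auto

lemma Ker_iff:
  "(y, z) \<in> Ker X (P \<union> P') (Q \<union> Q') a \<longleftrightarrow> (y, z) \<in> Ker X P Q a \<and> (\<forall>k\<in>P'. y k = 0) \<and> (\<forall>r\<in>Q'. cobd r z = 0)"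
  by (auto simp: Ker_def cycles_def solves_def supp_def)

lemma singular_split:
  assumes "singular X (P \<union> P') (Q \<union> Q') a"
  shows "\<exists>y z. (y, z) \<in> Ker X P Q a \<and> (y, z) \<noteq> (0, 0) \<and> (\<forall>k\<in>P'. y k = 0) \<and> (\<forall>r\<in>Q'. cobd r z = 0)"
  using singularE[OF assms] unfolding Ker_iff by metis

lemma singular_mono:
  "singular X P Q a \<Longrightarrow> P' \<subseteq> P \<Longrightarrow> Q' \<subseteq> Q \<Longrightarrow> singular X P' Q' a"
proof -
  assume a: "singular X P Q a" "P' \<subseteq> P" "Q' \<subseteq> Q"
  then have "Ker X P Q a \<subseteq> Ker X P' Q' a"
    unfolding Ker_def cycles_def solves_def supp_def by blast
  then show ?thesis using a(1) zero_in_Ker[of X P Q a] unfolding singular_def by auto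
qed

lemma isotropy2:
  assumes X: "X \<subseteq> {..<N}" and ab: "a < N" "b < N" "a \<notin> X" "b \<notin> X" "a \<noteq> b"
    and K: "(y, z) \<in> Ker X ({..<N} - X - {a, b}) {} \<alpha>" "(y', z') \<in> Ker X ({..<N} - X - {a, b}) {} \<alpha>"
  shows "y a * cobd a z' - y' a * cobd a z + (y b * cobd b z' - y' b * cobd b z) = 0"
proof -
  have "0 = (\<Sum>r\<in>{..<N} - X. y r * cobd r z' - y' r * cobd r z)"
    by (rule isotropy[OF _ _ _ _ X, symmetric]) (use K in \<open>auto simp: Ker_def\<close>)
  also have "\<dots> = (\<Sum>r\<in>{a, b}. y r * cobd r z' - y' r * cobd r z)"
    by (intro sum.mono_neutral_right) (use ab K in \<open>auto simp: Ker_def cycles_def supp_def\<close>)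
  finally show ?thesis using ab by simp
qed

text \<open>If all four polynomials \<open>\<Psi>\<^bsup>ab\<^esup>\<close>, \<open>\<Psi>\<^bsup>a\<^esup>\<^sub>b\<close>, \<open>\<Psi>\<^bsup>b\<^esup>\<^sub>a\<close>, \<open>\<Psi>\<^sub>a\<^sub>b\<close> vanish, the matrix is singular for all
values of the variables of \<open>a\<close> and \<open>b\<close>, and there is a vector in all these kernels. Each hypothesis provides a kernel
vector for which two of the four values at \<open>a\<close> and \<open>b\<close> vanish; pairwise isotropy is impossible if none of them has all
four values zero.\<close>

lemma common_kernel_vector:
  assumes X: "X \<subseteq> {..<N}" and ab: "a < N" "b < N" "a \<notin> X" "b \<notin> X" "a \<noteq> b"
  defines "S \<equiv> {..<N} - X - {a, b}"
  assumes 1: "singular X (S \<union> {a, b}) {} \<alpha>" and 2: "singular X (S \<union> {a}) {b} \<alpha>"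
    and 3: "singular X (S \<union> {b}) {a} \<alpha>" and 4: "singular X S {a, b} \<alpha>"
  shows "singular X (S \<union> {a, b}) {a, b} \<alpha>"
proof (rule ccontr)
  assume not: "\<not> ?thesis"
  have T: "y a \<noteq> 0 \<or> y b \<noteq> 0 \<or> cobd a z \<noteq> 0 \<or> cobd b z \<noteq> 0"
    if "(y, z) \<in> Ker X S {} \<alpha>" "(y, z) \<noteq> (0, 0)" for y z
    using not that Ker_iff[of y z X S "{a, b}" "{}" "{a, b}" \<alpha>] unfolding singular_def by auto
  note iso = isotropy2[OF X ab, folded S_def]
  obtain y1 z1 where v1: "(y1, z1) \<in> Ker X S {} \<alpha>" "(y1, z1) \<noteq> (0, 0)" "y1 a = 0" "y1 b = 0"
    using singular_split[of X S "{a, b}" "{}" "{}" \<alpha>] 1 by auto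
  obtain y2 z2 where v2: "(y2, z2) \<in> Ker X S {} \<alpha>" "(y2, z2) \<noteq> (0, 0)" "y2 a = 0" "cobd b z2 = 0"
    using singular_split[of X S "{a}" "{}" "{b}" \<alpha>] 2 by auto
  obtain y3 z3 where v3: "(y3, z3) \<in> Ker X S {} \<alpha>" "(y3, z3) \<noteq> (0, 0)" "y3 b = 0" "cobd a z3 = 0"
    using singular_split[of X S "{b}" "{}" "{a}" \<alpha>] 3 by auto
  obtain y4 z4 where v4: "(y4, z4) \<in> Ker X S {} \<alpha>" "(y4, z4) \<noteq> (0, 0)" "cobd a z4 = 0" "cobd b z4 = 0"
    using singular_split[of X S "{}" "{}" "{a, b}" \<alpha>] 4 by auto
  show False
    using iso[OF v1(1) v2(1)] iso[OF v1(1) v3(1)] iso[OF v1(1) v4(1)] iso[OF v2(1) v3(1)]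
      iso[OF v2(1) v4(1)] iso[OF v3(1) v4(1)] T[OF v1(1,2)] T[OF v2(1,2)] T[OF v3(1,2)] T[OF v4(1,2)]
      v1 v2 v3 v4 by auto
qed

text \<open>This replaces the symmetry \<open>\<Psi>\<^bsup>a,b\<^esup> = \<plusminus> \<Psi>\<^bsup>b,a\<^esup>\<close>. Unless the given vector has values zero at \<open>b\<close>
itself, isotropy with it makes the values at \<open>b\<close> of all vectors of a space of dimension at least two proportional, so
some nonzero vector of that space has values zero at \<open>b\<close>.\<close>

lemma singular_swap:
  assumes X: "X \<subseteq> {..<N}" and ab: "a < N" "b < N" "a \<notin> X" "b \<notin> X" "a \<noteq> b"
  defines "S \<equiv> {..<N} - X - {a, b}"
  assumes 1: "singular X (S \<union> {a}) {a} \<alpha>"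
  shows "singular X (S \<union> {b}) {b} \<alpha>"
proof -
  have fin: "finite X" using X by (rule finite_subset) simp
  note iso = isotropy2[OF X ab, folded S_def]
  obtain y z where v: "(y, z) \<in> Ker X S {} \<alpha>" "(y, z) \<noteq> (0, 0)" "y a = 0" "cobd a z = 0"
    using singular_split[of X S "{a}" "{}" "{a}" \<alpha>] 1 by auto
  \<comment> \<open>a coordinate at \<open>b\<close> in which the given vector is nonzero unless it vanishes at \<open>b\<close> altogether\<close>
  define g where "g = (\<lambda>w. if y b \<noteq> 0 then fst w b else cobd b (snd w))"
  show ?thesis
  proof (cases "y b = 0 \<and> cobd b z = 0")
    case True
    then have "(y, z) \<in> Ker X (S \<union> {b}) {b} \<alpha>"
      using v Ker_iff[of y z X S "{b}" "{}" "{b}" \<alpha>] by auto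
    then show ?thesis using v(2) unfolding singular_def by blast
  next
    case False
    have "{w \<in> Ker X S {} \<alpha>. g w = 0} \<subseteq> Ker X (S \<union> {b}) {b} \<alpha>"
    proof
      fix w assume "w \<in> {w \<in> Ker X S {} \<alpha>. g w = 0}"
      then obtain y' z' where w: "w = (y', z')" "(y', z') \<in> Ker X S {} \<alpha>" "g (y', z') = 0"
        by (cases w) auto
      have "y' b = 0 \<and> cobd b z' = 0"
        using iso[OF v(1) w(2)] w(3) v False by (auto simp: g_def split: if_splits)
      then show "w \<in> Ker X (S \<union> {b}) {b} \<alpha>"
        using w Ker_iff[of y' z' X S "{b}" "{}" "{b}" \<alpha>] by auto
    qed
    then have le: "card {w \<in> Ker X S {} \<alpha>. g w = 0} \<le> card (Ker X (S \<union> {b}) {b} \<alpha>)"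
      by (intro card_mono) auto
    have card: "card {w \<in> Ker X S {} \<alpha>. g w = 0} * CARD('k) = card (Ker X S {} \<alpha>)"
      by (rule card_hyperplane[where u = "(y, z)" and sc = "\<lambda>c. map_prod (smul c) (smul c)"])
        (use v False in \<open>auto simp: g_def intro: Ker_subspace\<close>)
    obtain d where d: "card (Ker X S {} \<alpha>) = CARD('k) ^ d" "card ({..<N} - S) \<le> d + card X"
      using card_Ker_ge[OF fin, of "{}" S \<alpha>] by auto
    have "{..<N} - S = insert a (insert b X)" using X ab by (auto simp: S_def)
    then have "2 \<le> d" using d(2) ab fin by simp
    then obtain e where "d = Suc (Suc e)" by (metis add_2_eq_Suc le_Suc_ex)
    then have "card {w \<in> Ker X S {} \<alpha>. g w = 0} = CARD('k) ^ Suc e" using card d(1) by simp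
    moreover have "card {0::'k, 1} \<le> CARD('k)" by (rule card_mono) auto
    then have "2 * 1 \<le> CARD('k) * CARD('k) ^ e" by (intro mult_le_mono) (auto simp: Suc_le_eq)
    ultimately have "card {w \<in> Ker X S {} \<alpha>. g w = 0} \<ge> 2" by simp
    then show ?thesis using le unfolding singular_def by auto
  qed
qed

text \<open>The number of zeros of the graph polynomial of the subgraph with edge set \<open>X\<close>.\<close>

abbreviation num_singular :: "nat set \<Rightarrow> int" where
  "num_singular X \<equiv> int (card {a \<in> supp X. singular X ({..<N} - X) {} a})"

lemma num_singular_eq: "X \<subseteq> {..<N} \<Longrightarrow> {a \<in> supp X. singular X ({..<N} - X) {} a} = {a \<in> supp X. Det X Unit a = 0}"
  by (subst Det_eq_0_iff) auto

lemma Det_eq_0_iff2: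
  assumes X: "X \<subseteq> {..<N}" and ab: "a < N" "b < N" "a \<notin> X" "b \<notin> X" "a \<noteq> b"
    and uv: "units {u, v} \<subseteq> {..<N}"
  shows "Det X (Unit(a := u, b := v)) \<alpha> = 0 \<longleftrightarrow> singular X ({..<N} - X - {a, b} \<union> units {u, v}) (incs {u, v}) \<alpha>"
proof -
  have "(Unit(a := u, b := v)) ` ({..<N} - X) = Unit ` ({..<N} - X - {a, b}) \<union> {u, v}"
    using ab by auto
  then have u: "units ((Unit(a := u, b := v)) ` ({..<N} - X)) = {..<N} - X - {a, b} \<union> units {u, v}"
    and i: "incs ((Unit(a := u, b := v)) ` ({..<N} - X)) = incs {u, v}"
    by (simp_all only: units_incs(7-10) Un_empty_left)
  show ?thesis unfolding u[symmetric] i[symmetric]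
    by (rule Det_eq_0_iff[OF X]) (use uv u in auto)
qed

text \<open>Eliminating the variable of \<open>a\<close> and then that of \<open>b\<close>, the resultant is the square of
\<open>\<Psi>\<^bsup>a,b\<^esup>\<close> up to sign, so \<open>[\<Psi>]\<close> is congruent to \<open>q [\<Psi>\<^bsup>a,b\<^esup>]\<close>. The pair \<open>\<Psi>\<^bsup>ab\<^esup>, \<Psi>\<^bsup>b\<^esup>\<^sub>a\<close> that is subtracted occurs
also in the elimination of \<open>a\<close> from the graph without \<open>b\<close>, where all other counts are divisible by \<open>q\<^sup>3\<close>.\<close>

lemma num_singular_double_elimination:
  assumes X: "X \<subseteq> {..<N}" and ab: "a < N" "b < N" "a \<notin> X" "b \<notin> X" "a \<noteq> b"
    and c: "3 \<le> card X" "card X + 2 \<le> 2 * n" and n: "3 \<le> n"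
  shows "[num_singular (insert a (insert b X)) =
    q * int (card {\<alpha> \<in> supp X. singular X ({..<N} - X - {a, b} \<union> {b}) {b} \<alpha>})] (mod q ^ 3)"
proof -
  have fin: "finite X" using X by (rule finite_subset) simp
  let ?S = "{..<N} - X - {a, b}"
  define \<phi> where "\<phi> = (\<lambda>u v. Det X (Unit(a := u, b := v)))"
  have \<phi>0: "\<phi> u v \<alpha> = 0 \<longleftrightarrow> singular X (?S \<union> units {u, v}) (incs {u, v}) \<alpha>" if "units {u, v} \<subseteq> {..<N}" for u v \<alpha>
    unfolding \<phi>_def using Det_eq_0_iff2[OF X ab that] .
  have Xa: "insert a X \<subseteq> {..<N}" and Xb: "insert b X \<subseteq> {..<N}" and Xab: "insert a (insert b X) \<subseteq> {..<N}"
    using X ab by auto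
  have U: "Unit(x := Unit x) = Unit" for x by auto
  have UU: "Unit(a := Unit a, b := w) = Unit(b := w)" for w by auto
  let ?C = "\<lambda>R. int (card {\<alpha> \<in> supp X. R \<alpha>})"
  let ?e1 = "int (card {\<alpha> \<in> supp (insert b X). Det (insert b X) Unit \<alpha> = 0 \<and> Det (insert b X) (Unit(a := Inc a)) \<alpha> = 0})"
  have s1: "num_singular (insert a (insert b X)) + num_singular (insert b X) = q ^ card (insert b X) + q * ?e1"
    unfolding num_singular_eq[OF Xab] num_singular_eq[OF Xb] q_def
    using card_affine_zeros[of "insert b X" a "Det (insert b X) Unit" "Det (insert b X) (Unit(a := Inc a))"]
    using ab fin by (simp add: Det_affine U)
  have s2: "?e1 + ?C (\<lambda>\<alpha>. \<phi> (Unit a) (Unit b) \<alpha> = 0 \<and> \<phi> (Inc a) (Unit b) \<alpha> = 0)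
     = q * ?C (\<lambda>\<alpha>. \<phi> (Unit a) (Unit b) \<alpha> = 0 \<and> \<phi> (Unit a) (Inc b) \<alpha> = 0 \<and> \<phi> (Inc a) (Unit b) \<alpha> = 0 \<and> \<phi> (Inc a) (Inc b) \<alpha> = 0)
      + ?C (\<lambda>\<alpha>. \<phi> (Unit a) (Unit b) \<alpha> * \<phi> (Inc a) (Inc b) \<alpha> = \<phi> (Unit a) (Inc b) \<alpha> * \<phi> (Inc a) (Unit b) \<alpha>)"
    unfolding q_def
    using card_affine_zeros2[of X b "\<phi> (Unit a) (Unit b)" "\<phi> (Unit a) (Inc b)" "\<phi> (Inc a) (Unit b)" "\<phi> (Inc a) (Inc b)"]
    using ab fin by (simp add: Det_affine U UU \<phi>_def)
  have s3: "num_singular (insert a X) + num_singular X = q ^ card X + q * ?C (\<lambda>\<alpha>. \<phi> (Unit a) (Unit b) \<alpha> = 0 \<and> \<phi> (Inc a) (Unit b) \<alpha> = 0)"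
    unfolding num_singular_eq[OF Xa] num_singular_eq[OF X] q_def
    using card_affine_zeros[of X a "Det X Unit" "Det X (Unit(a := Inc a))"]
    using ab fin by (simp add: Det_affine U \<phi>_def) (simp add: fun_upd_twist[of a b] U)
  have "\<phi> (Unit a) (Unit b) \<alpha> * \<phi> (Inc a) (Inc b) \<alpha> = \<phi> (Inc b) (Unit b) \<alpha> * \<phi> (Inc a) (Unit a) \<alpha>
      + \<phi> (Unit a) (Inc b) \<alpha> * \<phi> (Inc a) (Unit b) \<alpha>" for \<alpha>
    unfolding \<phi>_def by (rule Det_pluecker) (use ab in auto)
  then have "\<phi> (Unit a) (Unit b) \<alpha> * \<phi> (Inc a) (Inc b) \<alpha> = \<phi> (Unit a) (Inc b) \<alpha> * \<phi> (Inc a) (Unit b) \<alpha> \<longleftrightarrow>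
      singular X (?S \<union> {b}) {b} \<alpha> \<or> singular X (?S \<union> {a}) {a} \<alpha>" for \<alpha>
    using ab by (simp add: \<phi>0)
  moreover have "singular X (?S \<union> {a}) {a} \<alpha> \<Longrightarrow> singular X (?S \<union> {b}) {b} \<alpha>" for \<alpha>
    by (rule singular_swap[OF X ab])
  ultimately have res: "?C (\<lambda>\<alpha>. \<phi> (Unit a) (Unit b) \<alpha> * \<phi> (Inc a) (Inc b) \<alpha> = \<phi> (Unit a) (Inc b) \<alpha> * \<phi> (Inc a) (Unit b) \<alpha>)
     = ?C (\<lambda>\<alpha>. singular X (?S \<union> {b}) {b} \<alpha>)" by (metis (no_types, lifting))
  have "\<phi> (Unit a) (Unit b) \<alpha> = 0 \<and> \<phi> (Unit a) (Inc b) \<alpha> = 0 \<and> \<phi> (Inc a) (Unit b) \<alpha> = 0 \<and> \<phi> (Inc a) (Inc b) \<alpha> = 0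
     \<longleftrightarrow> singular X (?S \<union> {a, b}) {a, b} \<alpha>" for \<alpha>
  proof -
    have "\<phi> (Unit a) (Unit b) \<alpha> = 0 \<and> \<phi> (Unit a) (Inc b) \<alpha> = 0 \<and> \<phi> (Inc a) (Unit b) \<alpha> = 0 \<and> \<phi> (Inc a) (Inc b) \<alpha> = 0
      \<longleftrightarrow> singular X (?S \<union> {a, b}) {} \<alpha> \<and> singular X (?S \<union> {a}) {b} \<alpha> \<and> singular X (?S \<union> {b}) {a} \<alpha> \<and> singular X ?S {a, b} \<alpha>"
      using ab by (simp add: \<phi>0)
    also have "\<dots> \<longleftrightarrow> singular X (?S \<union> {a, b}) {a, b} \<alpha>"
    proof
      assume k: "singular X (?S \<union> {a, b}) {a, b} \<alpha>"
      show "singular X (?S \<union> {a, b}) {} \<alpha> \<and> singular X (?S \<union> {a}) {b} \<alpha> \<and> singular X (?S \<union> {b}) {a} \<alpha> \<and> singular X ?S {a, b} \<alpha>"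
        by (intro conjI singular_mono[OF k]) auto
    qed (blast intro: common_kernel_vector[OF X ab, of \<alpha>])
    finally show ?thesis .
  qed
  note 4 = this
  have four: "q dvd ?C (\<lambda>\<alpha>. \<phi> (Unit a) (Unit b) \<alpha> = 0 \<and> \<phi> (Unit a) (Inc b) \<alpha> = 0 \<and> \<phi> (Inc a) (Unit b) \<alpha> = 0 \<and> \<phi> (Inc a) (Inc b) \<alpha> = 0)"
    unfolding 4 by (rule dvd_card_singular[OF fin]) (use n c(1) ab in auto)
  have d: "q ^ 3 dvd num_singular (insert b X)" "q ^ 3 dvd num_singular (insert a X)" "q ^ 3 dvd num_singular X"
    using c n X Xa Xb ab fin by (intro cube_dvd_num_singular; simp)+
  have p: "q ^ 3 dvd q ^ card X" "q ^ 3 dvd q ^ card (insert b X)"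
    using c ab fin by (intro le_imp_power_dvd; simp)+
  let ?t = "?C (\<lambda>\<alpha>. \<phi> (Unit a) (Unit b) \<alpha> = 0 \<and> \<phi> (Inc a) (Unit b) \<alpha> = 0)"
  let ?f = "?C (\<lambda>\<alpha>. \<phi> (Unit a) (Unit b) \<alpha> = 0 \<and> \<phi> (Unit a) (Inc b) \<alpha> = 0 \<and> \<phi> (Inc a) (Unit b) \<alpha> = 0 \<and> \<phi> (Inc a) (Inc b) \<alpha> = 0)"
  have "num_singular (insert a (insert b X)) - q * ?C (\<lambda>\<alpha>. singular X (?S \<union> {b}) {b} \<alpha>)
    = q ^ card (insert b X) - num_singular (insert b X) + q * (q * ?f) - q * ?t"
    by (rule elim_inner_count[OF s1 s2[unfolded res]])
  also have "q * ?t = num_singular (insert a X) + num_singular X - q ^ card X" using s3 by linarith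
  finally have e: "num_singular (insert a (insert b X)) - q * ?C (\<lambda>\<alpha>. singular X (?S \<union> {b}) {b} \<alpha>)
    = q ^ card (insert b X) - num_singular (insert b X) + q * (q * ?f) - (num_singular (insert a X) + num_singular X - q ^ card X)" .
  have "q ^ 3 dvd q * (q * ?f)" using four by (simp add: power3_eq_cube mult_dvd_mono)
  then show ?thesis unfolding cong_iff_dvd_diff e using d p by (intro dvd_diff dvd_add)
qed

end

lemma elim_outer_count:
  fixes q :: int
  assumes "x + y = p + q * h"
  shows "q * x - (- (q ^ 2) * z) = q * p - q * y + q ^ 2 * (h + z)"
proof -
  have x: "x = p + q * h - y" using assms by simp
  show ?thesis unfolding x by (simp add: algebra_simps power2_eq_square)
qed

context incidence
begin

text \<open>Let \<open>a, b, c, d\<close> be the edges 1, 2, 3, 4. The variable of \<open>c\<close> has the coefficient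
\<open>\<Psi>\<^bsup>ac,bc\<^esup>\<close> in \<open>\<Psi>\<^bsup>a,b\<^esup>\<close>, whose number of zeros is controlled by applying \<open>num_singular_double_elimination\<close> to the graph
without \<open>c\<close>. The resultant in the variable of \<open>d\<close> is the product of \<open>\<Psi>\<^bsup>ac,bd\<^esup>\<close> and \<open>\<Psi>\<^bsup>ad,bc\<^esup>\<close>, and the zeros of a
product are counted by inclusion and exclusion.\<close>

theorem num_singular_eq_pair_count:
  assumes N: "N = 2 * n" and n: "3 \<le> n" and lt: "a < N" "b < N" "c < N" "d < N"
    and dist: "distinct [a, b, c, d]"
  defines "X \<equiv> {..<N} - {a, b, c, d}"
  shows "[num_singular {..<N} = - (q ^ 2) * int (card {\<alpha> \<in> supp X. singular X {b, d} {b, d} \<alpha> \<and> singular X {b, c} {b, c} \<alpha>})] (mod q ^ 3)"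
proof -
  let ?C = "\<lambda>R. int (card {\<alpha> \<in> supp X. R \<alpha>})"
  let ?X3 = "insert d X" and ?X2 = "insert c (insert d X)"
  have fin: "finite X" by (simp add: X_def)
  have sub: "X \<subseteq> {..<N}" "?X3 \<subseteq> {..<N}" "?X2 \<subseteq> {..<N}" using lt by (auto simp: X_def)
  have abcd: "{..<N} - X = {a, b, c, d}" using lt by (auto simp: X_def)
  have all: "{..<N} = insert a (insert b ?X2)" using lt by (auto simp: X_def)
  have ne: "a \<noteq> b" "a \<noteq> c" "a \<noteq> d" "b \<noteq> c" "b \<noteq> d" "c \<noteq> d" using dist by auto
  have notin: "a \<notin> X" "b \<notin> X" "c \<notin> X" "d \<notin> X" by (auto simp: X_def)
  have card: "card X = 2 * n - 4"
  proof -
    have "card X = card {..<N} - card {a, b, c, d}"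
      unfolding X_def by (rule card_Diff_subset) (use lt in auto)
    then show ?thesis using N ne by simp
  qed
  have card3: "card ?X3 = 2 * n - 3" using card notin fin n by simp
  have card2: "card ?X2 = 2 * n - 2" using card3 notin fin n ne by simp
  have S2: "{..<N} - ?X2 - {a, b} = {}" and S3: "{..<N} - ?X3 - {a, b} = {c}"
    using lt ne notin by (auto simp: X_def)
  \<comment> \<open>the numbers of zeros of \<open>\<Psi>\<^bsup>a,b\<^esup>\<close> and of \<open>\<Psi>\<^bsup>ac,bc\<^esup>\<close>\<close>
  let ?G2 = "int (card {\<alpha> \<in> supp ?X2. singular ?X2 ({..<N} - ?X2 - {a, b} \<union> {b}) {b} \<alpha>})"
  let ?G3 = "int (card {\<alpha> \<in> supp ?X3. singular ?X3 ({..<N} - ?X3 - {a, b} \<union> {b}) {b} \<alpha>})"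
  have R2: "[num_singular {..<N} = q * ?G2] (mod q ^ 3)"
  proof -
    have "[num_singular (insert a (insert b ?X2)) = q * ?G2] (mod q ^ 3)"
      by (rule num_singular_double_elimination[OF sub(3)]) (use lt ne notin card2 n in auto)
    then show ?thesis unfolding all[symmetric] .
  qed
  have G3: "q ^ 3 dvd q * ?G3"
  proof -
    have c: "[num_singular (insert a (insert b ?X3)) = q * ?G3] (mod q ^ 3)"
      by (rule num_singular_double_elimination[OF sub(2)]) (use lt ne notin card3 n in auto)
    have "q ^ 3 dvd num_singular (insert a (insert b ?X3))"
      by (rule cube_dvd_num_singular) (use sub lt ne notin card3 n fin in auto)
    then show ?thesis by (rule iffD1[OF cong_dvd_iff[OF c]])
  qed
  \<comment> \<open>the rows of \<open>\<Psi>\<^bsup>a,b\<^esup>\<close>\<close>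
  define e where "e = Unit(a := Unit b, b := Inc b)"
  have ec: "e(c := Unit c) = e" using ne by (auto simp: e_def)
  let ?H = "int (card {\<alpha> \<in> supp ?X3. Det ?X3 e \<alpha> = 0 \<and> Det ?X3 (e(c := Inc c)) \<alpha> = 0})"
  have s1: "?G2 + ?G3 = q ^ card ?X3 + q * ?H"
  proof -
    have "singular ?X2 ({..<N} - ?X2 - {a, b} \<union> {b}) {b} \<alpha> \<longleftrightarrow> Det ?X2 e \<alpha> = 0" for \<alpha>
      unfolding e_def by (subst Det_eq_0_iff2[OF sub(3)]) (use lt ne notin in auto)
    moreover have "singular ?X3 ({..<N} - ?X3 - {a, b} \<union> {b}) {b} \<alpha> \<longleftrightarrow> Det ?X3 e \<alpha> = 0" for \<alpha>
      unfolding e_def by (subst Det_eq_0_iff2[OF sub(2)]) (use lt ne notin in auto)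
    moreover have "Det ?X2 e \<alpha> = \<alpha> c * Det ?X3 e \<alpha> + Det ?X3 (e(c := Inc c)) \<alpha>" for \<alpha>
      using Det_affine[of c ?X3 e \<alpha>] ec lt ne notin by simp
    ultimately show ?thesis
      using card_affine_zeros[of ?X3 c "Det ?X3 e" "Det ?X3 (e(c := Inc c))"] fin ne notin
      by (simp add: q_def)
  qed
  define \<phi> where "\<phi> = (\<lambda>u v. Det X (e(c := u, d := v)))"
  have \<phi>0: "\<phi> u v \<alpha> = 0 \<longleftrightarrow> singular X (insert b (units {u, v})) (insert b (incs {u, v})) \<alpha>"
    if "units {u, v} \<subseteq> {..<N}" for u v \<alpha>
  proof -
    have im: "(e(c := u, d := v)) ` ({..<N} - X) = {Unit b, Inc b} \<union> {u, v}"
      unfolding abcd e_def using ne by auto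
    have "units ((e(c := u, d := v)) ` ({..<N} - X)) = insert b (units {u, v})"
      "incs ((e(c := u, d := v)) ` ({..<N} - X)) = insert b (incs {u, v})"
      unfolding im by (simp_all only: units_incs(9,10)) simp_all
    then show ?thesis unfolding \<phi>_def using Det_eq_0_iff[OF sub(1), of "e(c := u, d := v)" \<alpha>] that lt by simp
  qed
  have aff: "Det ?X3 e \<alpha> = \<alpha> d * \<phi> (Unit c) (Unit d) \<alpha> + \<phi> (Unit c) (Inc d) \<alpha>"
    "Det ?X3 (e(c := Inc c)) \<alpha> = \<alpha> d * \<phi> (Inc c) (Unit d) \<alpha> + \<phi> (Inc c) (Inc d) \<alpha>" for \<alpha>
    using Det_affine[of d X "e(c := Unit c)" \<alpha>] Det_affine[of d X "e(c := Inc c)" \<alpha>] lt notin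
    by (simp_all add: ec \<phi>_def)
  let ?t = "?C (\<lambda>\<alpha>. \<phi> (Unit c) (Unit d) \<alpha> = 0 \<and> \<phi> (Inc c) (Unit d) \<alpha> = 0)"
  let ?f = "?C (\<lambda>\<alpha>. \<phi> (Unit c) (Unit d) \<alpha> = 0 \<and> \<phi> (Unit c) (Inc d) \<alpha> = 0 \<and> \<phi> (Inc c) (Unit d) \<alpha> = 0 \<and> \<phi> (Inc c) (Inc d) \<alpha> = 0)"
  let ?r = "?C (\<lambda>\<alpha>. \<phi> (Unit c) (Unit d) \<alpha> * \<phi> (Inc c) (Inc d) \<alpha> = \<phi> (Unit c) (Inc d) \<alpha> * \<phi> (Inc c) (Unit d) \<alpha>)"
  have s2: "?H + ?t = q * ?f + ?r"
    unfolding aff q_def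
    by (rule card_affine_zeros2) (use fin notin in \<open>auto simp: \<phi>_def\<close>)
  have t: "q dvd ?t"
  proof -
    have "\<phi> (Unit c) (Unit d) \<alpha> = 0 \<and> \<phi> (Inc c) (Unit d) \<alpha> = 0 \<longleftrightarrow>
       singular X {b, c, d} {b} \<alpha> \<and> singular X {b, d} {b, c} \<alpha>" for \<alpha>
      using lt by (simp add: \<phi>0)
    moreover have "q dvd ?C (\<lambda>\<alpha>. singular X {b, c, d} {b} \<alpha> \<and> singular X {b, d} {b, c} \<alpha>)"
      by (rule dvd_card_singular_pair) (use fin n card ne in auto)
    ultimately show ?thesis by simp
  qed
  let ?A = "\<lambda>\<alpha>. singular X {b, d} {b, d} \<alpha>" and ?B = "\<lambda>\<alpha>. singular X {b, c} {b, c} \<alpha>"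
  have "\<phi> (Unit c) (Unit d) \<alpha> * \<phi> (Inc c) (Inc d) \<alpha> = \<phi> (Inc d) (Unit d) \<alpha> * \<phi> (Inc c) (Unit c) \<alpha>
      + \<phi> (Unit c) (Inc d) \<alpha> * \<phi> (Inc c) (Unit d) \<alpha>" for \<alpha>
    unfolding \<phi>_def by (rule Det_pluecker) (use lt notin ne in auto)
  then have r: "\<phi> (Unit c) (Unit d) \<alpha> * \<phi> (Inc c) (Inc d) \<alpha> = \<phi> (Unit c) (Inc d) \<alpha> * \<phi> (Inc c) (Unit d) \<alpha> \<longleftrightarrow>
      ?A \<alpha> \<or> ?B \<alpha>" for \<alpha>
    using lt by (simp add: \<phi>0)
  have "card {\<alpha> \<in> supp X. ?A \<alpha> \<or> ?B \<alpha>} + card {\<alpha> \<in> supp X. ?A \<alpha> \<and> ?B \<alpha>} = card {\<alpha> \<in> supp X. ?A \<alpha>} + card {\<alpha> \<in> supp X. ?B \<alpha>}"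
  proof -
    have "{\<alpha> \<in> supp X. ?A \<alpha> \<or> ?B \<alpha>} = {\<alpha> \<in> supp X. ?A \<alpha>} \<union> {\<alpha> \<in> supp X. ?B \<alpha>}"
      "{\<alpha> \<in> supp X. ?A \<alpha> \<and> ?B \<alpha>} = {\<alpha> \<in> supp X. ?A \<alpha>} \<inter> {\<alpha> \<in> supp X. ?B \<alpha>}" by auto
    then show ?thesis using card_Un_Int[of "{\<alpha> \<in> supp X. ?A \<alpha>}" "{\<alpha> \<in> supp X. ?B \<alpha>}"] fin by simp
  qed
  then have r': "?r = ?C ?A + ?C ?B - ?C (\<lambda>\<alpha>. ?A \<alpha> \<and> ?B \<alpha>)" unfolding r by linarith
  have "card X > 0" using card n by simp
  then have "X \<noteq> {}" by auto
  then have AB: "q dvd ?C ?A" "q dvd ?C ?B"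
    using n fin ne by (intro dvd_card_singular; auto)+
  have H: "q dvd ?H + ?C (\<lambda>\<alpha>. ?A \<alpha> \<and> ?B \<alpha>)"
  proof -
    have "?H + ?C (\<lambda>\<alpha>. ?A \<alpha> \<and> ?B \<alpha>) = q * ?f + (?C ?A + ?C ?B) - ?t" using s2 r' by linarith
    then show ?thesis using AB t by simp
  qed
  have "q ^ 3 dvd q ^ card ?X3" using card3 n by (intro le_imp_power_dvd) simp
  then have p: "q ^ 3 dvd q * q ^ card ?X3" by (rule dvd_mult)
  have "q * ?G2 - (- (q ^ 2) * ?C (\<lambda>\<alpha>. ?A \<alpha> \<and> ?B \<alpha>)) =
      q * q ^ card ?X3 - q * ?G3 + q ^ 2 * (?H + ?C (\<lambda>\<alpha>. ?A \<alpha> \<and> ?B \<alpha>))"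
    by (rule elim_outer_count[OF s1])
  moreover have "q ^ 3 dvd q ^ 2 * (?H + ?C (\<lambda>\<alpha>. ?A \<alpha> \<and> ?B \<alpha>))"
    using H by (simp add: power3_eq_cube power2_eq_square mult_dvd_mono)
  ultimately have "[q * ?G2 = - (q ^ 2) * ?C (\<lambda>\<alpha>. ?A \<alpha> \<and> ?B \<alpha>)] (mod q ^ 3)"
    unfolding cong_iff_dvd_diff by (simp only: dvd_add[OF dvd_diff[OF p G3]])
  with R2 show ?thesis by (rule cong_trans)
qed

end

section \<open>The matrix-tree theorem\<close>

lemma sum_Pow_insert:
  assumes "finite X" "x \<notin> X"
  shows "(\<Sum>S\<in>Pow (insert x X). f S) = (\<Sum>S\<in>Pow X. f (insert x S)) + (\<Sum>S\<in>Pow X. f S)"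
proof -
  have "inj_on (insert x) (Pow X)" using assms(2) by (force simp: inj_on_def)
  then have "(\<Sum>S\<in>Pow X. f (insert x S)) = (\<Sum>S\<in>insert x ` Pow X. f S)"
    by (simp add: sum.reindex)
  moreover have "Pow X \<inter> insert x ` Pow X = {}" using assms(2) by auto
  ultimately show ?thesis
    unfolding Pow_insert using assms(1) by (subst sum.union_disjoint) (auto simp: add.commute)
qed

context incidence
begin

text \<open>The expansion of the determinant as a polynomial in the edge variables: each of them is taken from the
diagonal for the edges in \<open>S\<close> and set to zero for the others.\<close>

lemma Det_expand:
  assumes "finite X" "X \<subseteq> {..<N}"
  shows "Det X c a = (\<Sum>S\<in>Pow X. (\<Prod>r\<in>S. a r) * Det {} (\<lambda>r. if r \<in> S then Unit r else if r \<in> X then Inc r else c r) a)"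
  using assms
proof (induction X arbitrary: c rule: finite_induct)
  case empty
  then show ?case by simp
next
  case (insert x X)
  have IH: "Det X c a = (\<Sum>S\<in>Pow X. (\<Prod>r\<in>S. a r) * Det {} (\<lambda>r. if r \<in> S then Unit r else if r \<in> X then Inc r else c r) a)" for c
    using insert by simp
  let ?D = "\<lambda>c. Det {} c a"
  have "(\<Sum>S\<in>Pow (insert x X). (\<Prod>r\<in>S. a r) * ?D (\<lambda>r. if r \<in> S then Unit r else if r \<in> insert x X then Inc r else c r))
    = (\<Sum>S\<in>Pow X. (\<Prod>r\<in>insert x S. a r) * ?D (\<lambda>r. if r \<in> insert x S then Unit r else if r \<in> insert x X then Inc r else c r))
    + (\<Sum>S\<in>Pow X. (\<Prod>r\<in>S. a r) * ?D (\<lambda>r. if r \<in> S then Unit r else if r \<in> insert x X then Inc r else c r))"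
    by (rule sum_Pow_insert[OF insert.hyps])
  also have "(\<Sum>S\<in>Pow X. (\<Prod>r\<in>insert x S. a r) * ?D (\<lambda>r. if r \<in> insert x S then Unit r else if r \<in> insert x X then Inc r else c r))
    = (\<Sum>S\<in>Pow X. a x * ((\<Prod>r\<in>S. a r) * ?D (\<lambda>r. if r \<in> S then Unit r else if r \<in> X then Inc r else (c(x := Unit x)) r)))"
  proof (intro sum.cong refl)
    fix S assume "S \<in> Pow X"
    then have S: "finite S" "x \<notin> S" using insert.hyps finite_subset by auto
    have "(\<lambda>r. if r \<in> insert x S then Unit r else if r \<in> insert x X then Inc r else c r)
      = (\<lambda>r. if r \<in> S then Unit r else if r \<in> X then Inc r else (c(x := Unit x)) r)"
      using S insert.hyps by auto
    then show "(\<Prod>r\<in>insert x S. a r) * ?D (\<lambda>r. if r \<in> insert x S then Unit r else if r \<in> insert x X then Inc r else c r)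
      = a x * ((\<Prod>r\<in>S. a r) * ?D (\<lambda>r. if r \<in> S then Unit r else if r \<in> X then Inc r else (c(x := Unit x)) r))"
      using S by (simp add: mult.assoc)
  qed
  also have "(\<Sum>S\<in>Pow X. (\<Prod>r\<in>S. a r) * ?D (\<lambda>r. if r \<in> S then Unit r else if r \<in> insert x X then Inc r else c r))
    = (\<Sum>S\<in>Pow X. (\<Prod>r\<in>S. a r) * ?D (\<lambda>r. if r \<in> S then Unit r else if r \<in> X then Inc r else (c(x := Inc x)) r))"
  proof (intro sum.cong refl)
    fix S assume "S \<in> Pow X"
    then have S: "finite S" "x \<notin> S" using insert.hyps finite_subset by auto
    have "(\<lambda>r. if r \<in> S then Unit r else if r \<in> insert x X then Inc r else c r)
      = (\<lambda>r. if r \<in> S then Unit r else if r \<in> X then Inc r else (c(x := Inc x)) r)"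
      using S insert.hyps by auto
    then show "(\<Prod>r\<in>S. a r) * ?D (\<lambda>r. if r \<in> S then Unit r else if r \<in> insert x X then Inc r else c r)
      = (\<Prod>r\<in>S. a r) * ?D (\<lambda>r. if r \<in> S then Unit r else if r \<in> X then Inc r else (c(x := Inc x)) r)" by simp
  qed
  finally show ?case
    using Det_affine[of x X c a] insert.hyps insert.prems IH by (simp add: sum_distrib_left)
qed

text \<open>The rows and columns of \<open>T\<close> are brought to the identity by the integer inverse \<open>Y\<close> of the square matrix of the
rows of \<open>E\<close> in \<open>T\<close>. What remains is the Gram matrix of that square matrix, of determinant \<open>(\<plusminus>1)\<^sup>2\<close>. Working over
the integers first is what excludes other units of the field.\<close>

lemma Det_unimodular:
  fixes Ez Y :: "nat \<Rightarrow> nat \<Rightarrow> int"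
  assumes T: "T \<subseteq> {..<N}" "card T = n" and Ez: "\<And>r j. E r j = of_int (Ez r j)"
    and Y: "\<And>i j. i < n \<Longrightarrow> j < n \<Longrightarrow> (\<Sum>r\<in>T. Y i r * Ez r j) = (if i = j then 1 else 0)"
  shows "Det {} (\<lambda>r. if r \<in> T then Inc r else Unit r) a = 1"
proof -
  have fin: "finite T" using T(1) by (rule finite_subset) simp
  obtain t where t: "bij_betw t {..<n} T"
    using ex_bij_betw_nat_finite[OF fin] T(2) by (auto simp: atLeast0LessThan)
  have t_in: "t i \<in> T" if "i < n" for i using t that by (auto simp: bij_betw_def)
  have sumT: "(\<Sum>r\<in>T. f r) = (\<Sum>i<n. f (t i))" for f :: "nat \<Rightarrow> 'x::comm_monoid_add"
    using sum.reindex_bij_betw[OF t, of f] by simp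
  define ET YT where "ET = mat n n (\<lambda>(i, j). Ez (t i) j)" and "YT = mat n n (\<lambda>(i, k). Y i (t k))"
  have carr [simp]: "ET \<in> carrier_mat n n" "YT \<in> carrier_mat n n" by (simp_all add: ET_def YT_def)
  have YE: "YT * ET = 1\<^sub>m n"
  proof (rule eq_matI)
    fix i j assume ij: "i < dim_row (1\<^sub>m n :: int mat)" "j < dim_col (1\<^sub>m n :: int mat)"
    then have "(YT * ET) $$ (i, j) = (\<Sum>k<n. Y i (t k) * Ez (t k) j)"
      by (simp add: ET_def YT_def scalar_prod_def atLeast0LessThan)
    also have "\<dots> = (if i = j then 1 else 0)" using Y[of i j] ij by (simp add: sumT)
    finally show "(YT * ET) $$ (i, j) = (1\<^sub>m n) $$ (i, j)" using ij by simp
  qed (simp_all add: ET_def YT_def)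
  have "det YT * det ET = 1" using det_mult[of YT n ET] YE by simp
  then have detET: "det ET * det ET = 1"
    using zmult_eq_1_iff[of "det YT" "det ET"] by auto
  let ?h = "map_mat (of_int :: int \<Rightarrow> 'k)"
  have "?h YT * ?h ET = 1\<^sub>m n"
    unfolding of_int_hom.mat_hom_mult[OF carr(2,1), symmetric] YE by (rule of_int_hom.mat_hom_one)
  then have EY: "?h ET * ?h YT = 1\<^sub>m n"
    by (rule mat_mult_left_right_inverse[rotated 2]) simp_all
  have EYe: "(\<Sum>j<n. E r j * of_int (Y j s)) = (if r = s then 1 else 0)" if rs: "r \<in> T" "s \<in> T" for r s
  proof -
    obtain i k where ik: "i < n" "k < n" "r = t i" "s = t k"
      using t rs by (metis bij_betw_def imageE lessThan_iff)
    have "(\<Sum>j<n. E r j * of_int (Y j s)) = (?h ET * ?h YT) $$ (i, k)"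
      using ik by (simp add: ET_def YT_def scalar_prod_def atLeast0LessThan Ez)
    also have "\<dots> = (if i = k then 1 else 0)" using ik unfolding EY by simp
    also have "i = k \<longleftrightarrow> r = s" using t ik by (auto simp: bij_betw_def inj_on_def)
    finally show ?thesis .
  qed
  define A B C Z where "A = mat N N (\<lambda>(r, s). if r = s \<and> r \<notin> T then 1 else 0 :: 'k)"
    and "B = mat N n (\<lambda>(r, j). if r \<in> T then E r j else 0)"
    and "C = mat n N (\<lambda>(i, r). - E r i)"
    and "Z = mat n N (\<lambda>(j, s). if s \<in> T then of_int (Y j s) else 0 :: 'k)"
  have dims [simp]: "A \<in> carrier_mat N N" "B \<in> carrier_mat N n" "C \<in> carrier_mat n N" "Z \<in> carrier_mat n N"
    by (simp_all add: A_def B_def C_def Z_def)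
  have ABZ: "A + B * Z = 1\<^sub>m N"
  proof (rule eq_matI)
    fix r s assume rs: "r < dim_row (1\<^sub>m N :: 'k mat)" "s < dim_col (1\<^sub>m N :: 'k mat)"
    have "(B * Z) $$ (r, s) = (\<Sum>j<n. (if r \<in> T then E r j else 0) * (if s \<in> T then of_int (Y j s) else 0))"
      using rs by (simp add: B_def Z_def scalar_prod_def atLeast0LessThan)
    also have "\<dots> = (if r = s \<and> r \<in> T then 1 else 0)"
      using EYe[of r s] by (cases "r \<in> T"; cases "s \<in> T") auto
    finally show "(A + B * Z) $$ (r, s) = (1\<^sub>m N) $$ (r, s)" using rs by (auto simp: A_def B_def Z_def)
  qed (simp_all add: A_def B_def Z_def)
  note [simp] = right_mult_one_mat[OF dims(1)] right_mult_one_mat[OF dims(2)] right_mult_one_mat[OF dims(3)]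
    right_mult_zero_mat[OF dims(1)] right_mult_zero_mat[OF dims(3)] left_mult_zero_mat[OF dims(4)]
    left_add_zero_mat[OF dims(2)] right_add_zero_mat[OF dims(3)]
  define M0 where "M0 = four_block_mat A B C (0\<^sub>m n n)"
  have M0: "M0 \<in> carrier_mat (N + n) (N + n)" unfolding M0_def by (rule four_block_carrier_mat) auto
  have "Det {} (\<lambda>r. if r \<in> T then Inc r else Unit r) a = det M0"
    unfolding Det_def rdet_def M0_def
    by (rule arg_cong[of _ _ det], rule eq_matI) (auto simp: Rows_def A_def B_def C_def)
  also have "\<dots> = det (M0 * four_block_mat (1\<^sub>m N) (0\<^sub>m N n) Z (1\<^sub>m n))"
    using M0 by (subst det_mult[of _ "N + n"]) (auto simp: det_four_block_mat_upper_right_zero[of _ N _ n])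
  also have "M0 * four_block_mat (1\<^sub>m N) (0\<^sub>m N n) Z (1\<^sub>m n) = four_block_mat (1\<^sub>m N) B C (0\<^sub>m n n)"
    unfolding M0_def by (subst mult_four_block_mat[of _ N N _ n _ n _ _ N _ n]) (simp_all add: ABZ)
  also have "det \<dots> = det (four_block_mat (1\<^sub>m N) B C (0\<^sub>m n n) * four_block_mat (1\<^sub>m N) (- B) (0\<^sub>m n N) (1\<^sub>m n))"
    by (subst det_mult[of _ "N + n"]) (auto simp: det_four_block_mat_lower_left_zero[of _ N _ n])
  also have "four_block_mat (1\<^sub>m N) B C (0\<^sub>m n n) * four_block_mat (1\<^sub>m N) (- B) (0\<^sub>m n N) (1\<^sub>m n)
     = four_block_mat (1\<^sub>m N) (0\<^sub>m N n) C (- (C * B))"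
  proof -
    have nb: "- B + B = 0\<^sub>m N n" by (rule eq_matI) (auto simp: B_def)
    have "C * - B = - (C * B)" by (rule eq_matI) (auto simp: B_def C_def scalar_prod_def sum_negf[symmetric] intro!: sum.cong)
    moreover have "1\<^sub>m N * - B = - B" "B * 0\<^sub>m n N = 0\<^sub>m N N"
      by (auto intro: left_mult_one_mat right_mult_zero_mat simp: B_def)
    moreover have "- (C * B) + 0\<^sub>m n n = - (C * B)" by (rule right_add_zero_mat) (auto simp: B_def C_def)
    ultimately show ?thesis
      by (subst mult_four_block_mat[of _ N N _ n _ n _ _ N _ n]) (simp_all, simp only: nb)
  qed
  also have "det \<dots> = det (- (C * B))"
    by (subst det_four_block_mat_upper_right_zero[of _ N _ n]) (simp_all add: mult_carrier_mat[OF dims(3,2)])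
  also have "- (C * B) = transpose_mat (?h ET) * ?h ET"
  proof (rule eq_matI)
    fix i j assume "i < dim_row (transpose_mat (?h ET) * ?h ET)" "j < dim_col (transpose_mat (?h ET) * ?h ET)"
    then have ij: "i < n" "j < n" by (auto simp: ET_def)
    have "(- (C * B)) $$ (i, j) = (\<Sum>r<N. if r \<in> T then E r i * E r j else 0)"
      using ij by (simp add: B_def C_def scalar_prod_def atLeast0LessThan sum_negf[symmetric] if_distrib cong: if_cong)
    also have "\<dots> = (\<Sum>r\<in>T. E r i * E r j)"
      using T(1) by (subst sum.inter_restrict[symmetric]) (auto simp: Int_absorb1)
    also have "\<dots> = (\<Sum>k<n. E (t k) i * E (t k) j)" by (rule sumT)
    also have "\<dots> = (transpose_mat (?h ET) * ?h ET) $$ (i, j)"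
      using ij by (simp add: ET_def scalar_prod_def atLeast0LessThan Ez)
    finally show "(- (C * B)) $$ (i, j) = (transpose_mat (?h ET) * ?h ET) $$ (i, j)" .
  qed (simp_all add: ET_def B_def C_def)
  also have "det \<dots> = of_int (det ET * det ET)"
    by (subst det_mult[of _ n]) (simp_all add: det_transpose[of _ n])
  also have "\<dots> = 1" unfolding detET by simp
  finally show ?thesis .
qed

end

lemma sum_cyclic_shift:
  fixes f :: "nat \<Rightarrow> 'a::comm_monoid_add"
  assumes "m > 0"
  shows "(\<Sum>i<m. f (Suc i mod m)) = (\<Sum>i<m. f i)"
proof -
  obtain k where m: "m = Suc k" using assms by (cases m) auto
  have "(\<Sum>i<m. f (Suc i mod m)) = (\<Sum>i<k. f (Suc i)) + f 0" unfolding m by simp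
  also have "\<dots> = (\<Sum>i<m. f i)" unfolding m sum.lessThan_Suc_shift by (simp add: add.commute)
  finally show ?thesis .
qed

text \<open>The reduced incidence matrix of an oriented graph, with entries in a finite field. A self-loop has a zero
row. From here on the edges are identified with their positions in \<open>es\<close>.\<close>

locale graph_over_field = fin_digraph G
  for G :: "('v, 'e) pre_digraph" +
  fixes es :: "'e list" and vs :: "'v list" and v0 :: 'v
    and E :: "nat \<Rightarrow> nat \<Rightarrow> 'k::{finite,field}" and N n :: nat and q :: int
  assumes es: "distinct es" "set es = arcs G"
    and vs: "v0 \<in> verts G" "distinct vs" "set vs = verts G - {v0}"
    and N_eq: "N = length es" and n_eq: "n = length vs"
    and E_eq: "E = (\<lambda>r j. of_bool (tail G (es ! r) = vs ! j) - of_bool (head G (es ! r) = vs ! j))"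
    and q_eq: "q = int CARD('k)"

sublocale graph_over_field \<subseteq> incidence E N n q
  by unfold_locales (rule q_eq)

context graph_over_field
begin

abbreviation tl' :: "nat \<Rightarrow> 'v" where "tl' r \<equiv> tail G (es ! r)"
abbreviation hd' :: "nat \<Rightarrow> 'v" where "hd' r \<equiv> head G (es ! r)"

text \<open>Adjacency through the edges at the positions in \<open>T\<close>, regardless of orientation.\<close>

definition adj :: "nat set \<Rightarrow> ('v \<times> 'v) set" where
  "adj T = {(u, v). \<exists>r\<in>T. {tl' r, hd' r} = {u, v}}"

definition spans :: "nat set \<Rightarrow> bool" where
  "spans T \<longleftrightarrow> (\<forall>v\<in>verts G. (v0, v) \<in> (adj T)\<^sup>*)"

lemma es_in_arcs: "r < N \<Longrightarrow> es ! r \<in> arcs G"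
  using es(2) nth_mem[of r es] unfolding N_eq by simp

lemma ends_in_verts: "r < N \<Longrightarrow> tl' r \<in> verts G" "r < N \<Longrightarrow> hd' r \<in> verts G"
  using es_in_arcs by auto

lemma sym_adj: "(u, v) \<in> adj T \<Longrightarrow> (v, u) \<in> adj T"
  by (auto simp: adj_def insert_commute)

lemma adj_verts: "T \<subseteq> {..<N} \<Longrightarrow> (u, v) \<in> adj T \<Longrightarrow> u \<in> verts G \<and> v \<in> verts G"
  using ends_in_verts by (fastforce simp: adj_def doubleton_eq_iff)

lemma sym_adj_star: "(u, v) \<in> (adj T)\<^sup>* \<Longrightarrow> (v, u) \<in> (adj T)\<^sup>*"
  using sym_rtrancl[of "adj T"] sym_adj by (auto simp: sym_def)

lemma connected_iff_spans:
  assumes T: "T \<subseteq> {..<N}"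
  shows "Digraph_Component.connected (G\<lparr>arcs := (!) es ` T\<rparr>) \<longleftrightarrow> spans T"
proof -
  let ?H = "G\<lparr>arcs := (!) es ` T\<rparr>"
  have p: "parcs (mk_symmetric ?H) = adj T"
    by (auto simp: parcs_mk_symmetric adj_def doubleton_eq_iff)
  have r: "u \<rightarrow>\<^sup>*\<^bsub>with_proj (mk_symmetric ?H)\<^esub> v \<longleftrightarrow> (u, v) \<in> (adj T)\<^sup>*"
    if "u \<in> verts G" "v \<in> verts G" for u v
    unfolding reachable_def with_proj_simps p
    using that adj_verts[OF T]
    by (auto intro: rtrancl_on_rtranclI rtrancl_consistent_rtrancl_on)
  have "Digraph_Component.connected ?H \<longleftrightarrow> (\<forall>u\<in>verts G. \<forall>v\<in>verts G. (u, v) \<in> (adj T)\<^sup>*)"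
    unfolding Digraph_Component.connected_def strongly_connected_def using r vs(1) by auto
  also have "\<dots> \<longleftrightarrow> spans T"
    unfolding spans_def using vs(1) by (blast intro: sym_adj_star rtrancl_trans)
  finally show ?thesis .
qed

text \<open>The potential as a function of all vertices, with value zero at the deleted vertex.\<close>

definition pot :: "(nat \<Rightarrow> 'k) \<Rightarrow> 'v \<Rightarrow> 'k" where
  "pot z v = (\<Sum>j<n. of_bool (v = vs ! j) * z j)"

lemma cobd_pot: "cobd r z = pot z (tl' r) - pot z (hd' r)"
  unfolding cobd_def pot_def sum_subtractf[symmetric]
  by (rule sum.cong[OF refl]) (simp add: E_eq left_diff_distrib)

lemma pot_v0: "pot z v0 = 0"
proof -
  have "v0 \<noteq> vs ! j" if "j < n" for j using vs(3) that nth_mem[of j vs] by (auto simp: n_eq)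
  then show ?thesis by (simp add: pot_def)
qed

lemma pot_nth: "j < n \<Longrightarrow> pot z (vs ! j) = z j"
proof -
  assume j: "j < n"
  have "pot z (vs ! j) = (\<Sum>i<n. if i = j then z i else 0)"
    unfolding pot_def using vs(2) j by (intro sum.cong refl) (auto simp: nth_eq_iff_index_eq n_eq)
  then show ?thesis using j by simp
qed

lemma vertex_cases:
  assumes "v \<in> verts G" obtains "v = v0" | j where "j < n" "v = vs ! j"
proof (cases "v = v0")
  case False
  then have "v \<in> set vs" using assms vs(3) by simp
  then show ?thesis using that(2) unfolding in_set_conv_nth n_eq by blast
qed (rule that(1))

text \<open>A potential with zero coboundary on \<open>T\<close> is constant along the edges of \<open>T\<close>.\<close>

lemma spans_imp_potential_0:
  assumes "spans T" "\<forall>r\<in>T. cobd r z = 0" "z \<in> supp {..<n}"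
  shows "z = 0"
proof -
  have 0: "pot z v = 0" if "(v0, v) \<in> (adj T)\<^sup>*" for v
    using that
  proof induction
    case (step u v)
    then obtain r where "r \<in> T" "{tl' r, hd' r} = {u, v}" by (auto simp: adj_def)
    then have "pot z u = pot z v" using assms(2) cobd_pot[of r z] by (auto simp: doubleton_eq_iff)
    then show ?case using step by simp
  qed (rule pot_v0)
  have "z j = 0" if "j < n" for j
  proof -
    have "vs ! j \<in> set vs" using that unfolding n_eq by (rule nth_mem)
    then have "(v0, vs ! j) \<in> (adj T)\<^sup>*" using assms(1) vs(3) by (simp add: spans_def)
    from 0[OF this] show ?thesis using pot_nth[OF that] by simp
  qed
  then have "z j = 0" for j using assms(3) by (cases "j < n") (simp_all add: supp_def)
  then show ?thesis by (intro ext) simp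
qed

text \<open>The indicator of the vertices that cannot be reached from \<open>v0\<close>.\<close>

lemma not_spans_potential:
  assumes "\<not> spans T" "T \<subseteq> {..<N}"
  shows "\<exists>z\<in>supp {..<n}. z \<noteq> 0 \<and> (\<forall>r\<in>T. cobd r z = 0)"
proof -
  define z :: "nat \<Rightarrow> 'k" where "z = (\<lambda>j. if j < n \<and> (v0, vs ! j) \<notin> (adj T)\<^sup>* then 1 else 0)"
  have pz: "pot z v = (if (v0, v) \<in> (adj T)\<^sup>* then 0 else 1)" if "v \<in> verts G" for v
    using that
  proof (cases rule: vertex_cases)
    case 1
    then show ?thesis by (simp add: pot_v0)
  next
    case (2 j)
    then show ?thesis by (simp add: pot_nth) (simp add: z_def)
  qed
  have "cobd r z = 0" if "r \<in> T" for r
  proof -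
    have "r < N" using that assms(2) by auto
    have "(tl' r, hd' r) \<in> adj T" "(hd' r, tl' r) \<in> adj T" using that by (auto simp: adj_def)
    then have "(v0, tl' r) \<in> (adj T)\<^sup>* \<longleftrightarrow> (v0, hd' r) \<in> (adj T)\<^sup>*"
      by (meson rtrancl.rtrancl_into_rtrancl)
    then show ?thesis using pz ends_in_verts[OF \<open>r < N\<close>] by (simp add: cobd_pot)
  qed
  moreover have "z \<noteq> 0"
  proof
    assume "z = 0"
    obtain v where v: "v \<in> verts G" "(v0, v) \<notin> (adj T)\<^sup>*" using assms(1) by (auto simp: spans_def)
    have "pot z v = 0" unfolding \<open>z = 0\<close> pot_def by simp
    then show False using pz[OF v(1)] v(2) by simp
  qed
  moreover have "z \<in> supp {..<n}" by (simp add: supp_def z_def)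
  ultimately show ?thesis by blast
qed

text \<open>The signed sum of the edges of a path from \<open>v0\<close> to \<open>v\<close> has boundary \<open>v - v0\<close>. These chains form the integer
inverse of the incidence matrix of a tree.\<close>

lemma path_chain:
  assumes T: "T \<subseteq> {..<N}" and spans: "spans T" and v: "v \<in> verts G"
  shows "\<exists>y :: nat \<Rightarrow> int. \<forall>w. (\<Sum>r\<in>T. y r * (of_bool (tl' r = w) - of_bool (hd' r = w))) = of_bool (v = w) - of_bool (v0 = w)"
proof -
  have fin: "finite T" using T by (rule finite_subset) simp
  have "(v0, v) \<in> (adj T)\<^sup>*" using spans v by (simp add: spans_def)
  then show ?thesis
  proof induction
    case base
    show ?case by (rule exI[of _ "\<lambda>_. 0"]) simp
  next
    case (step u v)
    then obtain y :: "nat \<Rightarrow> int" where y: "\<And>w. (\<Sum>r\<in>T. y r * (of_bool (tl' r = w) - of_bool (hd' r = w))) = of_bool (u = w) - of_bool (v0 = w)"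
      by auto
    obtain r where r: "r \<in> T" "{tl' r, hd' r} = {u, v}" using step by (auto simp: adj_def)
    \<comment> \<open>the orientation of \<open>r\<close> relative to the path\<close>
  define c :: int where "c = (if tl' r = v \<and> hd' r = u then 1 else - 1)"
    have c: "c * (of_bool (tl' r = w) - of_bool (hd' r = w)) = of_bool (v = w) - of_bool (u = w)" for w
      using r(2) by (auto simp: c_def doubleton_eq_iff)
    have "(\<Sum>s\<in>T. (y s + c * of_bool (s = r)) * (of_bool (tl' s = w) - of_bool (hd' s = w))) = of_bool (v = w) - of_bool (v0 = w)" for w
    proof -
      have "(\<Sum>s\<in>T. (y s + c * of_bool (s = r)) * (of_bool (tl' s = w) - of_bool (hd' s = w)))
        = (\<Sum>s\<in>T. y s * (of_bool (tl' s = w) - of_bool (hd' s = w))) + (\<Sum>s\<in>T. if s = r then c * (of_bool (tl' r = w) - of_bool (hd' r = w)) else 0)"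
        unfolding sum.distrib[symmetric] by (intro sum.cong refl) (auto simp: distrib_right)
      also have "\<dots> = of_bool (v = w) - of_bool (v0 = w)" using fin r(1) by (simp add: y c del: of_bool_eq_iff)
      finally show ?thesis .
    qed
    then show ?case by (intro exI[of _ "\<lambda>s. y s + c * of_bool (s = r)"] allI)
  qed
qed

lemma simple_path:
  assumes "(u, v) \<in> (adj T)\<^sup>*"
  shows "\<exists>ws fs'. ws \<noteq> [] \<and> hd ws = u \<and> last ws = v \<and> distinct ws \<and> length ws = Suc (length fs') \<and>
     (\<forall>i<length fs'. fs' ! i \<in> T \<and> {tl' (fs' ! i), hd' (fs' ! i)} = {ws ! i, ws ! Suc i})"
  using assms
proof (induction rule: converse_rtrancl_induct)
  case base
  show ?case by (intro exI[of _ "[v]"] exI[of _ "[]"]) simp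
next
  case (step u w)
  then obtain ws fs' where p: "ws \<noteq> []" "hd ws = w" "last ws = v" "distinct ws" "length ws = Suc (length fs')"
     "\<forall>i<length fs'. fs' ! i \<in> T \<and> {tl' (fs' ! i), hd' (fs' ! i)} = {ws ! i, ws ! Suc i}" by blast
  obtain r where r: "r \<in> T" "{tl' r, hd' r} = {u, w}" using step by (auto simp: adj_def)
  show ?case
  proof (cases "u \<in> set ws")
    case True
    then obtain k where k: "k < length ws" "ws ! k = u" by (auto simp: in_set_conv_nth)
    show ?thesis
      by (rule exI[of _ "drop k ws"], rule exI[of _ "drop k fs'"]) (use k p in \<open>auto simp: hd_drop_conv_nth\<close>)
  next
    case False
    have "ws ! 0 = w" using p by (simp add: hd_conv_nth)
    then have "(r # fs') ! i \<in> T \<and>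
        {tl' ((r # fs') ! i), hd' ((r # fs') ! i)} = {(u # ws) ! i, (u # ws) ! Suc i}" if "i < length (r # fs')" for i
      using p(6) r that by (cases i) simp_all
    then show ?thesis using p False by (intro exI[of _ "u # ws"] exI[of _ "r # fs'"]) simp
  qed
qed

definition acyclic :: "nat set \<Rightarrow> bool" where
  "acyclic T \<longleftrightarrow> \<not> (\<exists>ws fs'. undirected_cycle (G\<lparr>arcs := (!) es ` T\<rparr>) ws fs')"

lemma cycle_through:
  assumes T: "T \<subseteq> {..<N}" and r: "r \<in> T" and conn: "(hd' r, tl' r) \<in> (adj (T - {r}))\<^sup>*"
  shows "\<not> acyclic T"
proof -
  obtain ws ps where p: "ws \<noteq> []" "hd ws = hd' r" "last ws = tl' r" "distinct ws" "length ws = Suc (length ps)"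
     "\<forall>i<length ps. ps ! i \<in> T - {r} \<and> {tl' (ps ! i), hd' (ps ! i)} = {ws ! i, ws ! Suc i}"
    using simple_path[OF conn] by blast
  have "set ps \<subseteq> T - {r}"
  proof
    fix x assume "x \<in> set ps"
    then obtain i where "i < length ps" "ps ! i = x" unfolding in_set_conv_nth by blast
    then show "x \<in> T - {r}" using p(6) by blast
  qed
  have "distinct ps"
  proof (rule ccontr)
    assume "\<not> distinct ps"
    then obtain i j where ij: "i < length ps" "j < length ps" "i \<noteq> j" "ps ! i = ps ! j"
      unfolding distinct_conv_nth by blast
    have "{tl' (ps ! i), hd' (ps ! i)} = {ws ! i, ws ! Suc i}" "{tl' (ps ! j), hd' (ps ! j)} = {ws ! j, ws ! Suc j}"
      using p(6) ij(1,2) by blast+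
    then have "{ws ! i, ws ! Suc i} = {ws ! j, ws ! Suc j}" using ij(4) by simp
    then have "ws ! i = ws ! j \<or> ws ! i = ws ! Suc j \<and> ws ! Suc i = ws ! j" unfolding doubleton_eq_iff by blast
    then show False using p(4,5) ij(1-3) by (auto simp: nth_eq_iff_index_eq)
  qed
  have inj: "inj_on ((!) es) {..<N}" using es(1) by (auto simp: inj_on_def N_eq nth_eq_iff_index_eq)
  let ?fs = "map ((!) es) (ps @ [r])"
  have "set (ps @ [r]) \<subseteq> {..<N}" "distinct (ps @ [r])"
    using \<open>distinct ps\<close> \<open>set ps \<subseteq> T - {r}\<close> r T by auto
  then have "distinct ?fs" unfolding distinct_map using inj_on_subset[OF inj] by blast
  moreover have "{tail G (?fs ! i), head G (?fs ! i)} = {ws ! i, ws ! (Suc i mod length ?fs)}" if "i < length ?fs" for i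
  proof (cases "i < length ps")
    case True
    then show ?thesis using p(6) by (simp add: nth_append)
  next
    case False
    then have i: "i = length ps" using that by simp
    have "?fs ! i = es ! r" "Suc i mod length ?fs = 0" by (simp_all add: i nth_append)
    moreover have "ws ! i = tl' r" using p(1,3,5) i by (simp add: last_conv_nth)
    moreover have "ws ! 0 = hd' r" using p(1,2) by (simp add: hd_conv_nth)
    ultimately show ?thesis by simp
  qed
  ultimately have "undirected_cycle (G\<lparr>arcs := (!) es ` T\<rparr>) ws ?fs"
    unfolding undirected_cycle_def using p(4,5) \<open>set ps \<subseteq> T - {r}\<close> r
    by (intro conjI allI impI) (simp_all del: map_append, blast)
  then show ?thesis unfolding acyclic_def by blast
qed

text \<open>The signed edges of a closed walk form an element of the cycle space. It is nonzero since the edges of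
the cycle are distinct.\<close>

lemma cycle_vector:
  assumes T: "T \<subseteq> {..<N}" and "\<not> acyclic T"
  shows "\<exists>y\<in>supp T. y \<noteq> 0 \<and> (\<forall>i<n. (\<Sum>r<N. E r i * y r) = 0)"
proof -
  obtain ws ls where cyc: "undirected_cycle (G\<lparr>arcs := (!) es ` T\<rparr>) ws ls"
    using assms(2) by (auto simp: acyclic_def)
  define m where "m = length ls"
  have m: "m > 0" "length ws = m" "distinct ls" "set ls \<subseteq> (!) es ` T"
    "\<And>i. i < m \<Longrightarrow> {tail G (ls ! i), head G (ls ! i)} = {ws ! i, ws ! (Suc i mod m)}"
    using cyc by (auto simp: undirected_cycle_def m_def)
  have "\<forall>i\<in>{..<m}. \<exists>r. r \<in> T \<and> es ! r = ls ! i"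
  proof
    fix i assume "i \<in> {..<m}"
    then have "ls ! i \<in> (!) es ` T" using m(4) nth_mem[of i ls] by (auto simp: m_def)
    then show "\<exists>r. r \<in> T \<and> es ! r = ls ! i" by (metis imageE)
  qed
  then obtain p where p: "\<And>i. i < m \<Longrightarrow> p i \<in> T \<and> es ! p i = ls ! i"
    by (metis lessThan_iff)
  define c :: "nat \<Rightarrow> 'k" where "c = (\<lambda>i. if tail G (ls ! i) = ws ! i \<and> head G (ls ! i) = ws ! (Suc i mod m) then 1 else - 1)"
  define y where "y = (\<lambda>r. \<Sum>i<m. c i * of_bool (p i = r))"
  have c: "c i * (of_bool (tail G (ls ! i) = w) - of_bool (head G (ls ! i) = w)) = of_bool (ws ! i = w) - of_bool (ws ! (Suc i mod m) = w)"
    if "i < m" for i w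
  proof (cases "tail G (ls ! i) = ws ! i \<and> head G (ls ! i) = ws ! (Suc i mod m)")
    case True
    then have "c i = 1" by (simp add: c_def)
    then show ?thesis using True by simp
  next
    case False
    then have "tail G (ls ! i) = ws ! (Suc i mod m)" "head G (ls ! i) = ws ! i"
      using m(5)[OF that] unfolding doubleton_eq_iff by blast+
    moreover have "c i = - 1" using False unfolding c_def by (rule if_not_P)
    ultimately show ?thesis by simp
  qed
  have "(\<Sum>r<N. E r j * y r) = 0" for j
  proof -
    have "(\<Sum>r<N. E r j * y r) = (\<Sum>i<m. \<Sum>r<N. E r j * (c i * of_bool (p i = r)))"
      unfolding y_def sum_distrib_left by (rule sum.swap)
    also have "\<dots> = (\<Sum>i<m. of_bool (ws ! i = vs ! j) - of_bool (ws ! (Suc i mod m) = vs ! j))"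
    proof (intro sum.cong refl)
      fix i assume "i \<in> {..<m}"
      then have i: "i < m" by simp
      have "p i < N" using p[OF i] T by auto
      have "(\<Sum>r<N. E r j * (c i * of_bool (p i = r))) = (\<Sum>r<N. if r = p i then E (p i) j * c i else 0)"
        by (intro sum.cong refl) auto
      also have "\<dots> = c i * E (p i) j" using \<open>p i < N\<close> by simp
      also have "\<dots> = of_bool (ws ! i = vs ! j) - of_bool (ws ! (Suc i mod m) = vs ! j)"
        unfolding E_eq using p[OF i] c[OF i, of "vs ! j"] by simp
      finally show "(\<Sum>r<N. E r j * (c i * of_bool (p i = r))) = of_bool (ws ! i = vs ! j) - of_bool (ws ! (Suc i mod m) = vs ! j)" .
    qed
    also have "\<dots> = 0"
      using sum_cyclic_shift[OF m(1), of "\<lambda>i. of_bool (ws ! i = vs ! j) :: 'k"] by (simp only: sum_subtractf diff_self)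
    finally show ?thesis .
  qed
  moreover have "y \<in> supp T"
    unfolding supp_def y_def using p by (auto intro!: sum.neutral)
  moreover have "y \<noteq> 0"
  proof
    assume "y = 0"
    have "p i = p 0 \<longleftrightarrow> i = 0" if "i < m" for i
    proof
      assume "p i = p 0"
      then have "ls ! i = ls ! 0" using p[OF that] p[OF m(1)] by simp
      then show "i = 0" using m(1,3) that by (simp add: nth_eq_iff_index_eq m_def)
    qed simp
    then have "y (p 0) = (\<Sum>i<m. if i = 0 then c 0 else 0)"
      unfolding y_def by (intro sum.cong refl) auto
    also have "\<dots> = c 0" using m(1) by simp
    finally show False using \<open>y = 0\<close> by (simp add: c_def split: if_splits)
  qed
  ultimately show ?thesis by blast
qed

text \<open>The columns of the incidence matrix of a connected graph are independent, so there are at least \<open>n\<close> edges. With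
more edges there is a nonzero element of the cycle space. An edge in its support can be removed without losing
connectedness, because the coboundary of a potential at this edge is determined by the other edges; hence it lies on
a cycle.\<close>

lemma card_tree:
  assumes T: "T \<subseteq> {..<N}" and spans: "spans T" and acyc: "acyclic T"
  shows "card T = n"
proof (rule antisym)
  have fin: "finite T" using T by (rule finite_subset) simp
  have q2: "1 < CARD('k) ^ d" if "d > 0" for d
  proof -
    have "card {0::'k, 1} \<le> CARD('k)" by (rule card_mono) auto
    then show ?thesis using that by (intro one_less_power) simp_all
  qed
  show "n \<le> card T"
  proof -
    have "\<exists>d. card {z \<in> supp {..<n}. \<forall>r\<in>T. cobd r z = 0} = CARD('k) ^ d \<and> n \<le> d + card T"
      by (rule card_solutions_ge[where sc = smul]) (use fin in \<open>auto simp: card_supp supp_closed\<close>)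
    moreover have "{z \<in> supp {..<n}. \<forall>r\<in>T. cobd r z = 0} = {0}"
      using spans_imp_potential_0[OF spans] by (auto simp: supp_closed)
    ultimately obtain d where "1 = CARD('k) ^ d" "n \<le> d + card T" by auto
    then show ?thesis using q2[of d] by (cases "d = 0") simp_all
  qed
  show "card T \<le> n"
  proof (rule ccontr)
    assume "\<not> card T \<le> n"
    let ?S = "{y \<in> supp T. \<forall>i\<in>{..<n}. (\<Sum>r<N. E r i * y r) = 0}"
    have "\<exists>d. card ?S = CARD('k) ^ d \<and> card T \<le> d + card {..<n}"
      by (rule card_solutions_ge[where sc = smul])
        (use fin in \<open>auto simp: card_supp supp_closed algebra_simps sum.distrib sum_distrib_left\<close>)
    then obtain d where "card ?S = CARD('k) ^ d" "d > 0" using \<open>\<not> card T \<le> n\<close> by auto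
    then have "card ?S \<noteq> 1" using q2[of d] by (metis less_irrefl)
    define S where "S = ?S"
    have "S \<noteq> {0}" using \<open>card ?S \<noteq> 1\<close> unfolding S_def[symmetric] by auto
    moreover have "0 \<in> S" by (simp add: supp_closed S_def)
    ultimately obtain y where "y \<in> S" "y \<noteq> 0" by blast
    then have y: "y \<in> ?S" "y \<noteq> 0" by (simp_all add: S_def)
    obtain r where r: "y r \<noteq> 0" using y(2) by (auto simp: fun_eq_iff)
    then have rT: "r \<in> T" using y by (auto simp: supp_def)
    have "spans (T - {r})"
    proof (rule ccontr)
      assume "\<not> spans (T - {r})"
      moreover have "T - {r} \<subseteq> {..<N}" using T by blast
      ultimately obtain z where z: "z \<in> supp {..<n}" "z \<noteq> 0" "\<forall>s\<in>T - {r}. cobd s z = 0"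
        using not_spans_potential[of "T - {r}"] by blast
      have "supp T \<subseteq> (supp ({..<N} - {}) :: (nat \<Rightarrow> 'k) set)" using T unfolding supp_def by blast
      then have yc: "y \<in> cycles {}" using y(1) by (simp add: cycles_def subset_iff)
      have "0 = (\<Sum>s<N. y s * cobd s z)" using cycle_cut_orthogonal[OF yc] by simp
      also have "\<dots> = (\<Sum>s\<in>{r}. y s * cobd s z)"
      proof (rule sum.mono_neutral_right)
        show "\<forall>s\<in>{..<N} - {r}. y s * cobd s z = 0"
        proof
          fix s assume "s \<in> {..<N} - {r}"
          then show "y s * cobd s z = 0" using z(3) y(1) by (cases "s \<in> T") (simp_all add: supp_def)
        qed
      qed (use rT T in auto)
      finally have "cobd r z = 0" using r by simp
      then have "\<forall>s\<in>T. cobd s z = 0" using z(3) by auto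
      then show False using spans_imp_potential_0[OF spans _ z(1)] z(2) by blast
    qed
    then have "(hd' r, tl' r) \<in> (adj (T - {r}))\<^sup>*"
      using ends_in_verts[of r] rT T unfolding spans_def
      by (meson lessThan_iff rtrancl_trans subsetD sym_adj_star)
    then show False using cycle_through[OF T rT] acyc by blast
  qed
qed

text \<open>The coefficients of the determinant. A potential, an element of the cycle space, or unimodularity settle
the disconnected case, the case of a cycle, and the case of a tree.\<close>

lemma Det_tree:
  assumes T: "T \<subseteq> {..<N}"
  shows "Det {} (\<lambda>r. if r \<in> T then Inc r else Unit r) a = of_bool (spans T \<and> acyclic T)"
proof -
  let ?c = "\<lambda>r. if r \<in> T then Inc r else Unit r"
  have im: "?c ` ({..<N} - {}) = Unit ` ({..<N} - T) \<union> Inc ` T"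
    using T by (auto simp: image_iff)
  have "units (Inc ` T) = {}" "incs (Inc ` T) = T" by (auto simp: units_def incs_def)
  then have u: "units (?c ` ({..<N} - {})) = {..<N} - T" "incs (?c ` ({..<N} - {})) = T"
    unfolding im by auto
  have 0: "Det {} ?c a = 0 \<longleftrightarrow> singular {} ({..<N} - T) T a"
    using Det_eq_0_iff[of "{}" ?c a] unfolding u by auto
  consider "\<not> spans T" | "\<not> acyclic T" | "spans T" "acyclic T" by blast
  then show ?thesis
  proof cases
    case 1
    then obtain z where "z \<in> supp {..<n}" "z \<noteq> 0" "\<forall>r\<in>T. cobd r z = 0" using not_spans_potential T by blast
    then have "(0, z) \<in> Ker {} ({..<N} - T) T a" by (simp add: Ker_def solves_def cycles_closed)
    then have "singular {} ({..<N} - T) T a" unfolding singular_def using \<open>z \<noteq> 0\<close> by blast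
    then show ?thesis using 0 1 by simp
  next
    case 2
    then obtain y where y: "y \<in> supp T" "y \<noteq> 0" "\<forall>i<n. (\<Sum>r<N. E r i * y r) = 0" using cycle_vector[OF T] by blast
    have "{..<N} - ({..<N} - T) = T" using T by auto
    then have "(y, 0) \<in> Ker {} ({..<N} - T) T a" using y by (simp add: Ker_def solves_def cycles_def supp_closed)
    then have "singular {} ({..<N} - T) T a" unfolding singular_def using y(2) by blast
    then show ?thesis using 0 2 by simp
  next
    case 3
    define Ez :: "nat \<Rightarrow> nat \<Rightarrow> int" where
      "Ez = (\<lambda>r j. of_bool (tl' r = vs ! j) - of_bool (hd' r = vs ! j))"
    have "\<exists>y :: nat \<Rightarrow> int. \<forall>j<n. (\<Sum>r\<in>T. y r * Ez r j) = (if i = j then 1 else 0)" if "i < n" for i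
    proof -
      have "vs ! i \<in> verts G" using vs(3) nth_mem[of i vs] that by (auto simp: n_eq)
      from path_chain[OF T 3(1) this] obtain y :: "nat \<Rightarrow> int" where
        y: "\<And>w. (\<Sum>r\<in>T. y r * (of_bool (tl' r = w) - of_bool (hd' r = w))) = of_bool (vs ! i = w) - of_bool (v0 = w)"
        by blast
      have "(\<Sum>r\<in>T. y r * Ez r j) = (if i = j then 1 else 0)" if j: "j < n" for j
      proof -
        have "v0 \<noteq> vs ! j" using vs(3) nth_mem[of j vs] j by (auto simp: n_eq)
        moreover have "vs ! i = vs ! j \<longleftrightarrow> i = j" using vs(2) j \<open>i < n\<close> by (simp add: nth_eq_iff_index_eq n_eq)
        ultimately show ?thesis unfolding Ez_def y by simp
      qed
      then show ?thesis by blast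
    qed
    then obtain Y :: "nat \<Rightarrow> nat \<Rightarrow> int" where Y: "\<And>i j. i < n \<Longrightarrow> j < n \<Longrightarrow> (\<Sum>r\<in>T. Y i r * Ez r j) = (if i = j then 1 else 0)"
      by metis
    have "Det {} ?c a = 1"
      by (rule Det_unimodular[OF T card_tree[OF T 3] _ Y]) (simp_all add: E_eq Ez_def)
    then show ?thesis using 3 by simp
  qed
qed

lemma undirected_spanning_tree_iff:
  assumes "T \<subseteq> {..<N}"
  shows "undirected_spanning_tree G ((!) es ` T) \<longleftrightarrow> spans T \<and> acyclic T"
  unfolding undirected_spanning_tree_def connected_iff_spans[OF assms] acyclic_def
  using assms es_in_arcs by auto

theorem matrix_tree:
  "Det {..<N} c a = (\<Sum>T | undirected_spanning_tree G T. \<Prod>r | r < N \<and> es ! r \<notin> T. a r)"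
proof -
  have inj: "inj_on ((!) es) {..<N}" using es(1) by (auto simp: inj_on_def N_eq nth_eq_iff_index_eq)
  have arcs: "arcs G = (!) es ` {..<N}" using es(2) by (auto simp: N_eq set_conv_nth)
  let ?tree = "\<lambda>S. undirected_spanning_tree G ((!) es ` ({..<N} - S))"
  have "Det {..<N} c a = (\<Sum>S\<in>Pow {..<N}. (\<Prod>r\<in>S. a r) * of_bool (?tree S))"
  proof (subst Det_expand; (intro sum.cong refl)?)
    fix S assume S: "S \<in> Pow {..<N}"
    have "Det {} (\<lambda>r. if r \<in> S then Unit r else if r \<in> {..<N} then Inc r else c r) a
      = Det {} (\<lambda>r. if r \<in> {..<N} - S then Inc r else Unit r) a"
      by (rule Det_cong) (use S in auto)
    also have "\<dots> = of_bool (?tree S)" by (simp only: Det_tree Diff_subset undirected_spanning_tree_iff)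
    finally show "(\<Prod>r\<in>S. a r) * Det {} (\<lambda>r. if r \<in> S then Unit r else if r \<in> {..<N} then Inc r else c r) a
      = (\<Prod>r\<in>S. a r) * of_bool (?tree S)" by simp
  qed auto
  also have "\<dots> = (\<Sum>S\<in>{S \<in> Pow {..<N}. ?tree S}. \<Prod>r\<in>S. a r)"
    by (simp add: Int_def)
  also have "\<dots> = (\<Sum>T | undirected_spanning_tree G T. \<Prod>r | r < N \<and> es ! r \<notin> T. a r)"
  proof (rule sum.reindex_bij_witness[where i = "\<lambda>T. {r. r < N \<and> es ! r \<notin> T}" and j = "\<lambda>S. (!) es ` ({..<N} - S)"])
    fix S assume S: "S \<in> {S \<in> Pow {..<N}. ?tree S}"
    then show e: "{r. r < N \<and> es ! r \<notin> (!) es ` ({..<N} - S)} = S"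
      using inj by (auto simp: inj_on_def)
    show "(!) es ` ({..<N} - S) \<in> Collect (undirected_spanning_tree G)" using S by simp
    show "prod a {r. r < N \<and> es ! r \<notin> (!) es ` ({..<N} - S)} = prod a S" unfolding e ..
  next
    fix T assume T: "T \<in> Collect (undirected_spanning_tree G)"
    then have "T \<subseteq> arcs G" by (simp add: undirected_spanning_tree_def)
    then show e: "(!) es ` ({..<N} - {r. r < N \<and> es ! r \<notin> T}) = T"
      unfolding arcs by auto
    show "{r. r < N \<and> es ! r \<notin> T} \<in> {S \<in> Pow {..<N}. ?tree S}" using T e by auto
  qed
  finally show ?thesis .
qed

text \<open>A connected graph has the single component \<open>verts G\<close>, and the number of loops is \<open>N - n\<close>.\<close>

lemma edges_eq_twice_rank:
  assumes "primitive_divergent G"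
  shows "N = 2 * n"
proof -
  have conn: "Digraph_Component.connected G" and e: "int (card (arcs G)) = 2 * loop_number G"
    using assms by (auto simp: primitive_divergent_def)
  let ?H = "with_proj (mk_symmetric G)"
  have reach: "u \<rightarrow>\<^sup>*\<^bsub>?H\<^esub> v" if "u \<in> verts G" "v \<in> verts G" for u v
    using conn that by (auto simp: Digraph_Component.connected_def strongly_connected_def)
  have in_verts: "u \<in> verts G \<and> v \<in> verts G" if "u \<rightarrow>\<^sup>*\<^bsub>?H\<^esub> v" for u v
    using in_rtrancl_on_in_F that by (fastforce simp: reachable_def)
  have "components G = {verts G}"
    unfolding components_def pre_digraph.sccs_verts_def using reach in_verts vs(1) by blast
  then have "loop_number G = int N - int (card (verts G)) + 1"
    using es distinct_card[of es] by (simp add: loop_number_def N_eq)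
  moreover have "card (verts G) = Suc n"
    using vs distinct_card[of vs] card_Suc_Diff1[of "verts G" v0] by (simp add: n_eq)
  moreover have "card (arcs G) = N" using es distinct_card[of es] by (simp add: N_eq)
  ultimately show ?thesis using e by simp
qed

end

section \<open>Evaluation of integer polynomials\<close>

definition eval_monom :: "('e \<Rightarrow> 'k::comm_ring_1) \<Rightarrow> ('e \<Rightarrow>\<^sub>0 nat) \<Rightarrow> 'k" where
  "eval_monom a m = (\<Prod>e\<in>Poly_Mapping.keys m. a e ^ Poly_Mapping.lookup m e)"

lemma eval_monom_superset:
  "finite S \<Longrightarrow> Poly_Mapping.keys m \<subseteq> S \<Longrightarrow> eval_monom a m = (\<Prod>e\<in>S. a e ^ Poly_Mapping.lookup m e)"
  unfolding eval_monom_def by (rule prod.mono_neutral_left) (auto simp: in_keys_iff)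

lemma eval_monom_0 [simp]: "eval_monom a 0 = 1"
  by (simp add: eval_monom_def)

lemma eval_monom_add: "eval_monom a (m + m') = eval_monom a m * eval_monom a m'"
proof -
  let ?S = "Poly_Mapping.keys m \<union> Poly_Mapping.keys m'"
  have "Poly_Mapping.keys (m + m') \<subseteq> ?S" by (rule keys_add)
  then have "eval_monom a (m + m') = (\<Prod>e\<in>?S. a e ^ Poly_Mapping.lookup (m + m') e)"
    by (intro eval_monom_superset) auto
  also have "\<dots> = (\<Prod>e\<in>?S. a e ^ Poly_Mapping.lookup m e) * (\<Prod>e\<in>?S. a e ^ Poly_Mapping.lookup m' e)"
    by (simp add: lookup_add power_add prod.distrib)
  also have "\<dots> = eval_monom a m * eval_monom a m'"
    by (subst (1 2) eval_monom_superset[of ?S]) auto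
  finally show ?thesis .
qed

lemma eval_ipoly_superset:
  "finite S \<Longrightarrow> Poly_Mapping.keys P \<subseteq> S \<Longrightarrow>
    eval_ipoly a P = (\<Sum>m\<in>S. of_int (Poly_Mapping.lookup P m) * eval_monom a m)"
  unfolding eval_ipoly_def eval_monom_def by (rule sum.mono_neutral_left) (auto simp: in_keys_iff)

lemma eval_ipoly_add: "eval_ipoly a (P + Q) = eval_ipoly a P + eval_ipoly a Q"
proof -
  let ?S = "Poly_Mapping.keys P \<union> Poly_Mapping.keys Q"
  have "Poly_Mapping.keys (P + Q) \<subseteq> ?S" by (rule keys_add)
  then have "eval_ipoly a (P + Q) = (\<Sum>m\<in>?S. of_int (Poly_Mapping.lookup (P + Q) m) * eval_monom a m)"
    by (intro eval_ipoly_superset) auto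
  also have "\<dots> = (\<Sum>m\<in>?S. of_int (Poly_Mapping.lookup P m) * eval_monom a m) + (\<Sum>m\<in>?S. of_int (Poly_Mapping.lookup Q m) * eval_monom a m)"
    by (simp add: lookup_add distrib_right sum.distrib)
  also have "\<dots> = eval_ipoly a P + eval_ipoly a Q"
    by (subst (1 2) eval_ipoly_superset[of ?S]) auto
  finally show ?thesis .
qed

lemma eval_ipoly_single: "eval_ipoly a (Poly_Mapping.single m c) = of_int c * eval_monom a m"
  by (subst eval_ipoly_superset[of "{m}"]) (auto simp: lookup_single)

text \<open>Additivity reduces multiplicativity of the evaluation to monomials.\<close>

lemma ipoly_induct [case_names zero add_single]:
  fixes P :: "'e ipoly"
  assumes "R 0" and "\<And>m c P. R P \<Longrightarrow> R (Poly_Mapping.single m c + P)"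
  shows "R P"
proof (induction P rule: update_induct)
  case const
  show ?case by (rule assms(1))
next
  case (update f m c)
  have "Poly_Mapping.update m c f = Poly_Mapping.single m c + f"
    using update by (intro poly_mapping_eqI) (auto simp: lookup_update lookup_add lookup_single in_keys_iff when_def)
  then show ?case using assms(2) update by simp
qed

lemma eval_ipoly_mult: "eval_ipoly a (P * Q) = eval_ipoly a P * eval_ipoly a Q"
proof (induction P rule: ipoly_induct)
  case zero
  show ?case by (simp add: eval_ipoly_def)
next
  case (add_single m c P)
  have "eval_ipoly a (Poly_Mapping.single m c * Q) = eval_ipoly a (Poly_Mapping.single m c) * eval_ipoly a Q"
  proof (induction Q rule: ipoly_induct)
    case zero
    show ?case by (simp add: eval_ipoly_def)
  next
    case (add_single m' c' Q)
    then show ?case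
      by (simp add: distrib_left eval_ipoly_add mult_single eval_ipoly_single eval_monom_add)
  qed
  then show ?case using add_single by (simp add: distrib_right eval_ipoly_add)
qed

lemma eval_ipoly_hom: "comm_ring_hom (eval_ipoly a)"
proof
  show "eval_ipoly a 1 = 1"
    using eval_ipoly_single[of a 0 1] by simp
qed (simp_all add: eval_ipoly_add eval_ipoly_mult, simp add: eval_ipoly_def)

lemma eval_ipoly_var: "eval_ipoly a (var e) = a e"
  unfolding var_def eval_ipoly_single eval_monom_def by simp

section \<open>Minors\<close>

lemma pick_eqI:
  assumes "infinite S" "x \<in> S" "card {a \<in> S. a < x} = n"
  shows "pick S n = x"
  using pick_card_in_set[OF assms(2)] assms(3) by simp

text \<open>Deleting the rows in \<open>I\<close> and then the row that was \<open>m\<close> is the same as deleting the rows in \<open>insert m I\<close>.\<close>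

lemma pick_insert_compl:
  assumes I: "finite I" "m \<notin> I"
  defines "p \<equiv> card {a \<in> - I. a < m}"
  shows "pick (- I) (if i < p then i else Suc i) = pick (- insert m I) i"
proof -
  let ?k = "if i < p then i else Suc i"
  have inf: "infinite (- I)" "infinite (- insert m I)" using I(1) by (simp_all add: finite_compl)
  define x where "x = pick (- I) ?k"
  have x: "x \<in> - I" "card {a \<in> - I. a < x} = ?k"
    unfolding x_def using pick_in_set[of ?k "- I"] card_pick[of ?k "- I"] inf(1) by blast+
  have mono: "card {a \<in> - I. a < u} \<le> card {a \<in> - I. a < v}" if "u \<le> v" for u v
    by (rule card_mono) (use that in auto)
  have "x < m \<longleftrightarrow> i < p"
  proof
    assume "x < m"
    then have "{a \<in> - I. a < x} \<subset> {a \<in> - I. a < m}" using x(1) by auto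
    then have "card {a \<in> - I. a < x} < p" unfolding p_def by (rule psubset_card_mono[rotated]) simp
    then show "i < p" unfolding x(2) by (cases "i < p") simp_all
  next
    assume "i < p"
    then have "card {a \<in> - I. a < x} < p" using x(2) by simp
    then show "x < m" using mono[of m x] unfolding p_def by linarith
  qed
  moreover have "x \<noteq> m"
  proof
    assume "x = m"
    then have "?k = p" using x(2) unfolding p_def by simp
    then show False by (auto split: if_splits)
  qed
  ultimately have "card {a \<in> - insert m I. a < x} = i"
  proof (cases "i < p")
    case True
    then have "{a \<in> - insert m I. a < x} = {a \<in> - I. a < x}" using \<open>x < m \<longleftrightarrow> i < p\<close> by auto
    then show ?thesis using x(2) True by simp
  next
    case False
    then have "m < x" using \<open>x < m \<longleftrightarrow> i < p\<close> \<open>x \<noteq> m\<close> by auto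
    then have "{a \<in> - insert m I. a < x} = {a \<in> - I. a < x} - {m}" "m \<in> {a \<in> - I. a < x}" using I(2) by auto
    then show ?thesis using x(2) False by simp
  qed
  then have "pick (- insert m I) i = x"
    using inf x(1) \<open>x \<noteq> m\<close> by (intro pick_eqI) auto
  then show ?thesis unfolding x_def ..
qed

lemma strict_mono_pick: "infinite S \<Longrightarrow> strict_mono (pick S)"
  using pick_mono[of _ S] by (simp add: strict_mono_def)

lemma bij_betw_pick:
  assumes "infinite S"
  shows "bij_betw (pick S) {..<card {i. i < s \<and> i \<in> S}} {i. i < s \<and> i \<in> S}"
proof (rule bij_betw_imageI)
  show "inj_on (pick S) {..<card {i. i < s \<and> i \<in> S}}"
    by (rule strict_mono_imp_inj_on[OF strict_mono_pick[OF assms]])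
  show "pick S ` {..<card {i. i < s \<and> i \<in> S}} = {i. i < s \<and> i \<in> S}"
  proof (intro equalityI subsetI)
    fix x assume "x \<in> pick S ` {..<card {i. i < s \<and> i \<in> S}}"
    then show "x \<in> {i. i < s \<and> i \<in> S}" using pick_le pick_in_set assms by auto
  next
    fix x assume x: "x \<in> {i. i < s \<and> i \<in> S}"
    then have "card {a \<in> S. a < x} < card {i. i < s \<and> i \<in> S}" by (intro psubset_card_mono) auto
    moreover have "pick S (card {a \<in> S. a < x}) = x" using x pick_card_in_set by auto
    ultimately show "x \<in> pick S ` {..<card {i. i < s \<and> i \<in> S}}" by force
  qed
qed

lemma compl_card:
  assumes "I \<subseteq> {..<s}" shows "card {i. i < s \<and> i \<in> - I} = s - card I"
proof -
  have e: "{i. i < s \<and> i \<in> - I} = {..<s} - I" by auto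
  show ?thesis unfolding e
    by (subst card_Diff_subset[OF finite_subset[OF assms finite_lessThan] assms]) simp
qed

lemma submatrix_compl:
  assumes A: "A \<in> carrier_mat s s" and IJ: "I \<subseteq> {..<s}" "J \<subseteq> {..<s}"
  shows "submatrix A (- I) (- J) = mat (s - card I) (s - card J) (\<lambda>(i, j). A $$ (pick (- I) i, pick (- J) j))"
  by (simp only: submatrix_def carrier_matD[OF A] compl_card[OF IJ(1)] compl_card[OF IJ(2)])

text \<open>A kernel vector of the minor is extended by zero to the deleted columns. In this form minors are compared
with determinants of full size without keeping track of signs.\<close>

lemma det_submatrix_eq_0_iff:
  fixes A :: "'a::field mat"
  assumes A: "A \<in> carrier_mat s s" and IJ: "I \<subseteq> {..<s}" "J \<subseteq> {..<s}" "card I = card J"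
  shows "det (submatrix A (- I) (- J)) = 0 \<longleftrightarrow>
     (\<exists>v. (\<exists>j<s. v j \<noteq> 0) \<and> (\<forall>j\<in>J. v j = 0) \<and> (\<forall>i\<in>{..<s} - I. (\<Sum>j<s. A $$ (i, j) * v j) = 0))"
proof -
  have fin: "finite I" "finite J" using IJ finite_subset by blast+
  have inf: "infinite (- I)" "infinite (- J)" using fin by (simp_all add: finite_compl)
  define r where "r = s - card I"
  have bI: "bij_betw (pick (- I)) {..<r} ({..<s} - I)" and bJ: "bij_betw (pick (- J)) {..<r} ({..<s} - J)"
  proof -
    have e: "{i. i < s \<and> i \<in> - I} = {..<s} - I" "{i. i < s \<and> i \<in> - J} = {..<s} - J" by auto
    show "bij_betw (pick (- I)) {..<r} ({..<s} - I)"
      using bij_betw_pick[OF inf(1), of s] unfolding compl_card[OF IJ(1)] unfolding e r_def .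
    show "bij_betw (pick (- J)) {..<r} ({..<s} - J)"
      using bij_betw_pick[OF inf(2), of s] unfolding compl_card[OF IJ(2)] unfolding e r_def IJ(3) .
  qed
  have sub: "submatrix A (- I) (- J) = mat r r (\<lambda>(i, j). A $$ (pick (- I) i, pick (- J) j))"
    unfolding submatrix_compl[OF A IJ(1,2)] r_def IJ(3) ..
  have sum: "(\<Sum>j<s. A $$ (i, j) * v j) = (\<Sum>j<r. A $$ (i, pick (- J) j) * v (pick (- J) j))"
    if "\<forall>j\<in>J. v j = 0" for v i
  proof -
    have "(\<Sum>j<s. A $$ (i, j) * v j) = (\<Sum>j\<in>{..<s} - J. A $$ (i, j) * v j)"
      by (rule sum.mono_neutral_right) (use that in auto)
    then show ?thesis using sum.reindex_bij_betw[OF bJ, of "\<lambda>j. A $$ (i, j) * v j"] by simp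
  qed
  have "det (submatrix A (- I) (- J)) = 0 \<longleftrightarrow>
     (\<exists>w. (\<exists>j<r. w j \<noteq> 0) \<and> (\<forall>i<r. (\<Sum>j<r. A $$ (pick (- I) i, pick (- J) j) * w j) = 0))"
    using rdet_eq_0_iff[of r "\<lambda>i j. A $$ (pick (- I) i, pick (- J) j)"] unfolding rdet_def sub .
  also have "\<dots> \<longleftrightarrow> (\<exists>v. (\<exists>j<s. v j \<noteq> 0) \<and> (\<forall>j\<in>J. v j = 0) \<and> (\<forall>i\<in>{..<s} - I. (\<Sum>j<s. A $$ (i, j) * v j) = 0))"
  proof
    assume "\<exists>w. (\<exists>j<r. w j \<noteq> 0) \<and> (\<forall>i<r. (\<Sum>j<r. A $$ (pick (- I) i, pick (- J) j) * w j) = 0)"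
    then obtain w where w': "(\<exists>j<r. w j \<noteq> 0) \<and> (\<forall>i<r. (\<Sum>j<r. A $$ (pick (- I) i, pick (- J) j) * w j) = 0)"
      by (rule exE)
    obtain j0 where w: "j0 < r" "w j0 \<noteq> 0" using conjunct1[OF w'] by blast
    note w3 = conjunct2[OF w']
    define v where "v = (\<lambda>j. if j \<in> J then 0 else w (the_inv_into {..<r} (pick (- J)) j))"
    have v: "v (pick (- J) j) = w j" if "j < r" for j
    proof -
      have "pick (- J) j \<notin> J" using bJ that by (auto simp: bij_betw_def)
      then show ?thesis using bJ that by (simp add: v_def the_inv_into_f_f bij_betw_def)
    qed
    have "(\<Sum>j<s. A $$ (i, j) * v j) = 0" if "i \<in> {..<s} - I" for i
    proof -
      have "i \<in> pick (- I) ` {..<r}" using bI that by (simp add: bij_betw_def)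
      then obtain i' where "i' < r" "i = pick (- I) i'" by (rule imageE) simp
      moreover have "\<forall>j\<in>J. v j = 0" by (simp add: v_def)
      ultimately show ?thesis using w3 v by (simp add: sum)
    qed
    moreover have "pick (- J) j0 < s" using bJ w(1) by (auto simp: bij_betw_def)
    then have "\<exists>j<s. v j \<noteq> 0" using v[OF w(1)] w(2) by auto
    ultimately show "\<exists>v. (\<exists>j<s. v j \<noteq> 0) \<and> (\<forall>j\<in>J. v j = 0) \<and> (\<forall>i\<in>{..<s} - I. (\<Sum>j<s. A $$ (i, j) * v j) = 0)"
      by (intro exI[of _ v]) (simp add: v_def)
  next
    assume "\<exists>v. (\<exists>j<s. v j \<noteq> 0) \<and> (\<forall>j\<in>J. v j = 0) \<and> (\<forall>i\<in>{..<s} - I. (\<Sum>j<s. A $$ (i, j) * v j) = 0)"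
    then obtain v where v': "(\<exists>j<s. v j \<noteq> 0) \<and> (\<forall>j\<in>J. v j = 0) \<and> (\<forall>i\<in>{..<s} - I. (\<Sum>j<s. A $$ (i, j) * v j) = 0)"
      by (rule exE)
    note v4 = conjunct2[OF conjunct2[OF v']]
    obtain j0 where v: "j0 < s" "v j0 \<noteq> 0" "\<forall>j\<in>J. v j = 0" using conjunct1[OF v'] conjunct1[OF conjunct2[OF v']] by blast
    have "j0 \<in> {..<s} - J" using v(1-3) by auto
    then have "j0 \<in> pick (- J) ` {..<r}" using bJ by (simp add: bij_betw_def)
    then obtain j where "j < r" "j0 = pick (- J) j" by (rule imageE) simp
    moreover have "(\<Sum>j<r. A $$ (pick (- I) i, pick (- J) j) * v (pick (- J) j)) = 0" if "i < r" for i
    proof -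
      have "pick (- I) i \<in> {..<s} - I" using bI that unfolding bij_betw_def by auto
      then show ?thesis unfolding sum[OF v(3), symmetric] by (rule bspec[OF v4])
    qed
    ultimately show "\<exists>w. (\<exists>j<r. w j \<noteq> 0) \<and> (\<forall>i<r. (\<Sum>j<r. A $$ (pick (- I) i, pick (- J) j) * w j) = 0)"
      using v(2) by (intro exI[of _ "\<lambda>j. v (pick (- J) j)"]) auto
  qed
  finally show ?thesis .
qed

lemma submatrix_cong:
  assumes "A \<in> carrier_mat s s" "B \<in> carrier_mat s s" "infinite S" "infinite S'"
    and "\<And>i j. i < s \<Longrightarrow> j < s \<Longrightarrow> i \<in> S \<Longrightarrow> j \<in> S' \<Longrightarrow> A $$ (i, j) = B $$ (i, j)"
  shows "submatrix A S S' = submatrix B S S'"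
proof (rule eq_matI)
  fix i j assume ij: "i < dim_row (submatrix B S S')" "j < dim_col (submatrix B S S')"
  have "pick S i < s" "pick S' j < s" using ij pick_le assms by (auto simp: dim_submatrix)
  then show "submatrix A S S' $$ (i, j) = submatrix B S S' $$ (i, j)"
    using ij assms pick_in_set by (simp add: submatrix_def)
qed (use assms in \<open>simp_all add: dim_submatrix\<close>)

lemma map_submatrix: "map_mat h (submatrix A S S') = submatrix (map_mat h A) S S'"
proof (rule eq_matI)
  fix i j assume ij: "i < dim_row (submatrix (map_mat h A) S S')" "j < dim_col (submatrix (map_mat h A) S S')"
  then have "pick S i < dim_row A" "pick S' j < dim_col A" using pick_le by (auto simp: dim_submatrix)
  then show "map_mat h (submatrix A S S') $$ (i, j) = submatrix (map_mat h A) S S' $$ (i, j)"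
    using ij by (simp add: submatrix_def)
qed (simp_all add: dim_submatrix)

text \<open>Here the sign of the coefficient matters: the five-invariant combines two such expansions, and only
their relative sign makes it a resultant.\<close>

lemma det_submatrix_diag_entry:
  fixes A :: "'a::comm_ring_1 mat"
  assumes A: "A \<in> carrier_mat s s" and IJ: "I \<subseteq> {..<s}" "J \<subseteq> {..<s}" "card I = card J"
    and m: "m < s" "m \<notin> I" "m \<notin> J" "A $$ (m, m) = 0"
  shows "det (submatrix (mat s s (\<lambda>(i, j). if i = m \<and> j = m then t else A $$ (i, j))) (- I) (- J)) =
     t * ((- 1) ^ (card {a \<in> - I. a < m} + card {a \<in> - J. a < m}) * det (submatrix A (- insert m I) (- insert m J)))
     + det (submatrix A (- I) (- J))"
proof -
  have fin: "finite I" "finite J" using IJ finite_subset by blast+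
  have inf: "infinite (- I)" "infinite (- J)" using fin by (simp_all add: finite_compl)
  define r where "r = s - card I"
  let ?B = "mat s s (\<lambda>(i, j). if i = m \<and> j = m then t else A $$ (i, j))"
  define p p' where "p = card {a \<in> - I. a < m}" and "p' = card {a \<in> - J. a < m}"
  have pick_p: "pick (- I) p = m" "pick (- J) p' = m"
    unfolding p_def p'_def by (rule pick_card_in_set, use m in simp)+
  have pick_eq: "pick (- I) i = m \<longleftrightarrow> i = p" "pick (- J) i = m \<longleftrightarrow> i = p'" for i
    using strict_mono_eq[OF strict_mono_pick[OF inf(1)], of i p] strict_mono_eq[OF strict_mono_pick[OF inf(2)], of i p']
    unfolding pick_p .
  have cI: "card {i. i < s \<and> i \<in> - I} = r" and cJ: "card {i. i < s \<and> i \<in> - J} = r"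
    using IJ by (simp_all only: compl_card r_def)
  have pr: "p < r" "p' < r"
  proof -
    show "p < r" unfolding cI[symmetric] p_def by (rule psubset_card_mono) (use m in auto)
    show "p' < r" unfolding cJ[symmetric] p'_def by (rule psubset_card_mono) (use m in auto)
  qed
  have lt: "pick (- I) i < s" "pick (- J) i < s" if "i < r" for i
    using pick_le[of i s "- I"] pick_le[of i s "- J"] that cI cJ by auto
  let ?\<rho> = "\<lambda>i j. A $$ (pick (- I) i, pick (- J) j)"
  have sA: "submatrix A (- I) (- J) = mat r r (\<lambda>(i, j). ?\<rho> i j)"
    unfolding submatrix_compl[OF A IJ(1,2)] r_def IJ(3) ..
  have sB: "submatrix ?B (- I) (- J) = mat r r (\<lambda>(i, j). (?\<rho>(p := \<lambda>j. t * of_bool (j = p') + ?\<rho> p j)) i j)"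
  proof -
    have r: "s - card I = r" "s - card J = r" by (simp_all add: r_def IJ(3))
    have B: "?B \<in> carrier_mat s s" by simp
    show ?thesis unfolding submatrix_compl[OF B IJ(1,2)] r
    proof (rule eq_matI)
      fix i j assume ij: "i < dim_row (mat r r (\<lambda>(i, j). (?\<rho>(p := \<lambda>j. t * of_bool (j = p') + ?\<rho> p j)) i j))"
        "j < dim_col (mat r r (\<lambda>(i, j). (?\<rho>(p := \<lambda>j. t * of_bool (j = p') + ?\<rho> p j)) i j))"
      then have ij: "i < r" "j < r" by simp_all
      have "?B $$ (pick (- I) i, pick (- J) j) = (if i = p \<and> j = p' then t else ?\<rho> i j)"
        using lt(1)[OF ij(1)] lt(2)[OF ij(2)] by (simp add: pick_eq)
      also have "\<dots> = (?\<rho>(p := \<lambda>j. t * of_bool (j = p') + ?\<rho> p j)) i j"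
        using m(4) by (simp add: pick_p)
      finally show "mat r r (\<lambda>(i, j). ?B $$ (pick (- I) i, pick (- J) j)) $$ (i, j) =
          mat r r (\<lambda>(i, j). (?\<rho>(p := \<lambda>j. t * of_bool (j = p') + ?\<rho> p j)) i j) $$ (i, j)"
        using ij by simp
    qed simp_all
  qed
  have "det (submatrix ?B (- I) (- J)) = rdet r (?\<rho>(p := \<lambda>j. t * of_bool (j = p') + ?\<rho> p j))"
    unfolding sB rdet_def ..
  also have "\<dots> = t * rdet r (?\<rho>(p := \<lambda>j. of_bool (j = p'))) + rdet r (?\<rho>(p := ?\<rho> p))"
    by (rule rdet_row_affine) (rule pr)
  also have "rdet r (?\<rho>(p := ?\<rho> p)) = det (submatrix A (- I) (- J))"
    unfolding sA rdet_def by (rule arg_cong[of _ _ det], rule eq_matI) auto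
  also have "rdet r (?\<rho>(p := \<lambda>j. of_bool (j = p'))) = cofactor (submatrix A (- I) (- J)) p p'"
  proof -
    have "rdet r (?\<rho>(p := \<lambda>j. of_bool (j = p'))) = (\<Sum>j<r. of_bool (j = p') * cofactor (mat r r (\<lambda>(i, j). ?\<rho> i j)) p j)"
      by (rule rdet_row_expand[OF pr(1)])
    also have "\<dots> = (\<Sum>j<r. if j = p' then cofactor (mat r r (\<lambda>(i, j). ?\<rho> i j)) p p' else 0)"
      by (rule sum.cong[OF refl]) simp
    also have "\<dots> = cofactor (mat r r (\<lambda>(i, j). ?\<rho> i j)) p p'" using pr(2) by simp
    finally show ?thesis unfolding sA .
  qed
  also have "\<dots> = (- 1) ^ (p + p') * det (mat_delete (submatrix A (- I) (- J)) p p')"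
    unfolding cofactor_def ..
  also have "mat_delete (submatrix A (- I) (- J)) p p' = submatrix A (- insert m I) (- insert m J)"
  proof (rule eq_matI)
    have c: "card {i. i < s \<and> i \<in> - insert m I} = r - 1" "card {i. i < s \<and> i \<in> - insert m J} = r - 1"
      using IJ m fin by (subst compl_card; simp add: r_def)+
    then show d: "dim_row (mat_delete (submatrix A (- I) (- J)) p p') = dim_row (submatrix A (- insert m I) (- insert m J))"
      "dim_col (mat_delete (submatrix A (- I) (- J)) p p') = dim_col (submatrix A (- insert m I) (- insert m J))"
      using A cI cJ by (simp_all add: dim_submatrix)
    fix i j assume "i < dim_row (submatrix A (- insert m I) (- insert m J))" "j < dim_col (submatrix A (- insert m I) (- insert m J))"
    then have ij: "i < r - 1" "j < r - 1" using A c by (simp_all add: dim_submatrix)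
    have "mat_delete (submatrix A (- I) (- J)) p p' $$ (i, j) =
        A $$ (pick (- I) (if i < p then i else Suc i), pick (- J) (if j < p' then j else Suc j))"
      using ij unfolding sA mat_delete_def by auto
    also have "\<dots> = A $$ (pick (- insert m I) i, pick (- insert m J) j)"
      unfolding p_def p'_def using pick_insert_compl[OF fin(1) m(2)] pick_insert_compl[OF fin(2) m(3)] by simp
    also have "\<dots> = submatrix A (- insert m I) (- insert m J) $$ (i, j)"
      using ij A c by (simp add: submatrix_def)
    finally show "mat_delete (submatrix A (- I) (- J)) p p' $$ (i, j) = submatrix A (- insert m I) (- insert m J) $$ (i, j)" .
  qed
  finally show ?thesis unfolding p_def p'_def .
qed

lemma card_below_compl: "finite I \<Longrightarrow> card {a \<in> - I. a < m} + card {a \<in> I. a < m} = (m::nat)"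
proof -
  assume "finite I"
  have "card {a \<in> - I. a < m} + card {a \<in> I. a < m} = card ({a \<in> - I. a < m} \<union> {a \<in> I. a < m})"
    by (rule card_Un_disjoint[symmetric]) auto
  also have "{a \<in> - I. a < m} \<union> {a \<in> I. a < m} = {..<m}" by auto
  finally show ?thesis by simp
qed

context graph_over_field
begin

definition graph_matrix :: "(nat \<Rightarrow> 'k) \<Rightarrow> 'k mat" where
  "graph_matrix d = mat (N + n) (N + n) (\<lambda>(i, j). if i < N then (if j < N then (if i = j then d i else 0) else E i (j - N))
     else (if j < N then - E j (i - N) else 0))"

lemma graph_matrix_carrier [simp]: "graph_matrix d \<in> carrier_mat (N + n) (N + n)"
  by (simp add: graph_matrix_def)

lemma eval_graph_mat:
  "map_mat (eval_ipoly a) (graph_mat G es vs K) = graph_matrix (\<lambda>r. if es ! r \<in> K then 0 else a (es ! r))"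
proof -
  interpret h: comm_ring_hom "eval_ipoly a" by (rule eval_ipoly_hom)
  have 1: "eval_ipoly a 1 = 1" "eval_ipoly a 0 = 0" "eval_ipoly a (- P) = - eval_ipoly a P" for P
    by (simp_all add: h.hom_uminus)
  have inc: "eval_ipoly a (incidence_mat G es vs $$ (r, j)) = E r j" if "r < N" "j < n" for r j
    using that by (simp add: incidence_mat_def N_eq n_eq E_eq 1)
  have d: "dim_row (incidence_mat G es vs) = N" "dim_col (incidence_mat G es vs) = n"
    by (simp_all add: incidence_mat_def N_eq n_eq)
  show ?thesis
  proof (rule eq_matI)
    fix i j assume "i < dim_row (graph_matrix (\<lambda>r. if es ! r \<in> K then 0 else a (es ! r)))"
      "j < dim_col (graph_matrix (\<lambda>r. if es ! r \<in> K then 0 else a (es ! r)))"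
    then have ij: "i < N + n" "j < N + n" by (simp_all add: graph_matrix_def)
    have N: "length es = N" "length vs = n" by (simp_all add: N_eq n_eq)
    show "map_mat (eval_ipoly a) (graph_mat G es vs K) $$ (i, j) = graph_matrix (\<lambda>r. if es ! r \<in> K then 0 else a (es ! r)) $$ (i, j)"
    proof (cases "i < N"; cases "j < N")
      assume "i < N" "j < N"
      then show ?thesis using ij by (simp add: graph_mat_def graph_matrix_def mat_diag_def N d 1 eval_ipoly_var)
    next
      assume "i < N" "\<not> j < N"
      then show ?thesis using ij inc[of i "j - N"] by (simp add: graph_mat_def graph_matrix_def mat_diag_def N d 1)
    next
      assume "\<not> i < N" "j < N"
      then show ?thesis using ij inc[of j "i - N"] by (simp add: graph_mat_def graph_matrix_def mat_diag_def N d 1)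
    next
      assume "\<not> i < N" "\<not> j < N"
      then show ?thesis using ij by (simp add: graph_mat_def graph_matrix_def mat_diag_def N d 1)
    qed
  qed (simp_all add: graph_mat_def graph_matrix_def mat_diag_def d N_eq[symmetric] n_eq[symmetric])
qed

lemma eval_dodgson:
  "eval_ipoly a (dodgson G es vs I J K) =
    det (submatrix (graph_matrix (\<lambda>r. if es ! r \<in> K then 0 else a (es ! r))) (- edge_positions es I) (- edge_positions es J))"
proof -
  interpret h: comm_ring_hom "eval_ipoly a" by (rule eval_ipoly_hom)
  show ?thesis unfolding dodgson_def h.hom_det[symmetric] map_submatrix eval_graph_mat ..
qed

text \<open>Matching the deleted rows with the deleted columns by unit rows turns the minor into a determinant of
full size with the same zeros.\<close>

lemma det_minor_eq_0_iff:
  assumes X: "X \<subseteq> {..<N}" and IJ: "I \<subseteq> {..<N}" "J \<subseteq> {..<N}" "card I = card J" "X \<inter> (I \<union> J) = {}"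
    and d: "\<And>r. r \<in> X \<Longrightarrow> d r = \<alpha> r" "\<And>r. r \<in> {..<N} - X - I - J \<Longrightarrow> d r = 0"
  shows "det (submatrix (graph_matrix d) (- I) (- J)) = 0 \<longleftrightarrow> singular X J ({..<N} - X - I) \<alpha>"
proof -
  have fin: "finite I" "finite J" using IJ(1,2) finite_subset by blast+
  obtain h where h: "bij_betw h I J" using finite_same_card_bij[OF fin IJ(3)] by blast
  define c where "c = (\<lambda>r. if r \<in> I then Unit (h r) else Inc r)"
  have cI: "c ` ({..<N} - X) = Unit ` J \<union> Inc ` ({..<N} - X - I)"
  proof -
    have "{..<N} - X = I \<union> ({..<N} - X - I)" using IJ by blast
    then have "c ` ({..<N} - X) = c ` I \<union> c ` ({..<N} - X - I)" by (metis image_Un)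
    also have "c ` I = Unit ` J" using h by (force simp: c_def bij_betw_def)
    also have "c ` ({..<N} - X - I) = Inc ` ({..<N} - X - I)" by (auto simp: c_def)
    finally show ?thesis .
  qed
  have u: "units (c ` ({..<N} - X)) = J" "incs (c ` ({..<N} - X)) = {..<N} - X - I"
    unfolding cI by (auto simp: units_def incs_def)
  have rows: "(\<forall>j\<in>J. v j = 0) \<and> (\<forall>i\<in>{..<N + n} - I. (\<Sum>j<N + n. graph_matrix d $$ (i, j) * v j) = 0) \<longleftrightarrow>
     (\<forall>i<N + n. (\<Sum>j<N + n. Rows X c \<alpha> i j * v j) = 0)" for v
  proof -
    have rI: "(\<Sum>j<N + n. Rows X c \<alpha> i j * v j) = v (h i)" if "i \<in> I" for i
    proof -
      have "h i < N + n" using h that IJ(2) by (force simp: bij_betw_def)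
      have "i < N" "i \<notin> X" using that IJ by auto
      then have "(\<Sum>j<N + n. Rows X c \<alpha> i j * v j) = (\<Sum>j<N + n. if j = h i then v (h i) else 0)"
        using that by (intro sum.cong refl) (simp add: Rows_def c_def)
      then show ?thesis using \<open>h i < N + n\<close> by simp
    qed
    have J: "(\<forall>j\<in>J. v j = 0) \<longleftrightarrow> (\<forall>i\<in>I. v (h i) = 0)" using h by (auto simp: bij_betw_def)
    have rO: "(\<Sum>j<N + n. graph_matrix d $$ (i, j) * v j) = (\<Sum>j<N + n. Rows X c \<alpha> i j * v j)"
      if v: "\<forall>j\<in>J. v j = 0" and i: "i \<in> {..<N + n} - I" for i
    proof (rule sum.cong[OF refl])
      fix j assume "j \<in> {..<N + n}"
      then have j: "j < N + n" and i': "i < N + n" "i \<notin> I" using i by auto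
      have "d i * v i = 0" if "i < N" "i \<notin> X"
        using d(2)[of i] v i' that by (cases "i \<in> J") simp_all
      then show "graph_matrix d $$ (i, j) * v j = Rows X c \<alpha> i j * v j"
        using j i' d(1)[of i] by (cases "i < N"; cases "i \<in> X"; cases "i = j") (simp_all add: graph_matrix_def Rows_def c_def)
    qed
    have split: "(\<forall>i<N + n. R i) \<longleftrightarrow> (\<forall>i\<in>I. R i) \<and> (\<forall>i\<in>{..<N + n} - I. R i)" for R
      using IJ(1) by fastforce
    show ?thesis
    proof (cases "\<forall>j\<in>J. v j = 0")
      case True
      have "(\<forall>i\<in>{..<N + n} - I. (\<Sum>j<N + n. graph_matrix d $$ (i, j) * v j) = 0) \<longleftrightarrow>
          (\<forall>i\<in>{..<N + n} - I. (\<Sum>j<N + n. Rows X c \<alpha> i j * v j) = 0)"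
        by (intro ball_cong refl) (simp only: rO[OF True])
      moreover have "\<forall>i\<in>I. (\<Sum>j<N + n. Rows X c \<alpha> i j * v j) = 0"
        using True unfolding J by (simp add: rI)
      ultimately show ?thesis unfolding split using True by blast
    next
      case False
      then have "\<not> (\<forall>i\<in>I. (\<Sum>j<N + n. Rows X c \<alpha> i j * v j) = 0)"
        unfolding J by (simp add: rI)
      then show ?thesis unfolding split using False by blast
    qed
  qed
  have I': "I \<subseteq> {..<N + n}" "J \<subseteq> {..<N + n}" using IJ by auto
  have "det (submatrix (graph_matrix d) (- I) (- J)) = 0 \<longleftrightarrow>
      (\<exists>v. (\<exists>j<N + n. v j \<noteq> 0) \<and> (\<forall>i<N + n. (\<Sum>j<N + n. Rows X c \<alpha> i j * v j) = 0))"
    unfolding det_submatrix_eq_0_iff[OF graph_matrix_carrier I' IJ(3)] rows ..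
  also have "\<dots> \<longleftrightarrow> Det X c \<alpha> = 0" unfolding Det_def rdet_eq_0_iff ..
  also have "\<dots> \<longleftrightarrow> singular X J ({..<N} - X - I) \<alpha>"
    using Det_eq_0_iff[OF X, of c \<alpha>] IJ(2) unfolding u by blast
  finally show ?thesis .
qed

lemma card_reindex:
  assumes X: "X \<subseteq> {..<N}"
    and PQ: "\<And>a. P a \<longleftrightarrow> R (\<lambda>r. if r \<in> X then a (es ! r) else 0)"
  shows "card {a :: 'e \<Rightarrow> 'k. a \<in> (!) es ` X \<rightarrow>\<^sub>E UNIV \<and> P a} = card {\<alpha> \<in> supp X. R \<alpha>}"
proof -
  have inj: "inj_on ((!) es) X"
    using es(1) X by (auto simp: inj_on_def N_eq nth_eq_iff_index_eq subset_iff)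
  let ?i = "the_inv_into X ((!) es)"
  have i: "?i (es ! r) = r" if "r \<in> X" for r using inj that by (rule the_inv_into_f_f)
  have "bij_betw (\<lambda>a r. if r \<in> X then a (es ! r) else 0) {a :: 'e \<Rightarrow> 'k. a \<in> (!) es ` X \<rightarrow>\<^sub>E UNIV \<and> P a} {\<alpha> \<in> supp X. R \<alpha>}"
  proof (rule bij_betw_byWitness[where f' = "\<lambda>\<alpha> e. if e \<in> (!) es ` X then \<alpha> (?i e) else undefined"])
    have 1: "(\<lambda>r. if r \<in> X then (\<lambda>e. if e \<in> (!) es ` X then \<alpha> (?i e) else undefined) (es ! r) else 0) = \<alpha>"
      if "\<alpha> \<in> supp X" for \<alpha> :: "nat \<Rightarrow> 'k"
      using that i by (auto simp: supp_def fun_eq_iff)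
    show "\<forall>\<alpha>\<in>{\<alpha> \<in> supp X. R \<alpha>}. (\<lambda>r. if r \<in> X then (\<lambda>e. if e \<in> (!) es ` X then \<alpha> (?i e) else undefined) (es ! r) else 0) = \<alpha>"
      using 1 by blast
    show "(\<lambda>\<alpha> e. if e \<in> (!) es ` X then \<alpha> (?i e) else undefined) ` {\<alpha> \<in> supp X. R \<alpha>} \<subseteq> {a. a \<in> (!) es ` X \<rightarrow>\<^sub>E UNIV \<and> P a}"
    proof
      fix a assume "a \<in> (\<lambda>\<alpha> e. if e \<in> (!) es ` X then \<alpha> (?i e) else undefined) ` {\<alpha> \<in> supp X. R \<alpha>}"
      then obtain \<alpha> where a: "a = (\<lambda>e. if e \<in> (!) es ` X then \<alpha> (?i e) else undefined)" "\<alpha> \<in> supp X" "R \<alpha>" by blast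
      have "P a" unfolding PQ using a(3) 1[OF a(2)] unfolding a(1) by (simp only:)
      moreover have "a \<in> (!) es ` X \<rightarrow>\<^sub>E UNIV" unfolding a(1) by auto
      ultimately show "a \<in> {a. a \<in> (!) es ` X \<rightarrow>\<^sub>E UNIV \<and> P a}" by simp
    qed
    show "(\<lambda>a r. if r \<in> X then a (es ! r) else 0) ` {a. a \<in> (!) es ` X \<rightarrow>\<^sub>E UNIV \<and> P a} \<subseteq> {\<alpha> \<in> supp X. R \<alpha>}"
      unfolding PQ by (auto simp: supp_def)
    show "\<forall>a\<in>{a. a \<in> (!) es ` X \<rightarrow>\<^sub>E UNIV \<and> P a}.
        (\<lambda>e. if e \<in> (!) es ` X then (\<lambda>r. if r \<in> X then a (es ! r) else 0) (?i e) else undefined) = a"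
    proof
      fix a :: "'e \<Rightarrow> 'k" assume "a \<in> {a. a \<in> (!) es ` X \<rightarrow>\<^sub>E UNIV \<and> P a}"
      then have "a e = undefined" if "e \<notin> (!) es ` X" for e using that by (auto simp: PiE_def extensional_def)
      then show "(\<lambda>e. if e \<in> (!) es ` X then (\<lambda>r. if r \<in> X then a (es ! r) else 0) (?i e) else undefined) = a"
        using i by (auto simp: fun_eq_iff)
    qed
  qed
  then show ?thesis by (rule bij_betw_same_card)
qed

lemma point_count_graph_polynomial:
  "int (point_count TYPE('k) (arcs G) (graph_polynomial G)) = num_singular {..<N}"
proof -
  have arcs: "arcs G = (!) es ` {..<N}" using es(2) by (auto simp: N_eq set_conv_nth)
  have "point_count TYPE('k) (arcs G) (graph_polynomial G) = card {\<alpha> \<in> supp {..<N}. singular {..<N} {} {} \<alpha>}"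
    unfolding point_count_def arcs
  proof (rule card_reindex)
    fix a :: "'e \<Rightarrow> 'k"
    interpret h: comm_ring_hom "eval_ipoly a" by (rule eval_ipoly_hom)
    let ?\<alpha> = "\<lambda>r. if r \<in> {..<N} then a (es ! r) else 0"
    have inj: "inj_on ((!) es) {..<N}" using es(1) by (auto simp: inj_on_def N_eq nth_eq_iff_index_eq)
    have "eval_ipoly a (graph_polynomial G) = (\<Sum>T | undirected_spanning_tree G T. \<Prod>e\<in>arcs G - T. a e)"
      by (simp add: graph_polynomial_def h.hom_sum h.hom_prod eval_ipoly_var)
    also have "\<dots> = (\<Sum>T | undirected_spanning_tree G T. \<Prod>r | r < N \<and> es ! r \<notin> T. ?\<alpha> r)"
    proof (rule sum.cong[OF refl])
      fix T
      have "arcs G - T = (!) es ` {r. r < N \<and> es ! r \<notin> T}" unfolding arcs by auto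
      then have "(\<Prod>e\<in>arcs G - T. a e) = (\<Prod>r | r < N \<and> es ! r \<notin> T. a (es ! r))"
        by (simp only:) (rule prod.reindex_cong[OF inj_on_subset[OF inj]], auto)
      also have "\<dots> = (\<Prod>r | r < N \<and> es ! r \<notin> T. ?\<alpha> r)" by (rule prod.cong) auto
      finally show "(\<Prod>e\<in>arcs G - T. a e) = (\<Prod>r | r < N \<and> es ! r \<notin> T. ?\<alpha> r)" .
    qed
    also have "\<dots> = Det {..<N} Unit ?\<alpha>" by (rule matrix_tree[symmetric])
    finally have "eval_ipoly a (graph_polynomial G) = Det {..<N} Unit ?\<alpha>" .
    then show "eval_ipoly a (graph_polynomial G) = 0 \<longleftrightarrow> singular {..<N} {} {} ?\<alpha>"
      using Det_eq_0_iff[of "{..<N}" Unit ?\<alpha>] by simp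
  qed simp
  then show ?thesis by simp
qed

end

section \<open>The five-invariant\<close>

lemma det_two_rows:
  fixes u v w x :: "'a::comm_ring_1"
  shows "det (mat_of_rows_list 2 [[u, v], [w, x]]) = u * x - v * w"
proof -
  let ?A = "mat_of_rows_list 2 [[u, v], [w, x]]"
  have A: "?A \<in> carrier_mat 2 2" by (simp add: mat_of_rows_list_def numeral_2_eq_2)
  have "mat_delete ?A 0 j \<in> carrier_mat 1 1" for j
    using mat_delete_carrier[OF A, of 0 j] by simp
  note minor = det_single[OF this]
  have "cofactor ?A 0 0 = x" "cofactor ?A 0 1 = - w"
    unfolding cofactor_def minor by (simp_all add: mat_delete_def mat_of_rows_list_def)
  then have "det ?A = ?A $$ (0, 0) * x + ?A $$ (0, 1) * (- w)"
    using laplace_expansion_row[OF A, of 0] by (simp add: numeral_2_eq_2)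
  then show ?thesis by (simp add: mat_of_rows_list_def)
qed

context graph_over_field
begin

lemma minor_cong:
  assumes "I \<subseteq> {..<N}" "J \<subseteq> {..<N}" and d: "\<And>r. r \<in> {..<N} - I - J \<Longrightarrow> d r = d' r"
  shows "submatrix (graph_matrix d) (- I) (- J) = submatrix (graph_matrix d') (- I) (- J)"
proof (rule submatrix_cong[OF graph_matrix_carrier graph_matrix_carrier])
  have "finite I" "finite J" using assms(1,2) finite_subset by blast+
  then show "infinite (- I)" "infinite (- J)" by (simp_all add: finite_compl)
  fix i j assume "i < N + n" "j < N + n" "i \<in> - I" "j \<in> - J"
  then show "graph_matrix d $$ (i, j) = graph_matrix d' $$ (i, j)" using d[of i] by (auto simp: graph_matrix_def)
qed

definition minor :: "(nat \<Rightarrow> 'k) \<Rightarrow> nat set \<Rightarrow> nat set \<Rightarrow> 'k" where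
  "minor \<alpha> I J = det (submatrix (graph_matrix \<alpha>) (- I) (- J))"

text \<open>The sign depends on \<open>I\<close> and \<open>J\<close> only through the number of their elements below \<open>m\<close>.\<close>

lemma minor_affine:
  assumes IJ: "I \<subseteq> {..<N}" "J \<subseteq> {..<N}" "card I = card J" and m: "m < N" "m \<notin> I" "m \<notin> J"
  shows "minor \<alpha> I J = \<alpha> m * ((- 1) ^ (card {x \<in> - I. x < m} + card {x \<in> - J. x < m}) * minor (\<alpha>(m := 0)) (insert m I) (insert m J))
     + minor (\<alpha>(m := 0)) I J"
proof -
  have I': "I \<subseteq> {..<N + n}" "J \<subseteq> {..<N + n}" using IJ by auto
  have "graph_matrix \<alpha> = mat (N + n) (N + n) (\<lambda>(i, j). if i = m \<and> j = m then \<alpha> m else graph_matrix (\<alpha>(m := 0)) $$ (i, j))"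
    using m(1) by (intro eq_matI) (simp_all add: graph_matrix_def)
  then show ?thesis
    unfolding minor_def using det_submatrix_diag_entry[OF graph_matrix_carrier I' IJ(3) _ m(2,3), of "\<alpha>(m := 0)" "\<alpha> m"] m(1)
    by (simp add: graph_matrix_def)
qed

lemma edge_positions_image:
  assumes "A \<subseteq> {..<N}"
  shows "edge_positions es ((!) es ` A) = A"
  using assms es(1) by (auto simp: edge_positions_def N_eq nth_eq_iff_index_eq subset_iff)

text \<open>The two minors of \<open>num_singular_eq_pair_count\<close> are Dodgson polynomials up to sign.
Eliminating the fifth variable, the sign \<open>\<tau>\<close> of its coefficient is the same for both, as the same four edges
are deleted from rows and columns. Therefore the resultant is the five-invariant up to sign. The common zeros of the
two coefficients are divisible by \<open>q\<close> in number: the sum of their degrees is one less than the number of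
variables.\<close>

theorem num_singular_eq_five_invariant_count:
  assumes N: "N = 2 * n" and n: "3 \<le> n"
    and lt: "a < N" "b < N" "c < N" "d < N" "m < N" and dist: "distinct [a, b, c, d, m]"
  shows "[num_singular {..<N} = - (q ^ 2) * int (point_count TYPE('k) (arcs G - {es ! a, es ! c, es ! d, es ! b, es ! m})
     (five_invariant G es vs (es ! a) (es ! c) (es ! d) (es ! b) (es ! m)))] (mod q ^ 3)"
proof -
  have ne: "a \<noteq> b" "a \<noteq> c" "a \<noteq> d" "a \<noteq> m" "b \<noteq> c" "b \<noteq> d" "b \<noteq> m" "c \<noteq> d" "c \<noteq> m" "d \<noteq> m"
    using dist by auto
  define X where "X = {..<N} - {a, b, c, d, m}"
  have fin: "finite X" and m: "m \<notin> X" by (simp_all add: X_def)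
  have sub: "X \<subseteq> {..<N}" "insert m X \<subseteq> {..<N}" using lt by (auto simp: X_def)
  have Xm: "{..<N} - {a, b, c, d} = insert m X" using lt ne by (auto simp: X_def)
  have card: "card X = 2 * n - 5"
  proof -
    have "card X = card {..<N} - card {a, b, c, d, m}"
      unfolding X_def by (rule card_Diff_subset) (use lt in auto)
    moreover have "card {a, b, c, d, m} = 5" using ne by (simp add: eval_nat_numeral)
    ultimately show ?thesis using N by simp
  qed
  have sets: "{a, c} \<subseteq> {..<N}" "{d, b} \<subseteq> {..<N}" "{a, d} \<subseteq> {..<N}" "{c, b} \<subseteq> {..<N}"
    "{a, c, m} \<subseteq> {..<N}" "{d, b, m} \<subseteq> {..<N}" "{a, d, m} \<subseteq> {..<N}" "{c, b, m} \<subseteq> {..<N}"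
    using lt by auto
  define \<tau> :: 'k where "\<tau> = (- 1) ^ (card {x \<in> - {a, c}. x < m} + card {x \<in> - {d, b}. x < m})"
  have \<tau>': "(- 1) ^ (card {x \<in> - {a, d}. x < m} + card {x \<in> - {c, b}. x < m}) = \<tau>"
  proof -
    have below: "card {z \<in> - {x, y}. z < m} + (of_bool (x < m) + of_bool (y < m)) = m" if "x \<noteq> y" for x y
    proof -
      have "{z \<in> {x, y}. z < m} = (if x < m then {x} else {}) \<union> (if y < m then {y} else {})" by auto
      then have "card {z \<in> {x, y}. z < m} = of_bool (x < m) + of_bool (y < m)" using that by auto
      then show ?thesis using card_below_compl[of "{x, y}" m] by (simp only: finite.intros simp_thms)
    qed
    have "card {x \<in> - {a, d}. x < m} + card {x \<in> - {c, b}. x < m} = card {x \<in> - {a, c}. x < m} + card {x \<in> - {d, b}. x < m}"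
      using below[OF ne(2)] below[OF ne(3)] below[OF ne(5)[symmetric]] below[OF ne(6)[symmetric]] by linarith
    then show ?thesis by (simp only: \<tau>_def)
  qed
  have \<tau>0: "\<tau> \<noteq> 0" by (simp add: \<tau>_def)
  \<comment> \<open>the coefficients \<open>A\<close>, \<open>C\<close> and the constant terms \<open>B\<close>, \<open>E'\<close> of the two minors in the variable of \<open>m\<close>\<close>
  define A B C E' where "A = (\<lambda>\<alpha>. minor (\<alpha>(m := 0)) {a, c, m} {d, b, m})"
    and "B = (\<lambda>\<alpha>. minor (\<alpha>(m := 0)) {a, c} {d, b})"
    and "C = (\<lambda>\<alpha>. minor (\<alpha>(m := 0)) {a, d, m} {c, b, m})"
    and "E' = (\<lambda>\<alpha>. minor (\<alpha>(m := 0)) {a, d} {c, b})"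
  have f: "minor \<alpha> {a, c} {d, b} = \<alpha> m * (\<tau> * A \<alpha>) + B \<alpha>" for \<alpha>
    using minor_affine[OF sets(1,2) _ lt(5), of \<alpha>] ne by (simp add: A_def B_def \<tau>_def insert_commute)
  have g: "minor \<alpha> {a, d} {c, b} = \<alpha> m * (\<tau> * C \<alpha>) + E' \<alpha>" for \<alpha>
    using minor_affine[OF sets(3,4) _ lt(5), of \<alpha>] ne unfolding \<tau>' by (simp add: C_def E'_def insert_commute)
  let ?T = "int (card {\<alpha> \<in> supp (insert m X). singular (insert m X) {b, d} {b, d} \<alpha> \<and> singular (insert m X) {b, c} {b, c} \<alpha>})"
  have F: "[num_singular {..<N} = - (q ^ 2) * ?T] (mod q ^ 3)"
    using num_singular_eq_pair_count[OF N n lt(1-4)] dist unfolding Xm by simp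
  have nf: "singular (insert m X) {b, d} {b, d} \<alpha> \<longleftrightarrow> \<alpha> m * (\<tau> * A \<alpha>) + B \<alpha> = 0" for \<alpha>
  proof -
    have e: "{..<N} - insert m X - {a, c} = {b, d}" "{d, b} = {b, d}" using lt ne by (auto simp: X_def)
    have "minor \<alpha> {a, c} {d, b} = 0 \<longleftrightarrow> singular (insert m X) {d, b} ({..<N} - insert m X - {a, c}) \<alpha>"
      unfolding minor_def by (rule det_minor_eq_0_iff[OF sub(2) sets(1,2)]) (use ne e in \<open>auto simp: X_def\<close>)
    then show ?thesis unfolding f unfolding e by (rule sym)
  qed
  have ng: "singular (insert m X) {b, c} {b, c} \<alpha> \<longleftrightarrow> \<alpha> m * (\<tau> * C \<alpha>) + E' \<alpha> = 0" for \<alpha>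
  proof -
    have e: "{..<N} - insert m X - {a, d} = {b, c}" "{c, b} = {b, c}" using lt ne by (auto simp: X_def)
    have "minor \<alpha> {a, d} {c, b} = 0 \<longleftrightarrow> singular (insert m X) {c, b} ({..<N} - insert m X - {a, d}) \<alpha>"
      unfolding minor_def by (rule det_minor_eq_0_iff[OF sub(2) sets(3,4)]) (use ne e in \<open>auto simp: X_def\<close>)
    then show ?thesis unfolding g unfolding e by (rule sym)
  qed
  have s: "?T + int (card {\<alpha> \<in> supp X. \<tau> * A \<alpha> = 0 \<and> \<tau> * C \<alpha> = 0}) =
     q * int (card {\<alpha> \<in> supp X. \<tau> * A \<alpha> = 0 \<and> B \<alpha> = 0 \<and> \<tau> * C \<alpha> = 0 \<and> E' \<alpha> = 0})
     + int (card {\<alpha> \<in> supp X. \<tau> * A \<alpha> * E' \<alpha> = B \<alpha> * (\<tau> * C \<alpha>)})"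
    unfolding nf ng q_def
    by (rule card_affine_zeros2) (use fin m in \<open>simp_all add: A_def B_def C_def E'_def\<close>)
  have AC: "q dvd int (card {\<alpha> \<in> supp X. \<tau> * A \<alpha> = 0 \<and> \<tau> * C \<alpha> = 0})"
  proof -
    have "\<tau> * A \<alpha> = 0 \<and> \<tau> * C \<alpha> = 0 \<longleftrightarrow> singular X {d, b, m} {b, d} \<alpha> \<and> singular X {c, b, m} {b, c} \<alpha>"
      if "\<alpha> \<in> supp X" for \<alpha>
    proof -
      have \<alpha>: "\<alpha>(m := 0) = \<alpha>" using that m by (auto simp: supp_def)
      have e: "{..<N} - X - {a, c, m} = {b, d}" "{..<N} - X - {a, d, m} = {b, c}" using lt ne by (auto simp: X_def)
      have "A \<alpha> = 0 \<longleftrightarrow> singular X {d, b, m} ({..<N} - X - {a, c, m}) \<alpha>"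
        unfolding A_def \<alpha> minor_def by (rule det_minor_eq_0_iff[OF sub(1) sets(5,6)]) (use ne e in \<open>auto simp: X_def\<close>)
      moreover have "C \<alpha> = 0 \<longleftrightarrow> singular X {c, b, m} ({..<N} - X - {a, d, m}) \<alpha>"
        unfolding C_def \<alpha> minor_def by (rule det_minor_eq_0_iff[OF sub(1) sets(7,8)]) (use ne e in \<open>auto simp: X_def\<close>)
      ultimately show ?thesis unfolding e using \<tau>0 by simp
    qed
    then have "{\<alpha> \<in> supp X. \<tau> * A \<alpha> = 0 \<and> \<tau> * C \<alpha> = 0} = {\<alpha> \<in> supp X. singular X {d, b, m} {b, d} \<alpha> \<and> singular X {c, b, m} {b, c} \<alpha>}"
      by blast
    moreover have "X \<noteq> {}" using card n by auto
    then have "q dvd int (card {\<alpha> \<in> supp X. singular X {d, b, m} {b, d} \<alpha> \<and> singular X {c, b, m} {b, c} \<alpha>})"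
      by (intro dvd_card_singular_pair) (use fin card n ne in auto)
    ultimately show ?thesis by simp
  qed
  let ?P = "int (point_count TYPE('k) (arcs G - {es ! a, es ! c, es ! d, es ! b, es ! m})
     (five_invariant G es vs (es ! a) (es ! c) (es ! d) (es ! b) (es ! m)))"
  have P: "int (card {\<alpha> \<in> supp X. \<tau> * A \<alpha> * E' \<alpha> = B \<alpha> * (\<tau> * C \<alpha>)}) = ?P"
  proof -
    have inj: "inj_on ((!) es) {..<N}" using es(1) by (auto simp: inj_on_def N_eq nth_eq_iff_index_eq)
    have "arcs G = (!) es ` {..<N}" using es(2) by (auto simp: N_eq set_conv_nth)
    then have arcs: "arcs G - {es ! a, es ! c, es ! d, es ! b, es ! m} = (!) es ` X"
      unfolding X_def using inj_on_image_set_diff[OF inj, of "{..<N}" "{a, b, c, d, m}"] lt by auto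
    have "point_count TYPE('k) ((!) es ` X) (five_invariant G es vs (es ! a) (es ! c) (es ! d) (es ! b) (es ! m))
      = card {\<alpha> \<in> supp X. \<tau> * A \<alpha> * E' \<alpha> = B \<alpha> * (\<tau> * C \<alpha>)}"
      unfolding point_count_def
    proof (rule card_reindex[OF sub(1)])
      fix \<xi> :: "'e \<Rightarrow> 'k"
      let ?\<alpha> = "\<lambda>r. if r \<in> X then \<xi> (es ! r) else 0"
      interpret h: comm_ring_hom "eval_ipoly \<xi>" by (rule eval_ipoly_hom)
      have pos: "edge_positions es {es ! x, es ! y} = {x, y}" if "x < N" "y < N" for x y
        using edge_positions_image[of "{x, y}"] that by simp
      have pos3: "edge_positions es {es ! x, es ! y, es ! z} = {x, y, z}" if "x < N" "y < N" "z < N" for x y z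
        using edge_positions_image[of "{x, y, z}"] that by simp
      have em: "es ! r = es ! m \<longleftrightarrow> r = m" if "r < N" for r
        using inj_on_eq_iff[OF inj, of r m] that lt by simp
      have d: "eval_ipoly \<xi> (dodgson G es vs {es ! a, es ! c} {es ! d, es ! b} {es ! m}) = B ?\<alpha>"
        "eval_ipoly \<xi> (dodgson G es vs {es ! a, es ! d} {es ! c, es ! b} {es ! m}) = E' ?\<alpha>"
        "eval_ipoly \<xi> (dodgson G es vs {es ! a, es ! c, es ! m} {es ! d, es ! b, es ! m} {}) = A ?\<alpha>"
        "eval_ipoly \<xi> (dodgson G es vs {es ! a, es ! d, es ! m} {es ! c, es ! b, es ! m} {}) = C ?\<alpha>"
        unfolding eval_dodgson A_def B_def C_def E'_def minor_def pos[OF lt(1) lt(3)] pos[OF lt(4) lt(2)] pos[OF lt(1) lt(4)] pos[OF lt(3) lt(2)]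
          pos3[OF lt(1) lt(3) lt(5)] pos3[OF lt(4) lt(2) lt(5)] pos3[OF lt(1) lt(4) lt(5)] pos3[OF lt(3) lt(2) lt(5)]
        by (rule arg_cong[of _ _ det], rule minor_cong, use sets em m in \<open>auto simp: X_def\<close>)+
      have "five_invariant G es vs (es ! a) (es ! c) (es ! d) (es ! b) (es ! m) =
         dodgson G es vs {es ! a, es ! c} {es ! d, es ! b} {es ! m} * dodgson G es vs {es ! a, es ! d, es ! m} {es ! c, es ! b, es ! m} {}
       - dodgson G es vs {es ! a, es ! d} {es ! c, es ! b} {es ! m} * dodgson G es vs {es ! a, es ! c, es ! m} {es ! d, es ! b, es ! m} {}"
        unfolding five_invariant_def by (rule det_two_rows)
      then have "eval_ipoly \<xi> (five_invariant G es vs (es ! a) (es ! c) (es ! d) (es ! b) (es ! m)) =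
         B ?\<alpha> * C ?\<alpha> - E' ?\<alpha> * A ?\<alpha>"
        by (simp only: h.hom_minus h.hom_mult d)
      moreover have "\<tau> * A ?\<alpha> * E' ?\<alpha> = B ?\<alpha> * (\<tau> * C ?\<alpha>) \<longleftrightarrow> \<tau> * (E' ?\<alpha> * A ?\<alpha>) = \<tau> * (B ?\<alpha> * C ?\<alpha>)"
        by (simp only: ac_simps)
      ultimately show "eval_ipoly \<xi> (five_invariant G es vs (es ! a) (es ! c) (es ! d) (es ! b) (es ! m)) = 0 \<longleftrightarrow>
          \<tau> * A ?\<alpha> * E' ?\<alpha> = B ?\<alpha> * (\<tau> * C ?\<alpha>)"
        using \<tau>0 by auto
    qed
    then show ?thesis unfolding arcs by simp
  qed
  have "q dvd ?T - ?P"
  proof -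
    have "?T - ?P = q * int (card {\<alpha> \<in> supp X. \<tau> * A \<alpha> = 0 \<and> B \<alpha> = 0 \<and> \<tau> * C \<alpha> = 0 \<and> E' \<alpha> = 0})
      - int (card {\<alpha> \<in> supp X. \<tau> * A \<alpha> = 0 \<and> \<tau> * C \<alpha> = 0})" using s P by linarith
    then show ?thesis using AC by simp
  qed
  then have "q ^ 3 dvd q ^ 2 * (?T - ?P)"
    by (simp add: power3_eq_cube power2_eq_square mult_dvd_mono)
  then have "[- (q ^ 2) * ?T = - (q ^ 2) * ?P] (mod q ^ 3)"
    unfolding cong_iff_dvd_diff by (subst dvd_minus_iff[symmetric]) (simp add: algebra_simps)
  with F show ?thesis by (rule cong_trans)
qed

end

text \<open>The factor \<open>Q\<^sup>2\<close> cancels, so the congruence modulo \<open>Q\<^sup>3\<close> determines \<open>c\<close> modulo \<open>Q\<close>.\<close>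

lemma residue_unique:
  fixes Q F P :: int
  assumes Q: "Q > 0" and F: "[F = - (Q ^ 2) * P] (mod Q ^ 3)"
  shows "(THE c. c \<in> {0..<Q} \<and> [F = c * Q ^ 2] (mod Q ^ 3)) = (- P) mod Q"
proof -
  have "c \<in> {0..<Q} \<and> [F = c * Q ^ 2] (mod Q ^ 3) \<longleftrightarrow> c = (- P) mod Q" for c
  proof -
    have e: "- (Q ^ 2) * P - c * Q ^ 2 = Q ^ 2 * (- P - c)" "Q ^ 3 = Q ^ 2 * Q"
      by (simp_all add: algebra_simps power3_eq_cube power2_eq_square)
    have "[F = c * Q ^ 2] (mod Q ^ 3) \<longleftrightarrow> [- (Q ^ 2) * P = c * Q ^ 2] (mod Q ^ 3)"
      using F by (meson cong_sym cong_trans)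
    also have "\<dots> \<longleftrightarrow> [- P = c] (mod Q)"
      unfolding cong_iff_dvd_diff e using Q by simp
    finally have *: "[F = c * Q ^ 2] (mod Q ^ 3) \<longleftrightarrow> [- P = c] (mod Q)" .
    show ?thesis unfolding * using Q by (auto simp: cong_def)
  qed
  then show ?thesis by simp
qed

theorem theorem3:
  fixes G :: "('v, 'e) pre_digraph"
    and es :: "'e list" and vs :: "'v list" and v0 :: 'v
    and e1 e2 e3 e4 e5 :: 'e
    and q :: nat
  assumes "fin_digraph G"
    and "primitive_divergent G"
    and "card (arcs G) \<ge> 5"
    and "distinct es" and "set es = arcs G"
    and "v0 \<in> verts G"
    and "distinct vs" and "set vs = verts G - {v0}"
    and "distinct [e1, e2, e3, e4, e5]" and "{e1, e2, e3, e4, e5} \<subseteq> arcs G"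
    and "q = CARD('k::{finite,field})"
  shows "[c2_invariant TYPE('k) G =
          - int (point_count TYPE('k) (arcs G - {e1, e2, e3, e4, e5})
                  (five_invariant G es vs e1 e2 e3 e4 e5))] (mod (int q))"
proof -
  define E :: "nat \<Rightarrow> nat \<Rightarrow> 'k" where
    "E = (\<lambda>r j. of_bool (tail G (es ! r) = vs ! j) - of_bool (head G (es ! r) = vs ! j))"
  interpret fin_digraph G by fact
  interpret graph_over_field G es vs v0 E "length es" "length vs" "int CARD('k)"
    by unfold_locales (use assms in \<open>simp_all add: E_def\<close>)
  have N: "length es = 2 * length vs" by (rule edges_eq_twice_rank) fact
  have n: "3 \<le> length vs" using assms(3) distinct_card[OF assms(4)] assms(5) N by simp
  have idx: "\<exists>r < length es. es ! r = e" if "e \<in> {e1, e2, e3, e4, e5}" for e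
    using that assms(5,10) by (metis in_set_conv_nth subsetD)
  obtain a c d b m where idx: "a < length es" "es ! a = e1" "c < length es" "es ! c = e2" "d < length es" "es ! d = e3"
    "b < length es" "es ! b = e4" "m < length es" "es ! m = e5"
    using idx[of e1] idx[of e2] idx[of e3] idx[of e4] idx[of e5] by auto
  have dist: "distinct [a, b, c, d, m]" using assms(9) idx by auto
  let ?Q = "int CARD('k)"
  let ?P = "int (point_count TYPE('k) (arcs G - {e1, e2, e3, e4, e5}) (five_invariant G es vs e1 e2 e3 e4 e5))"
  let ?F = "int (point_count TYPE('k) (arcs G) (graph_polynomial G))"
  have F: "[?F = - (?Q ^ 2) * ?P] (mod ?Q ^ 3)"
    using num_singular_eq_five_invariant_count[OF N n idx(1,7,3,5,9) dist] unfolding point_count_graph_polynomial idx .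
  have "c2_invariant TYPE('k) G = (- ?P) mod ?Q"
    unfolding c2_invariant_def by (rule residue_unique[OF _ F]) simp
  then show ?thesis by (simp add: cong_def assms(11))
qed

end
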